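(* Let $X\subseteq\mathbb{R}^d$ be open, let $w\in C^\infty(X)$ be such that the set $\{x\in X:\ w(x)\neq 0\}$ is dense in $X$, and let $\psi:X\to X$ be smooth and injective with $\det J\psi(x)\neq 0$ for all $x\in X$. Consider the following statements. (i) $\psi$ has stable orbits, and for every compact set $K\subseteq X$ and every $n\in\mathbb{N}_0$ we have $$\sup_{m\in\mathbb{N}}\left\|\left(\prod_{j=0}^{m-1}\frac{w(\psi^j(\cdot))}{|\det J\psi(\psi^j(\cdot))|}\right)\circ(\psi^m)^{-1}\right\|_{n,\psi^m(K)}<\infty$$ and $$\forall\,1\le c\le d:\quad \sup_{m\in\mathbb{N}}\left\|(\psi^m)^{-1}_c\right\|_{n,\psi^m(K)}<\infty.$$ (ii) $C_{w,\psi}$ is power bounded on $\mathscr{D}'(X)$. (iii) $\psi$ has stable orbits, and for every compact set $K\subseteq X$ and every $n\in\mathbb{N}_0$ we have $$\sup_{m\in\mathbb{N}}\left\|\left(\prod_{j=0}^{m-1}\frac{w(\psi^j(\cdot))}{|\det J\psi(\psi^j(\cdot))|}\right)\circ(\psi^m)^{-1}\right\|_{n,\psi^m(K)}<\infty.$$ Then (i) implies (ii), and (ii) implies (iii).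
   Context: Notation. $\mathbb{N}=\{1,2,\dots\}$, $\mathbb{N}_0=\mathbb{N}\cup\{0\}$. $J\psi(x)$ is the Jacobian matrix of $\psi$ at $x$; $\psi^m$ is the $m$-th iterate of $\psi$ ($\psi^0=\mathrm{id}$). $\mathscr{D}(X)$ is the space of compactly supported smooth (complex-valued) functions on $X$ with its standard locally convex (inductive limit) topology, and $\mathscr{D}'(X)$ is the space of distributions on $X$, equipped with the strong dual topology (uniform convergence on bounded subsets of $\mathscr{D}(X)$). Under the hypotheses on $\psi$, $\psi^m(X)$ is open in $\mathbb{R}^d$ and $\psi^m:X\to\psi^m(X)$ is a diffeomorphism, so $(\psi^m)^{-1}:\psi^m(X)\to\mathbb{R}^d$ is smooth; its components are denoted $(\psi^m)^{-1}_c$, $1\le c\le d$. For $Y\subseteq\mathbb{R}^d$ open, $K\subseteq Y$ compact, $n\in\mathbb{N}_0$ and $f\in C^\infty(Y)$, put $\|f\|_{n,K}:=\sup_{|\alpha|\le n,\,x\in K}|\partial^\alpha f(x)|$. Weighted composition operator: for $w\in C^\infty(X)$ and smooth $\psi:X\to X$ with $\det J\psi(x)\ne0$ for all $x\in X$, $C_{w,\psi}$ is the unique continuous linear operator on $\mathscr{D}'(X)$ extending $C(X)\ni f\mapsto w\cdot(f\circ\psi)$. For injective $\psi$ it is given by $\langle C_{w,\psi}(u),\varphi\rangle=\langle u,(\varphi\, w/|\det J\psi|)\circ\psi^{-1}\rangle$ for $\varphi\in\mathscr{D}(X)$, where the function on $\psi(X)$ is extended by zero to $X$. Power bounded: a continuous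 linear operator $T$ on a locally convex space $E$ is power bounded if for every continuous seminorm $p$ on $E$ there is a continuous seminorm $q$ on $E$ such that $p(T^m(x))\le q(x)$ for all $m\in\mathbb{N}$ and $x\in E$. Stable orbits: a continuous map $\psi:X\to X$ has stable orbits if for every compact $K\subseteq X$ there is a compact $L\subseteq X$ with $\psi^m(K)\subseteq L$ for every $m\in\mathbb{N}$. *)

theory Defs
  imports "HOL-Analysis.Analysis"
begin

section \<open>Smooth functions\<close>

definition partial_derivative ::
    "'n::finite \<Rightarrow> (real^'n \<Rightarrow> 'b::real_normed_vector) \<Rightarrow> real^'n \<Rightarrow> 'b" where
  "partial_derivative i f x = vector_derivative (\<lambda>t. f (x + t *\<^sub>R axis i 1)) (at 0)"

text \<open>
  A derivative of order \<open>k\<close> is indexed by the list, of length \<open>k\<close>, of the coordinates in which one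
  differentiates. By the symmetry of mixed derivatives, the derivatives of a smooth function along
  lists of length at most \<open>n\<close> are precisely its derivatives along multi-indices \<open>\<alpha>\<close> with
  \<open>|\<alpha>| \<le> n\<close>.
\<close>

primrec iterated_partial ::
    "'n::finite list \<Rightarrow> (real^'n \<Rightarrow> 'b::real_normed_vector) \<Rightarrow> real^'n \<Rightarrow> 'b" where
  "iterated_partial [] f = f"
| "iterated_partial (i # is) f = partial_derivative i (iterated_partial is f)"

text \<open>
  In the following, functions on an open set \<open>X\<close> are total functions of which only the values on \<open>X\<close>
  are relevant (derivatives at points of an open set depend only on the values on that set).
\<close>

definition smooth_on ::
    "(real^'n::finite) set \<Rightarrow> (real^'n \<Rightarrow> 'b::real_normed_vector) \<Rightarrow> bool" where
  "smooth_on X f \<longleftrightarrow> (\<forall>is. \<forall>x\<in>X. iterated_partial is f differentiable (at x))"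

text \<open>The norm \<open>\<parallel>f\<parallel>\<close> with indices \<open>n, K\<close>. It takes extended values; it is \<open>0\<close> for empty \<open>K\<close>.\<close>

definition Cn_norm ::
    "nat \<Rightarrow> (real^'n::finite) set \<Rightarrow> (real^'n \<Rightarrow> 'b::real_normed_vector) \<Rightarrow> ennreal" where
  "Cn_norm n K f = (SUP is\<in>{is. length is \<le> n}. SUP x\<in>K. ennreal (norm (iterated_partial is f x)))"


section \<open>Locally convex spaces of complex-valued functions\<close>

text \<open>
  A locally convex space is given by its carrier \<open>V\<close>, a set of complex-valued functions that is closed
  under the pointwise vector space operations, and a topology on \<open>V\<close>.
\<close>

definition seminorm_on :: "('a \<Rightarrow> complex) set \<Rightarrow> (('a \<Rightarrow> complex) \<Rightarrow> real) \<Rightarrow> bool" where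
  "seminorm_on V p \<longleftrightarrow>
     (\<forall>f\<in>V. \<forall>g\<in>V. p (\<lambda>x. f x + g x) \<le> p f + p g) \<and>
     (\<forall>c. \<forall>f\<in>V. p (\<lambda>x. c * f x) = cmod c * p f)"

definition seminorm_topology ::
    "('a \<Rightarrow> complex) set \<Rightarrow> (('a \<Rightarrow> complex) \<Rightarrow> real) set \<Rightarrow> ('a \<Rightarrow> complex) topology" where
  "seminorm_topology V P =
     topology_generated_by {{g \<in> V. p (\<lambda>x. g x - f x) < e} | p f e. p \<in> P \<and> f \<in> V \<and> 0 < e}"

definition continuous_seminorm ::
    "('a \<Rightarrow> complex) set \<Rightarrow> ('a \<Rightarrow> complex) topology \<Rightarrow> (('a \<Rightarrow> complex) \<Rightarrow> real) \<Rightarrow> bool" where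
  "continuous_seminorm V \<tau> p \<longleftrightarrow> seminorm_on V p \<and> continuous_map \<tau> euclideanreal p"

definition bounded_subset ::
    "('a \<Rightarrow> complex) set \<Rightarrow> ('a \<Rightarrow> complex) topology \<Rightarrow> ('a \<Rightarrow> complex) set \<Rightarrow> bool" where
  "bounded_subset V \<tau> B \<longleftrightarrow> B \<subseteq> V \<and>
     (\<forall>U. openin \<tau> U \<and> (\<lambda>_. 0) \<in> U \<longrightarrow>
        (\<exists>r>0. \<forall>c. r \<le> cmod c \<longrightarrow> B \<subseteq> (\<lambda>f x. c * f x) ` U))"

definition continuous_linear_operator ::
    "('a \<Rightarrow> complex) set \<Rightarrow> ('a \<Rightarrow> complex) topology \<Rightarrow>
     (('a \<Rightarrow> complex) \<Rightarrow> ('a \<Rightarrow> complex)) \<Rightarrow> bool" where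
  "continuous_linear_operator V \<tau> T \<longleftrightarrow>
     T \<in> V \<rightarrow> V \<and>
     (\<forall>f\<in>V. \<forall>g\<in>V. T (\<lambda>x. f x + g x) = (\<lambda>x. T f x + T g x)) \<and>
     (\<forall>c. \<forall>f\<in>V. T (\<lambda>x. c * f x) = (\<lambda>x. c * T f x)) \<and>
     continuous_map \<tau> \<tau> T"

definition power_bounded ::
    "('a \<Rightarrow> complex) set \<Rightarrow> ('a \<Rightarrow> complex) topology \<Rightarrow>
     (('a \<Rightarrow> complex) \<Rightarrow> ('a \<Rightarrow> complex)) \<Rightarrow> bool" where
  "power_bounded V \<tau> T \<longleftrightarrow>
     continuous_linear_operator V \<tau> T \<and>
     (\<forall>p. continuous_seminorm V \<tau> p \<longrightarrow>
        (\<exists>q. continuous_seminorm V \<tau> q \<and> (\<forall>m\<ge>1. \<forall>f\<in>V. p ((T ^^ m) f) \<le> q f)))"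


section \<open>Test functions and distributions\<close>

text \<open>Test functions on \<open>X\<close> are extended by zero to the whole space.\<close>

definition test_functions_on :: "(real^'n::finite) set \<Rightarrow> (real^'n \<Rightarrow> complex) set" where
  "test_functions_on K = {\<phi>. smooth_on UNIV \<phi> \<and> closure {x. \<phi> x \<noteq> 0} \<subseteq> K}"

definition test_functions :: "(real^'n::finite) set \<Rightarrow> (real^'n \<Rightarrow> complex) set" where
  "test_functions X =
     {\<phi>. smooth_on UNIV \<phi> \<and> compact (closure {x. \<phi> x \<noteq> 0}) \<and> closure {x. \<phi> x \<noteq> 0} \<subseteq> X}"

definition test_functions_on_topology ::
    "(real^'n::finite) set \<Rightarrow> (real^'n \<Rightarrow> complex) topology" where
  "test_functions_on_topology K =
     seminorm_topology (test_functions_on K) (range (\<lambda>n \<phi>. enn2real (Cn_norm n K \<phi>)))"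

text \<open>
  The locally convex inductive limit topology, i.e. the finest locally convex topology for which the
  inclusions of the spaces \<open>test_functions_on K\<close>, for compact \<open>K \<subseteq> X\<close>, are continuous: it is generated
  by all seminorms whose restrictions to these spaces are continuous.
\<close>

definition test_functions_topology ::
    "(real^'n::finite) set \<Rightarrow> (real^'n \<Rightarrow> complex) topology" where
  "test_functions_topology X =
     seminorm_topology (test_functions X)
       {p. seminorm_on (test_functions X) p \<and>
           (\<forall>K. compact K \<and> K \<subseteq> X \<longrightarrow>
              continuous_map (test_functions_on_topology K) euclideanreal p)}"

text \<open>
  A distribution is represented by a function on all functions that vanishes off the test functions,
  so that distributions are equal iff they agree on test functions.
\<close>

definition distributions ::
    "(real^'n::finite) set \<Rightarrow> ((real^'n \<Rightarrow> complex) \<Rightarrow> complex) set" where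
  "distributions X =
     {u. (\<forall>\<phi>\<in>test_functions X. \<forall>\<theta>\<in>test_functions X. u (\<lambda>x. \<phi> x + \<theta> x) = u \<phi> + u \<theta>) \<and>
         (\<forall>c. \<forall>\<phi>\<in>test_functions X. u (\<lambda>x. c * \<phi> x) = c * u \<phi>) \<and>
         continuous_map (test_functions_topology X) euclidean u \<and>
         (\<forall>\<phi>. \<phi> \<notin> test_functions X \<longrightarrow> u \<phi> = 0)}"

definition strong_dual_topology ::
    "(real^'n::finite) set \<Rightarrow> ((real^'n \<Rightarrow> complex) \<Rightarrow> complex) topology" where
  "strong_dual_topology X =
     seminorm_topology (distributions X)
       {\<lambda>u. SUP \<phi>\<in>B. cmod (u \<phi>) | B.
          B \<noteq> {} \<and> bounded_subset (test_functions X) (test_functions_topology X) B}"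

definition regular_distribution ::
    "(real^'n::finite) set \<Rightarrow> (real^'n \<Rightarrow> complex) \<Rightarrow> (real^'n \<Rightarrow> complex) \<Rightarrow> complex" where
  "regular_distribution X f =
     (\<lambda>\<phi>. if \<phi> \<in> test_functions X then (LINT x:X|lebesgue. f x * \<phi> x) else 0)"


section \<open>Weighted composition operators\<close>

text \<open>
  \<open>C\<close> is the operator \<open>C\<^bsub>w,\<psi>\<^esub>\<close>: it is the continuous linear operator on the distributions that extends
  \<open>f \<mapsto> w \<cdot> (f \<circ> \<psi>)\<close>. It is determined on \<open>distributions X\<close> since the continuous functions
  are dense there; its values elsewhere are irrelevant.
\<close>

definition weighted_composition_operator ::
    "(real^'n::finite) set \<Rightarrow> (real^'n \<Rightarrow> complex) \<Rightarrow> (real^'n \<Rightarrow> real^'n) \<Rightarrow>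
     (((real^'n \<Rightarrow> complex) \<Rightarrow> complex) \<Rightarrow> ((real^'n \<Rightarrow> complex) \<Rightarrow> complex)) \<Rightarrow> bool" where
  "weighted_composition_operator X w \<psi> C \<longleftrightarrow>
     continuous_linear_operator (distributions X) (strong_dual_topology X) C \<and>
     (\<forall>f. continuous_on X f \<longrightarrow>
        C (regular_distribution X f) = regular_distribution X (\<lambda>x. w x * f (\<psi> x)))"

definition stable_orbits :: "'a::topological_space set \<Rightarrow> ('a \<Rightarrow> 'a) \<Rightarrow> bool" where
  "stable_orbits X \<psi> \<longleftrightarrow>
     (\<forall>K. compact K \<and> K \<subseteq> X \<longrightarrow> (\<exists>L. compact L \<and> L \<subseteq> X \<and> (\<forall>m\<ge>1. (\<psi> ^^ m) ` K \<subseteq> L)))"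

definition weight_product ::
    "(real^'n::finite \<Rightarrow> complex) \<Rightarrow> (real^'n \<Rightarrow> real^'n) \<Rightarrow> nat \<Rightarrow> real^'n \<Rightarrow> complex" where
  "weight_product w \<psi> m x =
     (\<Prod>j<m. w ((\<psi> ^^ j) x) / complex_of_real \<bar>det (jacobian \<psi> (at ((\<psi> ^^ j) x)))\<bar>)"

definition weight_condition ::
    "(real^'n::finite) set \<Rightarrow> (real^'n \<Rightarrow> complex) \<Rightarrow> (real^'n \<Rightarrow> real^'n) \<Rightarrow> bool" where
  "weight_condition X w \<psi> \<longleftrightarrow>
     (\<forall>K n. compact K \<and> K \<subseteq> X \<longrightarrow>
        (SUP m\<in>{1..}. Cn_norm n ((\<psi> ^^ m) ` K) (weight_product w \<psi> m \<circ> inv_into X (\<psi> ^^ m))) < \<infinity>)"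

definition inverse_condition ::
    "(real^'n::finite) set \<Rightarrow> (real^'n \<Rightarrow> real^'n) \<Rightarrow> bool" where
  "inverse_condition X \<psi> \<longleftrightarrow>
     (\<forall>K n. compact K \<and> K \<subseteq> X \<longrightarrow>
        (\<forall>c. (SUP m\<in>{1..}. Cn_norm n ((\<psi> ^^ m) ` K) (\<lambda>y. inv_into X (\<psi> ^^ m) y $ c)) < \<infinity>))"

end

theory Submission
  imports Defs
begin

text \<open>
  The transpose of \<open>C\<close> acts on test functions by
  \<open>T \<phi> = (\<phi> \<cdot> w / |det J\<psi>|) \<circ> \<psi>\<^sup>-\<^sup>1\<close> on \<open>\<psi>(X)\<close>, extended by zero. For a continuous function \<open>f\<close>
  the change of variables formula gives \<open>\<langle>C f, \<phi>\<rangle> = \<langle>f, T \<phi>\<rangle>\<close>. Since \<open>C\<close> is continuous and the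
  continuous functions are dense in the strong dual, \<open>\<langle>C u, \<phi>\<rangle> = \<langle>u, T \<phi>\<rangle>\<close> for every distribution
  \<open>u\<close> (\<open>operator_eq_transposed\<close>). Hence \<open>\<langle>C\<^sup>m u, \<phi>\<rangle> = \<langle>u, T\<^sup>m \<phi>\<rangle>\<close>, where \<open>T\<^sup>m \<phi>\<close> is the product of the
  weight \<open>W\<^sub>m \<circ> (\<psi>\<^sup>m)\<^sup>-\<^sup>1\<close> with \<open>\<phi> \<circ> (\<psi>\<^sup>m)\<^sup>-\<^sup>1\<close> on \<open>\<psi>\<^sup>m(X)\<close> and zero elsewhere. Power boundedness of \<open>C\<close> is a
  statement about the orbits of bounded sets of test functions under \<open>T\<close>.

  Such a set is bounded iff its members are supported in one compact subset of \<open>X\<close> and all their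
  derivatives are uniformly bounded (\<open>bounded_test_functions_iff\<close>). If the orbits of \<open>\<psi>\<close> are stable
  and the derivatives of \<open>W\<^sub>m \<circ> (\<psi>\<^sup>m)\<^sup>-\<^sup>1\<close> and of the components of \<open>(\<psi>\<^sup>m)\<^sup>-\<^sup>1\<close> are bounded in \<open>m\<close>, then the
  Leibniz rule and the chain rule bound \<open>T\<^sup>m \<phi>\<close> uniformly for \<open>m \<ge> 1\<close> and \<open>\<phi>\<close> in a bounded set \<open>B\<close>. So
  \<open>\<Union>\<^sub>m T\<^sup>m B\<close> is bounded, and its seminorm dominates \<open>u \<mapsto> sup\<^sub>B |C\<^sup>m u|\<close> for all \<open>m\<close>
  (\<open>power_bounded_if\<close>).

  Conversely, for each test function \<open>\<phi>\<close> power boundedness bounds \<open>|u(T\<^sup>m \<phi>)|\<close> by a multiple of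
  \<open>sup\<^sub>B |u|\<close>, with one bounded set \<open>B\<close> for all \<open>m \<ge> 1\<close> and all distributions \<open>u\<close>. Taking for \<open>u\<close> the derivatives of point evaluations shows that all
  \<open>T\<^sup>m \<phi>\<close> are supported in one compact set \<open>L\<close> and have uniformly bounded derivatives
  (\<open>power_bounded_orbit_bounds\<close>). Let \<open>\<phi>\<close> be \<open>1\<close> on a ball. There \<open>T\<^sup>m \<phi> \<circ> \<psi>\<^sup>m = W\<^sub>m\<close>, and the
  zeros of \<open>W\<^sub>m\<close> have empty interior, so \<open>\<psi>\<^sup>m\<close> maps the ball into \<open>L\<close>; and the derivatives of
  \<open>W\<^sub>m \<circ> (\<psi>\<^sup>m)\<^sup>-\<^sup>1\<close> on the image of the ball are those of \<open>T\<^sup>m \<phi>\<close>. Covering a compact set by finitely many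
  such balls gives the stability of the orbits and the bounds on the weights (\<open>power_bounded_imp\<close>).

  The density of the continuous functions is proved by a discretized mollification: convolution with a
  mollifier \<open>R\<close> is close to the identity, and replacing the convolution integral by a sum over a fine
  partition of unity turns \<open>\<phi>\<close> into a finite combination of translates of \<open>R\<close>, on which a distribution
  acts as a continuous function (\<open>regular_distributions_dense\<close>).
\<close>

section \<open>Iterated partial derivatives and their bounds\<close>

text \<open>
  Differentiability up to a finite order is what the inductions below run on: the formula for the
  derivative of a product, composition or inverse involves the same operation again, with one order less.
\<close>

definition smooth_upto ::
    "nat \<Rightarrow> (real^'n::finite) set \<Rightarrow> (real^'n \<Rightarrow> 'b::real_normed_vector) \<Rightarrow> bool" where
  "smooth_upto k X f \<longleftrightarrow>
     (\<forall>is. length is \<le> k \<longrightarrow> (\<forall>x\<in>X. iterated_partial is f differentiable (at x)))"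

text \<open>
  Working at a single point lets the same estimates serve on compact sets that vary with a parameter.
\<close>

definition jet_bound ::
    "nat \<Rightarrow> (real^'n::finite \<Rightarrow> 'b::real_normed_vector) \<Rightarrow> real^'n \<Rightarrow> real \<Rightarrow> bool" where
  "jet_bound k f x A \<longleftrightarrow> (\<forall>is. length is \<le> k \<longrightarrow> norm (iterated_partial is f x) \<le> A)"

lemma has_derivative_partial:
  assumes "(f has_derivative D) (at x)"
  shows "((\<lambda>t. f (x + t *\<^sub>R axis i 1)) has_vector_derivative D (axis i 1)) (at 0)"
proof -
  have "((\<lambda>t. f (x + t *\<^sub>R axis i 1)) has_derivative (\<lambda>t. D (t *\<^sub>R axis i 1))) (at 0)"
    by (rule has_derivative_compose[where f="\<lambda>t. x + t *\<^sub>R axis i 1" and g=f])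
       (use assms in \<open>auto intro!: derivative_eq_intros\<close>)
  moreover have "D (t *\<^sub>R axis i 1) = t *\<^sub>R D (axis i 1)" for t
    using assms has_derivative_linear linear_cmul by blast
  ultimately show ?thesis
    by (simp add: has_vector_derivative_def)
qed

lemma partial_derivative_eqI:
  assumes "(f has_derivative D) (at x)"
  shows "partial_derivative i f x = D (axis i 1)"
  unfolding partial_derivative_def
  by (rule vector_derivative_at[OF has_derivative_partial[OF assms]])

lemma has_derivative_sum_partial:
  assumes "f differentiable (at x)"
  shows "(f has_derivative (\<lambda>h. \<Sum>i\<in>UNIV. (h $ i) *\<^sub>R partial_derivative i f x)) (at x)"
proof -
  obtain D where D: "(f has_derivative D) (at x)"
    using assms by (auto simp: differentiable_def)
  have lin: "linear D" using D has_derivative_linear by blast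
  have "D h = (\<Sum>i\<in>UNIV. (h $ i) *\<^sub>R partial_derivative i f x)" for h
  proof -
    have "D h = D (\<Sum>i\<in>UNIV. (h $ i) *\<^sub>R axis i 1)"
      by (metis basis_expansion scalar_mult_eq_scaleR)
    also have "\<dots> = (\<Sum>i\<in>UNIV. (h $ i) *\<^sub>R D (axis i 1))"
      by (simp add: linear_sum[OF lin] linear_cmul[OF lin])
    finally show ?thesis by (simp add: partial_derivative_eqI[OF D])
  qed
  then have "D = (\<lambda>h. \<Sum>i\<in>UNIV. (h $ i) *\<^sub>R partial_derivative i f x)" by auto
  with D show ?thesis by simp
qed

lemma iterated_partial_append:
  "iterated_partial (is @ js) f = iterated_partial is (iterated_partial js f)"
  by (induction "is") auto

lemma partial_derivative_cong:
  assumes "open X" "x \<in> X" "\<And>x. x \<in> X \<Longrightarrow> f x = g x"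
  shows "partial_derivative i f x = partial_derivative i g x"
proof -
  have "\<forall>\<^sub>F t in nhds (0::real). x + t *\<^sub>R axis i 1 \<in> X"
  proof (rule eventually_nhds_in_open[of "(\<lambda>t. x + t *\<^sub>R axis i 1) -` X" 0, simplified vimage_eq])
    show "open ((\<lambda>t::real. x + t *\<^sub>R axis i 1) -` X)"
      by (intro open_vimage assms continuous_intros)
  qed (use assms in auto)
  then have "\<forall>\<^sub>F t in nhds 0. f (x + t *\<^sub>R axis i 1) = g (x + t *\<^sub>R axis i 1)"
    by eventually_elim (use assms in auto)
  then show ?thesis
    unfolding partial_derivative_def
    by (intro vector_derivative_cong_eq) auto
qed

lemma iterated_partial_cong:
  assumes "open X" "\<And>x. x \<in> X \<Longrightarrow> f x = g x" "x \<in> X"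
  shows "iterated_partial is f x = iterated_partial is g x"
  using assms(3)
proof (induction "is" arbitrary: x)
  case (Cons i "is")
  then show ?case using partial_derivative_cong[OF assms(1)] by (metis iterated_partial.simps(2))
qed (simp add: assms(2))

lemma differentiable_cong_open:
  assumes "open X" "x \<in> X" "\<And>x. x \<in> X \<Longrightarrow> f x = g x" "f differentiable (at x)"
  shows "g differentiable (at x)"
proof -
  obtain D where D: "(f has_derivative D) (at x)"
    using assms(4) by (auto simp: differentiable_def)
  have "(g has_derivative D) (at x)"
    by (rule has_derivative_transform_within_open[OF D assms(1,2)]) (rule assms(3))
  then show ?thesis by (auto simp: differentiable_def)
qed

lemma smooth_upto_cong:
  assumes "open X" "\<And>x. x \<in> X \<Longrightarrow> f x = g x" "smooth_upto k X f"
  shows "smooth_upto k X g"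
  unfolding smooth_upto_def
proof (intro allI impI ballI)
  fix "is" :: "'a list" and x assume "length is \<le> k" "x \<in> X"
  show "iterated_partial is g differentiable (at x)"
  proof (rule differentiable_cong_open[OF assms(1) \<open>x \<in> X\<close>])
    show "iterated_partial is f y = iterated_partial is g y" if "y \<in> X" for y
      by (rule iterated_partial_cong[OF assms(1) _ that]) (rule assms(2))
    show "iterated_partial is f differentiable (at x)"
      using assms(3) \<open>x \<in> X\<close> \<open>length is \<le> k\<close> by (simp add: smooth_upto_def)
  qed
qed

lemma smooth_on_iff_upto: "smooth_on X f \<longleftrightarrow> (\<forall>k. smooth_upto k X f)"
  unfolding smooth_on_def smooth_upto_def by blast

lemma smooth_on_cong:
  assumes "open X" "\<And>x. x \<in> X \<Longrightarrow> f x = g x" "smooth_on X f"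
  shows "smooth_on X g"
  unfolding smooth_on_iff_upto
proof
  fix k show "smooth_upto k X g"
    by (rule smooth_upto_cong[OF assms(1), where f=f])
       (use assms(2,3) in \<open>simp_all add: smooth_on_iff_upto\<close>)
qed

lemma smooth_on_subset: "smooth_on X f \<Longrightarrow> Y \<subseteq> X \<Longrightarrow> smooth_on Y f"
  by (auto simp: smooth_on_def)

lemma smooth_on_union: "smooth_on X f \<Longrightarrow> smooth_on Y f \<Longrightarrow> smooth_on (X \<union> Y) f"
  by (auto simp: smooth_on_def)

lemma smooth_on_iterated: "smooth_on X f \<Longrightarrow> smooth_on X (iterated_partial is f)"
  unfolding smooth_on_def by (metis iterated_partial_append)

lemma smooth_on_imp_differentiable: "smooth_on X f \<Longrightarrow> x \<in> X \<Longrightarrow> f differentiable (at x)"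
  unfolding smooth_on_def by (metis iterated_partial.simps(1))

lemma smooth_on_imp_continuous_on: "smooth_on X f \<Longrightarrow> continuous_on X f"
  by (meson continuous_at_imp_continuous_on differentiable_imp_continuous_within smooth_on_imp_differentiable)

lemma smooth_upto_0: "smooth_upto 0 X f \<longleftrightarrow> (\<forall>x\<in>X. f differentiable (at x))"
  by (simp add: smooth_upto_def)

text \<open>
  Lists of differentiations are peeled from their end, that is, the derivative that is applied first
  comes first. The derivatives of \<open>f\<close> are then those of its first partial derivatives, and mixed
  derivatives never have to be interchanged.
\<close>

lemma smooth_upto_Suc:
  "smooth_upto (Suc k) X f \<longleftrightarrow>
     (\<forall>x\<in>X. f differentiable (at x)) \<and> (\<forall>i. smooth_upto k X (partial_derivative i f))"
proof safe
  fix i assume *: "smooth_upto (Suc k) X f"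
  then show "smooth_upto k X (partial_derivative i f)"
    unfolding smooth_upto_def
    using iterated_partial_append[where js="[i]" and f=f] by (metis Suc_le_mono iterated_partial.simps length_append_singleton)
next
  fix x assume *: "smooth_upto (Suc k) X f" "x \<in> X"
  then show "f differentiable (at x)"
    unfolding smooth_upto_def by (metis iterated_partial.simps(1) le0 list.size(3))
next
  assume *: "\<forall>x\<in>X. f differentiable (at x)" "\<forall>i. smooth_upto k X (partial_derivative i f)"
  show "smooth_upto (Suc k) X f"
    unfolding smooth_upto_def
  proof (intro allI impI ballI)
    fix "is" :: "'a list" and x assume "length is \<le> Suc k" "x \<in> X"
    then show "iterated_partial is f differentiable (at x)"
      using * by (cases "is" rule: rev_cases) (auto simp: smooth_upto_def iterated_partial_append)
  qed
qed

lemma smooth_upto_mono: "smooth_upto k X f \<Longrightarrow> l \<le> k \<Longrightarrow> smooth_upto l X f"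
  by (auto simp: smooth_upto_def)

lemma jet_bound_0: "jet_bound 0 f x A \<longleftrightarrow> norm (f x) \<le> A"
  by (simp add: jet_bound_def)

lemma jet_bound_Suc:
  "jet_bound (Suc k) f x A \<longleftrightarrow>
     norm (f x) \<le> A \<and> (\<forall>i. jet_bound k (partial_derivative i f) x A)"
proof safe
  fix i assume *: "jet_bound (Suc k) f x A"
  then show "jet_bound k (partial_derivative i f) x A"
    unfolding jet_bound_def
    using iterated_partial_append[where js="[i]" and f=f] by (metis Suc_le_mono iterated_partial.simps length_append_singleton)
next
  assume *: "jet_bound (Suc k) f x A"
  then show "norm (f x) \<le> A"
    unfolding jet_bound_def by (metis iterated_partial.simps(1) le0 list.size(3))
next
  assume *: "norm (f x) \<le> A" "\<forall>i. jet_bound k (partial_derivative i f) x A"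
  show "jet_bound (Suc k) f x A"
    unfolding jet_bound_def
  proof (intro allI impI ballI)
    fix "is" :: "'a list" assume "length is \<le> Suc k"
    then show "norm (iterated_partial is f x) \<le> A"
      using * by (cases "is" rule: rev_cases) (auto simp: jet_bound_def iterated_partial_append)
  qed
qed

lemma jet_bound_mono: "jet_bound k f x A \<Longrightarrow> l \<le> k \<Longrightarrow> A \<le> B \<Longrightarrow> jet_bound l f x B"
  unfolding jet_bound_def by (meson le_trans order_trans)

lemma jet_bound_nonneg: "jet_bound k f x A \<Longrightarrow> 0 \<le> A"
  unfolding jet_bound_def
  by (metis dual_order.trans iterated_partial.simps(1) le0 list.size(3) norm_ge_zero)

lemma jet_bound_cong:
  assumes "open X" "\<And>x. x \<in> X \<Longrightarrow> f x = g x" "x \<in> X" "jet_bound k f x A"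
  shows "jet_bound k g x A"
proof -
  have "iterated_partial is f x = iterated_partial is g x" for "is"
    by (rule iterated_partial_cong[OF assms(1) _ assms(3)]) (rule assms(2))
  then show ?thesis using assms(4) by (simp add: jet_bound_def)
qed

lemma (in bounded_linear) iterated_partial_linear:
  fixes g :: "real^'n::finite \<Rightarrow> 'a"
  assumes X: "open X" and g: "smooth_on X g" and "x \<in> X"
  shows "iterated_partial is (\<lambda>x. f (g x)) x = f (iterated_partial is g x)"
  using \<open>x \<in> X\<close>
proof (induction "is" arbitrary: x)
  case (Cons i "is")
  have "partial_derivative i (iterated_partial is (\<lambda>x. f (g x))) x
      = partial_derivative i (\<lambda>x. f (iterated_partial is g x)) x"
    using Cons by (intro partial_derivative_cong[OF X]) auto
  also have "\<dots> = f (partial_derivative i (iterated_partial is g) x)"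
  proof -
    obtain D where D: "(iterated_partial is g has_derivative D) (at x)"
      using g Cons.prems by (auto simp: smooth_on_def differentiable_def)
    have "((\<lambda>x. f (iterated_partial is g x)) has_derivative (\<lambda>h. f (D h))) (at x)"
      by (rule has_derivative[OF D])
    with D show ?thesis by (simp add: partial_derivative_eqI)
  qed
  finally show ?case by simp
qed auto

lemma (in bounded_linear) smooth_on_linear:
  fixes g :: "real^'n::finite \<Rightarrow> 'a"
  assumes X: "open X" and g: "smooth_on X g"
  shows "smooth_on X (\<lambda>x. f (g x))"
  unfolding smooth_on_def
proof (intro allI ballI)
  fix "is" :: "'n list" and x assume x: "x \<in> X"
  show "iterated_partial is (\<lambda>x. f (g x)) differentiable (at x)"
  proof (rule differentiable_cong_open[OF X x])
    show "f (iterated_partial is g x) = iterated_partial is (\<lambda>x. f (g x)) x" if "x \<in> X" for x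
      using iterated_partial_linear[OF X g that] by simp
    obtain D where D: "(iterated_partial is g has_derivative D) (at x)"
      using g x by (auto simp: smooth_on_def differentiable_def)
    show "(\<lambda>x. f (iterated_partial is g x)) differentiable (at x)"
      using has_derivative[OF D] by (auto simp: differentiable_def)
  qed
qed

lemma iterated_partial_add:
  fixes f g :: "real^'n::finite \<Rightarrow> 'b::real_normed_vector"
  assumes X: "open X" and f: "smooth_upto k X f" and g: "smooth_upto k X g" and "x \<in> X" "length is \<le> Suc k"
  shows "iterated_partial is (\<lambda>x. f x + g x) x = iterated_partial is f x + iterated_partial is g x"
  using \<open>x \<in> X\<close> \<open>length is \<le> Suc k\<close>
proof (induction "is" arbitrary: x)
  case (Cons i "is")
  have "partial_derivative i (iterated_partial is (\<lambda>x. f x + g x)) x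
      = partial_derivative i (\<lambda>x. iterated_partial is f x + iterated_partial is g x) x"
    using Cons by (intro partial_derivative_cong[OF X]) auto
  also have "\<dots> = partial_derivative i (iterated_partial is f) x + partial_derivative i (iterated_partial is g) x"
  proof -
    obtain D E where D: "(iterated_partial is f has_derivative D) (at x)"
      and E: "(iterated_partial is g has_derivative E) (at x)"
      using f g Cons.prems by (force simp: smooth_upto_def differentiable_def)
    show ?thesis
      using partial_derivative_eqI[OF has_derivative_add[OF D E]]
      by (simp add: partial_derivative_eqI[OF D] partial_derivative_eqI[OF E])
  qed
  finally show ?case by simp
qed auto

lemma smooth_upto_add:
  fixes f g :: "real^'n::finite \<Rightarrow> 'b::real_normed_vector"
  assumes X: "open X" and f: "smooth_upto k X f" and g: "smooth_upto k X g"
  shows "smooth_upto k X (\<lambda>x. f x + g x)"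
  unfolding smooth_upto_def
proof (intro allI impI ballI)
  fix "is" :: "'n list" and x assume x: "length is \<le> k" "x \<in> X"
  show "iterated_partial is (\<lambda>x. f x + g x) differentiable (at x)"
    by (rule differentiable_cong_open[OF X x(2), where f="\<lambda>x. iterated_partial is f x + iterated_partial is g x"])
       (use f g x iterated_partial_add[OF X f g] in \<open>auto simp: smooth_upto_def\<close>)
qed

lemma partial_derivative_const: "partial_derivative i (\<lambda>x. c) = (\<lambda>x. 0)"
  by (auto simp: partial_derivative_def)

lemma iterated_partial_const: "iterated_partial is (\<lambda>x. c) = (\<lambda>x. if is = [] then c else 0)"
  by (induction "is") (auto simp: partial_derivative_const)

lemma smooth_on_const: "smooth_on X (\<lambda>x. c)"
  unfolding smooth_on_def by (simp add: iterated_partial_const)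

lemma smooth_upto_const: "smooth_upto k X (\<lambda>x. c)"
  by (metis smooth_on_const smooth_on_iff_upto)

lemma smooth_upto_sum:
  assumes "open X" "\<And>j. j \<in> J \<Longrightarrow> smooth_upto k X (f j)"
  shows "smooth_upto k X (\<lambda>x. \<Sum>j\<in>J. f j x)"
  using assms(2)
proof (induction J rule: infinite_finite_induct)
  case (insert j J)
  have "smooth_upto k X (\<lambda>x. f j x + (\<Sum>j\<in>J. f j x))"
    by (rule smooth_upto_add[OF assms(1)]) (use insert in simp_all)
  then show ?case using insert(1,2) by simp
qed (simp_all add: smooth_upto_const)

lemma smooth_on_sum:
  assumes "open X" "\<And>j. j \<in> J \<Longrightarrow> smooth_on X (f j)"
  shows "smooth_on X (\<lambda>x. \<Sum>j\<in>J. f j x)"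
  unfolding smooth_on_iff_upto
  by (intro allI smooth_upto_sum assms(1)) (use assms(2) in \<open>simp add: smooth_on_iff_upto\<close>)

lemma iterated_partial_sum:
  assumes "open X" "\<And>j. j \<in> J \<Longrightarrow> smooth_on X (f j)" "x \<in> X"
  shows "iterated_partial is (\<lambda>x. \<Sum>j\<in>J. f j x) x = (\<Sum>j\<in>J. iterated_partial is (f j) x)"
  using assms(2)
proof (induction J rule: infinite_finite_induct)
  case (insert j J)
  have "smooth_upto (length is) X (f j)" "smooth_upto (length is) X (\<lambda>x. \<Sum>j\<in>J. f j x)"
    using insert assms smooth_on_sum[OF assms(1), of J f] by (auto simp: smooth_on_iff_upto)
  from iterated_partial_add[OF assms(1) this assms(3)] show ?case using insert by simp
qed (auto simp: iterated_partial_const)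

lemma (in bounded_bilinear) partial_derivative_prod:
  assumes "f differentiable (at x)" "g differentiable (at x)"
  shows "partial_derivative i (\<lambda>x. prod (f x) (g x)) x
    = prod (f x) (partial_derivative i g x) + prod (partial_derivative i f x) (g x)"
proof -
  obtain D E where D: "(f has_derivative D) (at x)" and E: "(g has_derivative E) (at x)"
    using assms by (auto simp: differentiable_def)
  show ?thesis
    using partial_derivative_eqI[OF FDERIV[OF D E]] by (simp add: partial_derivative_eqI[OF D] partial_derivative_eqI[OF E])
qed

lemma (in bounded_bilinear) differentiable_prod:
  assumes "f differentiable (at x)" "g differentiable (at x)"
  shows "(\<lambda>x. prod (f x) (g x)) differentiable (at x)"
proof -
  obtain D E where "(f has_derivative D) (at x)" "(g has_derivative E) (at x)"
    using assms by (auto simp: differentiable_def)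
  from FDERIV[OF this] show ?thesis unfolding differentiable_def by blast
qed

lemma (in bounded_bilinear) smooth_upto_prod:
  fixes f :: "real^'n::finite \<Rightarrow> 'a" and g :: "real^'n \<Rightarrow> 'b"
  assumes X: "open X"
  shows "smooth_upto k X f \<Longrightarrow> smooth_upto k X g \<Longrightarrow> smooth_upto k X (\<lambda>x. prod (f x) (g x))"
proof (induction k arbitrary: f g)
  case 0
  then show ?case by (simp add: smooth_upto_0 differentiable_prod)
next
  case (Suc k)
  have k: "smooth_upto k X f" "smooth_upto k X g" using Suc.prems smooth_upto_mono by fastforce+
  have "smooth_upto k X (partial_derivative i (\<lambda>x. prod (f x) (g x)))" for i
  proof (rule smooth_upto_cong[OF X])
    show "prod (f x) (partial_derivative i g x) + prod (partial_derivative i f x) (g x)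
        = partial_derivative i (\<lambda>x. prod (f x) (g x)) x" if "x \<in> X" for x
      using Suc.prems that by (subst partial_derivative_prod) (auto simp: smooth_upto_Suc)
    show "smooth_upto k X (\<lambda>x. prod (f x) (partial_derivative i g x) + prod (partial_derivative i f x) (g x))"
      using Suc k by (intro smooth_upto_add[OF X]) (auto simp: smooth_upto_Suc)
  qed
  then show ?case
    using Suc.prems by (simp add: smooth_upto_Suc differentiable_prod)
qed

lemma jet_bound_add:
  fixes f g :: "real^'n::finite \<Rightarrow> 'b::real_normed_vector"
  assumes X: "open X" and f: "smooth_upto k X f" and g: "smooth_upto k X g" and x: "x \<in> X"
    and "jet_bound k f x A" "jet_bound k g x B"
  shows "jet_bound k (\<lambda>x. f x + g x) x (A + B)"
  using assms(5,6) iterated_partial_add[OF X f g x]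
  by (auto simp: jet_bound_def intro!: norm_triangle_le add_mono)

lemma jet_bound_sum:
  assumes X: "open X" and f: "\<And>j. j \<in> J \<Longrightarrow> smooth_upto k X (f j)" and x: "x \<in> X"
    and A: "\<And>j. j \<in> J \<Longrightarrow> jet_bound k (f j) x A"
  shows "jet_bound k (\<lambda>x. \<Sum>j\<in>J. f j x) x (real (card J) * A)"
  using f A
proof (induction J rule: infinite_finite_induct)
  case (insert j J)
  have "jet_bound k (\<lambda>x. f j x + (\<Sum>j\<in>J. f j x)) x (A + real (card J) * A)"
    by (rule jet_bound_add[OF X _ _ x]) (use insert in \<open>simp_all add: smooth_upto_sum[OF X]\<close>)
  then show ?case using insert by (simp add: algebra_simps)
qed (auto simp: jet_bound_def iterated_partial_const)

text \<open>
  Each application of the Leibniz rule at most doubles the number of terms, whence the factor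
  \<open>2 ^ k\<close>.
\<close>

lemma (in bounded_bilinear) jet_bound_prod:
  fixes f :: "real^'n::finite \<Rightarrow> 'a" and g :: "real^'n \<Rightarrow> 'b"
  assumes X: "open X" and x: "x \<in> X" and n: "\<And>a b. norm (prod a b) \<le> norm a * norm b"
  shows "smooth_upto k X f \<Longrightarrow> smooth_upto k X g \<Longrightarrow> jet_bound k f x A \<Longrightarrow> jet_bound k g x B
    \<Longrightarrow> jet_bound k (\<lambda>x. prod (f x) (g x)) x (2 ^ k * A * B)"
proof (induction k arbitrary: f g)
  case 0
  then have "norm (f x) * norm (g x) \<le> A * B"
    by (intro mult_mono') (simp_all add: jet_bound_0)
  then show ?case using n[of "f x" "g x"] by (simp add: jet_bound_0)
next
  case (Suc k)
  have k: "smooth_upto k X f" "smooth_upto k X g" "jet_bound k f x A" "jet_bound k g x B"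
    using Suc.prems smooth_upto_mono jet_bound_mono by fastforce+
  have AB: "0 \<le> A" "0 \<le> B" using k jet_bound_nonneg by auto
  have "jet_bound k (partial_derivative i (\<lambda>x. prod (f x) (g x))) x (2 ^ k * A * B + 2 ^ k * A * B)" for i
  proof (rule jet_bound_cong[OF X _ x])
    show "prod (f x) (partial_derivative i g x) + prod (partial_derivative i f x) (g x)
        = partial_derivative i (\<lambda>x. prod (f x) (g x)) x" if "x \<in> X" for x
      using Suc.prems that by (subst partial_derivative_prod) (auto simp: smooth_upto_Suc)
    show "jet_bound k (\<lambda>x. prod (f x) (partial_derivative i g x) + prod (partial_derivative i f x) (g x)) x
         (2 ^ k * A * B + 2 ^ k * A * B)"
      using Suc k by (intro jet_bound_add[OF X _ _ x] smooth_upto_prod[OF X]) (auto simp: smooth_upto_Suc jet_bound_Suc)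
  qed
  moreover have "norm (prod (f x) (g x)) \<le> 2 ^ Suc k * A * B"
  proof -
    have "norm (prod (f x) (g x)) \<le> 1 * (A * B)"
      using n[of "f x" "g x"] mult_mono'[of "norm (f x)" A "norm (g x)" B] Suc.prems
      by (simp add: jet_bound_Suc)
    also have "\<dots> \<le> 2 ^ Suc k * (A * B)"
      using AB by (intro mult_right_mono) (auto intro: one_le_power[of 2 "Suc k", simplified])
    finally show ?thesis by (simp add: mult.assoc)
  qed
  ultimately show ?case by (simp add: jet_bound_Suc mult_ac)
qed

lemmas smooth_upto_mult = bounded_bilinear.smooth_upto_prod[OF bounded_bilinear_mult]
lemmas smooth_upto_scaleR = bounded_bilinear.smooth_upto_prod[OF bounded_bilinear_scaleR]

lemma smooth_on_add: "open X \<Longrightarrow> smooth_on X f \<Longrightarrow> smooth_on X g \<Longrightarrow> smooth_on X (\<lambda>x. f x + g x)"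
  unfolding smooth_on_iff_upto by (intro allI smooth_upto_add) simp_all

lemma smooth_on_mult:
  fixes f g :: "_ \<Rightarrow> 'b::real_normed_algebra"
  shows "open X \<Longrightarrow> smooth_on X f \<Longrightarrow> smooth_on X g \<Longrightarrow> smooth_on X (\<lambda>x. f x * g x)"
  unfolding smooth_on_iff_upto by (intro allI smooth_upto_mult) simp_all

lemma smooth_on_prod:
  fixes f :: "'j \<Rightarrow> _ \<Rightarrow> 'b::{real_normed_algebra,comm_ring_1}"
  assumes "open X" "\<And>j. j \<in> J \<Longrightarrow> smooth_on X (f j)"
  shows "smooth_on X (\<lambda>x. \<Prod>j\<in>J. f j x)"
  using assms(2)
proof (induction J rule: infinite_finite_induct)
  case (insert j J)
  have "smooth_on X (\<lambda>x. f j x * (\<Prod>j\<in>J. f j x))"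
    by (rule smooth_on_mult[OF assms(1)]) (use insert in simp_all)
  then show ?case using insert(1,2) by simp
qed (simp_all add: smooth_on_const)

section \<open>Chain rule and inverse functions\<close>

lemma partial_derivative_compose:
  fixes f :: "real^'m::finite \<Rightarrow> 'b::real_normed_vector" and g :: "real^'n::finite \<Rightarrow> real^'m"
  assumes "g differentiable (at x)" "f differentiable (at (g x))"
  shows "partial_derivative i (\<lambda>x. f (g x)) x
    = (\<Sum>c\<in>UNIV. partial_derivative i (\<lambda>x. g x $ c) x *\<^sub>R partial_derivative c f (g x))"
proof -
  obtain D where D: "(g has_derivative D) (at x)"
    using assms by (auto simp: differentiable_def)
  have c: "partial_derivative i (\<lambda>x. g x $ c) x = D (axis i 1) $ c" for c
    by (rule partial_derivative_eqI[OF bounded_linear.has_derivative[OF bounded_linear_vec_nth D]])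
  have "((\<lambda>x. f (g x)) has_derivative (\<lambda>h. \<Sum>c\<in>UNIV. (D h $ c) *\<^sub>R partial_derivative c f (g x))) (at x)"
    by (rule has_derivative_compose[OF D has_derivative_sum_partial[OF assms(2)]])
  from partial_derivative_eqI[OF this] show ?thesis by (simp add: c)
qed

lemma differentiable_compose_at:
  assumes "g differentiable (at x)" "f differentiable (at (g x))"
  shows "(\<lambda>x. f (g x)) differentiable (at x)"
  using assms unfolding differentiable_def by (blast intro: has_derivative_compose)

lemma smooth_on_component: "open X \<Longrightarrow> smooth_on X g \<Longrightarrow> smooth_on X (\<lambda>x. g x $ c)"
  by (rule bounded_linear.smooth_on_linear[OF bounded_linear_vec_nth])

lemma smooth_on_partial: "smooth_on X f \<Longrightarrow> smooth_on X (partial_derivative i f)"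
  using smooth_on_iterated[of X f "[i]"] by simp

lemma smooth_upto_compose:
  fixes f :: "real^'m::finite \<Rightarrow> 'b::real_normed_vector" and g :: "real^'n::finite \<Rightarrow> real^'m"
  assumes Y: "open Y" and gY: "g ` Y \<subseteq> Z" and dg: "\<And>y. y \<in> Y \<Longrightarrow> g differentiable (at y)"
    and g: "\<And>c. smooth_upto k Y (\<lambda>y. g y $ c)"
  shows "smooth_on Z f \<Longrightarrow> smooth_upto k Y (\<lambda>y. f (g y))"
  using g
proof (induction k arbitrary: f)
  case 0
  have "(\<lambda>y. f (g y)) differentiable (at y)" if "y \<in> Y" for y
    by (rule differentiable_compose_at[OF dg[OF that] smooth_on_imp_differentiable[OF 0(1)]]) (use gY that in auto)
  then show ?case by (simp add: smooth_upto_0)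
next
  case (Suc k)
  have d: "(\<lambda>y. f (g y)) differentiable (at y)" if "y \<in> Y" for y
    by (rule differentiable_compose_at[OF dg[OF that] smooth_on_imp_differentiable[OF Suc.prems(1)]]) (use gY that in auto)
  have gk: "smooth_upto k Y (\<lambda>y. g y $ c)" for c
    using smooth_upto_mono[OF Suc.prems(2)] by simp
  have "smooth_upto k Y (partial_derivative i (\<lambda>y. f (g y)))" for i
  proof (rule smooth_upto_cong[OF Y])
    show "(\<Sum>c\<in>UNIV. partial_derivative i (\<lambda>x. g x $ c) y *\<^sub>R partial_derivative c f (g y))
        = partial_derivative i (\<lambda>y. f (g y)) y" if "y \<in> Y" for y
      using partial_derivative_compose[OF dg[OF that] smooth_on_imp_differentiable[OF Suc.prems(1)]] that gY
      by force
    show "smooth_upto k Y (\<lambda>y. \<Sum>c\<in>UNIV. partial_derivative i (\<lambda>x. g x $ c) y *\<^sub>R partial_derivative c f (g y))"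
    proof (intro smooth_upto_sum[OF Y] smooth_upto_scaleR[OF Y])
      fix c
      show "smooth_upto k Y (partial_derivative i (\<lambda>x. g x $ c))"
        using Suc.prems(2) by (simp add: smooth_upto_Suc)
      show "smooth_upto k Y (\<lambda>y. partial_derivative c f (g y))"
        by (rule Suc.IH[OF smooth_on_partial[OF Suc.prems(1)] gk])
    qed
  qed
  with d show ?case by (simp add: smooth_upto_Suc)
qed

lemma smooth_on_compose:
  fixes f :: "real^'m::finite \<Rightarrow> 'b::real_normed_vector" and g :: "real^'n::finite \<Rightarrow> real^'m"
  assumes Y: "open Y" and gY: "g ` Y \<subseteq> Z" and g: "smooth_on Y g" and f: "smooth_on Z f"
  shows "smooth_on Y (\<lambda>y. f (g y))"
  unfolding smooth_on_iff_upto
proof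
  fix k show "smooth_upto k Y (\<lambda>y. f (g y))"
    by (rule smooth_upto_compose[OF Y gY smooth_on_imp_differentiable[OF g] _ f])
       (use smooth_on_component[OF Y g] in \<open>simp_all add: smooth_on_iff_upto\<close>)
qed

text \<open>
  The constant depends only on the order and on the bounds for the components of the inner function,
  not on the functions, and the bound is linear in the one for the outer function. This uniformity is
  what makes it applicable to all iterates of a map at once. By the chain rule,
  \<open>\<partial>\<^sub>i (f \<circ> g) = \<Sum>\<^sub>c \<partial>\<^sub>i g\<^sub>c \<cdot> (\<partial>\<^sub>c f \<circ> g)\<close>, so the estimate follows by induction from the one for products.
\<close>

lemma jet_bound_compose:
  fixes M :: real
  assumes "0 \<le> M"
  shows "\<exists>K\<ge>1. \<forall>(f::real^'m::finite \<Rightarrow> 'b::real_normed_vector) (g::real^'n::finite \<Rightarrow> real^'m) Y Z y A.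
     open Y \<longrightarrow> g ` Y \<subseteq> Z \<longrightarrow> smooth_on Y g \<longrightarrow> smooth_on Z f \<longrightarrow> y \<in> Y \<longrightarrow>
     (\<forall>c. jet_bound k (\<lambda>y. g y $ c) y M) \<longrightarrow> jet_bound k f (g y) A \<longrightarrow>
     jet_bound k (\<lambda>y. f (g y)) y (K * A)"
proof (induction k)
  case 0
  show ?case by (rule exI[of _ 1]) (auto simp: jet_bound_0)
next
  case (Suc k)
  then obtain K where K: "1 \<le> K"
    "\<And>(f::real^'m \<Rightarrow> 'b) (g::real^'n \<Rightarrow> real^'m) Y Z y A.
     open Y \<Longrightarrow> g ` Y \<subseteq> Z \<Longrightarrow> smooth_on Y g \<Longrightarrow> smooth_on Z f \<Longrightarrow> y \<in> Y \<Longrightarrow>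
     (\<forall>c. jet_bound k (\<lambda>y. g y $ c) y M) \<Longrightarrow> jet_bound k f (g y) A \<Longrightarrow>
     jet_bound k (\<lambda>y. f (g y)) y (K * A)"
    by metis
  \<comment> \<open>One summand for each component, each estimated by the Leibniz rule.\<close>
  define L where "L = real CARD('m) * (2 ^ k * M * K)"
  have L0: "0 \<le> L" using K(1) assms by (simp add: L_def)
  have "jet_bound (Suc k) (\<lambda>y. f (g y)) y ((1 + L) * A)"
    if Y: "open Y" and gY: "g ` Y \<subseteq> Z" and g: "smooth_on Y g" and f: "smooth_on Z f" and y: "y \<in> Y"
      and gM: "\<forall>c. jet_bound (Suc k) (\<lambda>y. g y $ c) y M" and fA: "jet_bound (Suc k) f (g y) A"
    for f :: "real^'m \<Rightarrow> 'b" and g :: "real^'n \<Rightarrow> real^'m" and Y Z y A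
  proof -
    have A: "0 \<le> A" using fA jet_bound_nonneg by blast
    have dg: "\<And>y. y \<in> Y \<Longrightarrow> g differentiable (at y)" using smooth_on_imp_differentiable[OF g] .
    have "jet_bound k (partial_derivative i (\<lambda>y. f (g y))) y (L * A)" for i
    proof (rule jet_bound_cong[OF Y _ y])
      show "(\<Sum>c\<in>UNIV. partial_derivative i (\<lambda>x. g x $ c) y *\<^sub>R partial_derivative c f (g y))
          = partial_derivative i (\<lambda>y. f (g y)) y" if "y \<in> Y" for y
        using partial_derivative_compose[OF dg[OF that] smooth_on_imp_differentiable[OF f]] that gY
        by force
      have s1: "smooth_upto k Y (partial_derivative i (\<lambda>x. g x $ c))" for c
        using smooth_on_partial[OF smooth_on_component[OF Y g]] by (simp add: smooth_on_iff_upto)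
      have s2: "smooth_upto k Y (\<lambda>y. partial_derivative c f (g y))" for c
        using smooth_on_compose[OF Y gY g smooth_on_partial[OF f]] by (simp add: smooth_on_iff_upto)
      have "jet_bound k (\<lambda>y. \<Sum>c\<in>UNIV. partial_derivative i (\<lambda>x. g x $ c) y *\<^sub>R partial_derivative c f (g y)) y
         (real (card (UNIV::'m set)) * (2 ^ k * M * (K * A)))"
      proof (intro jet_bound_sum[OF Y _ y] smooth_upto_scaleR[OF Y] s1 s2
            bounded_bilinear.jet_bound_prod[OF bounded_bilinear_scaleR Y y])
        fix c
        show "jet_bound k (partial_derivative i (\<lambda>x. g x $ c)) y M"
          using gM by (simp add: jet_bound_Suc)
        have "\<forall>c. jet_bound k (\<lambda>y. g y $ c) y M" by (intro allI jet_bound_mono[OF gM[rule_format]]) simp_all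
        then show "jet_bound k (\<lambda>y. partial_derivative c f (g y)) y (K * A)"
          by (rule K(2)[OF Y gY g smooth_on_partial[OF f] y]) (use fA in \<open>simp add: jet_bound_Suc\<close>)
      qed auto
      then show "jet_bound k (\<lambda>y. \<Sum>c\<in>UNIV. partial_derivative i (\<lambda>x. g x $ c) y *\<^sub>R partial_derivative c f (g y)) y (L * A)"
        by (simp add: L_def mult_ac)
    qed
    moreover have "L * A \<le> (1 + L) * A" using A by (simp add: algebra_simps)
    ultimately have "jet_bound k (partial_derivative i (\<lambda>y. f (g y))) y ((1 + L) * A)" for i
      using jet_bound_mono by blast
    moreover have "norm (f (g y)) \<le> (1 + L) * A"
      using fA L0 A by (auto simp: jet_bound_Suc algebra_simps add_increasing2)
    ultimately show ?thesis by (simp add: jet_bound_Suc)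
  qed
  then show ?case using L0 by (intro exI[of _ "1 + L"]) auto
qed

lemma smooth_upto_inverse:
  fixes f :: "real^'n::finite \<Rightarrow> real"
  assumes X: "open X" and f: "smooth_on X f" and nz: "\<And>x. x \<in> X \<Longrightarrow> f x \<noteq> 0"
  shows "smooth_upto k X (\<lambda>x. inverse (f x))"
proof (induction k)
  case 0
  show ?case using smooth_on_imp_differentiable[OF f] nz
    by (auto simp: smooth_upto_0 intro!: differentiable_inverse)
next
  case (Suc k)
  have "smooth_upto k X (partial_derivative i (\<lambda>x. inverse (f x)))" for i
  proof (rule smooth_upto_cong[OF X])
    fix x assume x: "x \<in> X"
    obtain D where D: "(f has_derivative D) (at x)"
      using smooth_on_imp_differentiable[OF f x] by (auto simp: differentiable_def)
    show "- 1 * (inverse (f x) * inverse (f x) * partial_derivative i f x) = partial_derivative i (\<lambda>x. inverse (f x)) x"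
      using partial_derivative_eqI[OF Deriv.has_derivative_inverse[OF nz[OF x] D], of i]
      by (simp add: partial_derivative_eqI[OF D])
  next
    show "smooth_upto k X (\<lambda>x. - 1 * (inverse (f x) * inverse (f x) * partial_derivative i f x))"
      using smooth_on_partial[OF f] Suc
      by (intro smooth_upto_mult[OF X] smooth_upto_const) (auto simp: smooth_on_iff_upto)
  qed
  then show ?case using smooth_on_imp_differentiable[OF f] nz
    by (auto simp: smooth_upto_Suc intro!: differentiable_inverse)
qed

lemma smooth_on_inverse:
  fixes f :: "real^'n::finite \<Rightarrow> real"
  assumes "open X" "smooth_on X f" "\<And>x. x \<in> X \<Longrightarrow> f x \<noteq> 0"
  shows "smooth_on X (\<lambda>x. inverse (f x))"
  using smooth_upto_inverse[OF assms] by (simp add: smooth_on_iff_upto)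

text \<open>
  Locally, the function does not change sign.
\<close>

lemma smooth_on_abs:
  fixes f :: "real^'n::finite \<Rightarrow> real"
  assumes X: "open X" and f: "smooth_on X f" and nz: "\<And>x. x \<in> X \<Longrightarrow> f x \<noteq> 0"
  shows "smooth_on X (\<lambda>x. \<bar>f x\<bar>)"
proof -
  have op: "open {x \<in> X. 0 < f x}" "open {x \<in> X. f x < 0}"
    using continuous_open_preimage[OF smooth_on_imp_continuous_on[OF f] X, of "{0<..}"]
      continuous_open_preimage[OF smooth_on_imp_continuous_on[OF f] X, of "{..<0}"]
    by (simp_all add: vimage_def Int_def)
  have 1: "smooth_on {x \<in> X. 0 < f x} (\<lambda>x. \<bar>f x\<bar>)"
    by (rule smooth_on_cong[OF op(1), where f=f]) (auto intro: smooth_on_subset[OF f])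
  have "smooth_on {x \<in> X. f x < 0} (\<lambda>x. - 1 * f x)"
    by (intro smooth_on_mult[OF op(2)] smooth_on_const smooth_on_subset[OF f]) auto
  then have 2: "smooth_on {x \<in> X. f x < 0} (\<lambda>x. \<bar>f x\<bar>)"
    by (rule smooth_on_cong[OF op(2), where f="\<lambda>x. - 1 * f x", rotated]) auto
  have "X \<subseteq> {x \<in> X. 0 < f x} \<union> {x \<in> X. f x < 0}" using nz by force
  then show ?thesis using smooth_on_union[OF 1 2] smooth_on_subset by blast
qed

text \<open>
  The outer function is given together with all its derivatives \<open>H\<close>, since smoothness is defined here
  only for functions of a vector.
\<close>

lemma smooth_on_scalar_compose:
  fixes q :: "real^'n::finite \<Rightarrow> real" and H :: "nat \<Rightarrow> real \<Rightarrow> real"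
  assumes X: "open X" and q: "smooth_on X q"
    and H: "\<And>k t. (H k has_real_derivative H (Suc k) t) (at t)"
  shows "smooth_on X (\<lambda>x. H j (q x))"
proof -
  have der: "((\<lambda>x. H j (q x)) has_derivative (\<lambda>h. H (Suc j) (q x) * D h)) (at x)"
    if "(q has_derivative D) (at x)" for x D j
    using has_derivative_compose[OF that, of "H j" "(*) (H (Suc j) (q x))"] H[of j "q x"]
    by (simp add: has_field_derivative_def)
  have dif: "(\<lambda>x. H j (q x)) differentiable (at x)" if "x \<in> X" for x j
    using smooth_on_imp_differentiable[OF q that] der by (auto simp: differentiable_def)
  have "smooth_upto k X (\<lambda>x. H j (q x))" for k
  proof (induction k arbitrary: j)
    case 0
    then show ?case using dif by (simp add: smooth_upto_0)
  next
    case (Suc k)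
    have "smooth_upto k X (partial_derivative i (\<lambda>x. H j (q x)))" for i
    proof (rule smooth_upto_cong[OF X])
      fix x assume x: "x \<in> X"
      obtain D where D: "(q has_derivative D) (at x)"
        using smooth_on_imp_differentiable[OF q x] by (auto simp: differentiable_def)
      show "H (Suc j) (q x) * partial_derivative i q x = partial_derivative i (\<lambda>x. H j (q x)) x"
        using partial_derivative_eqI[OF der[OF D], of i j] by (simp add: partial_derivative_eqI[OF D])
    next
      show "smooth_upto k X (\<lambda>x. H (Suc j) (q x) * partial_derivative i q x)"
        using smooth_on_partial[OF q] Suc
        by (intro smooth_upto_mult[OF X]) (auto simp: smooth_on_iff_upto)
    qed
    then show ?case using dif by (simp add: smooth_upto_Suc)
  qed
  then show ?thesis by (simp add: smooth_on_iff_upto)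
qed

lemma smooth_on_of_real:
  "open X \<Longrightarrow> smooth_on X f \<Longrightarrow> smooth_on X (\<lambda>x. complex_of_real (f x))"
  by (rule bounded_linear.smooth_on_linear[OF bounded_linear_of_real])

lemma jacobian_nth:
  assumes "g differentiable (at x)"
  shows "jacobian g (at x) $ c $ i = partial_derivative i (\<lambda>x. g x $ c) x"
proof -
  have D: "(g has_derivative frechet_derivative g (at x)) (at x)"
    using assms by (simp add: frechet_derivative_works)
  show ?thesis
    using partial_derivative_eqI[OF bounded_linear.has_derivative[OF bounded_linear_vec_nth D]]
    by (simp add: jacobian_def matrix_def)
qed

lemma smooth_on_det:
  fixes A :: "real^'n::finite \<Rightarrow> real^'m::finite^'m"
  assumes X: "open X" and A: "\<And>i j. smooth_on X (\<lambda>x. A x $ i $ j)"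
  shows "smooth_on X (\<lambda>x. det (A x))"
  unfolding det_def by (intro smooth_on_sum[OF X] smooth_on_mult[OF X] smooth_on_const smooth_on_prod[OF X] A)

lemma smooth_on_jacobian_nth:
  assumes X: "open X" and g: "smooth_on X g"
  shows "smooth_on X (\<lambda>x. jacobian g (at x) $ c $ i)"
  by (rule smooth_on_cong[OF X, of "partial_derivative i (\<lambda>x. g x $ c)"])
     (simp_all add: jacobian_nth smooth_on_imp_differentiable[OF g] smooth_on_partial smooth_on_component[OF X g])

lemma smooth_on_vec_iff:
  fixes g :: "real^'n::finite \<Rightarrow> real^'m::finite"
  assumes "open X" "\<And>c. smooth_on X (\<lambda>x. g x $ c)"
  shows "smooth_on X g"
proof -
  have "smooth_on X (\<lambda>x. \<Sum>c\<in>UNIV. (g x $ c) *\<^sub>R (axis c 1 :: real^'m))"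
    using assms by (intro smooth_on_sum bounded_linear.smooth_on_linear[OF bounded_linear_scaleR_left]) auto
  moreover have "(\<lambda>x. \<Sum>c\<in>UNIV. (g x $ c) *\<^sub>R (axis c 1 :: real^'m)) = g"
    by (simp add: basis_expansion flip: scalar_mult_eq_scaleR)
  ultimately show ?thesis by simp
qed

text \<open>
  Cramer's rule expresses the first derivatives of the inverse \<open>h\<close> as \<open>R \<circ> h\<close> with \<open>R\<close> smooth. So if \<open>h\<close>
  is differentiable up to order \<open>k\<close>, then so are its first derivatives, and \<open>h\<close> is differentiable up to
  order \<open>k + 1\<close>.
\<close>

lemma smooth_on_inverse_function:
  fixes g :: "real^'n::finite \<Rightarrow> real^'n"
  assumes X: "open X" and g: "smooth_on X g" and inj: "inj_on g X"
    and nz: "\<And>x. x \<in> X \<Longrightarrow> det (jacobian g (at x)) \<noteq> 0"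
  shows "open (g ` X)" "smooth_on (g ` X) (inv_into X g)"
proof -
  let ?h = "inv_into X g"
  let ?R = "\<lambda>k b x. det (\<chi> i j. if j = k then axis b 1 $ i else jacobian g (at x) $ i $ j)
      * inverse (det (jacobian g (at x)))"
  show op: "open (g ` X)"
    by (rule invariance_of_domain[OF smooth_on_imp_continuous_on[OF g] X inj])
  have "\<forall>x\<in>X. \<exists>B. jacobian g (at x) ** B = mat 1"
    using nz by (metis invertible_def invertible_det_nz)
  then obtain B where B: "\<And>x. x \<in> X \<Longrightarrow> jacobian g (at x) ** B x = mat 1"
    by metis
  have der: "(?h has_derivative (*v) (B x)) (at (g x))" if x: "x \<in> X" for x
  proof (rule has_derivative_inverse_strong[OF X x smooth_on_imp_continuous_on[OF g]])
    show "?h (g y) = y" if "y \<in> X" for y using inj that by simp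
    show "(g has_derivative (*v) (jacobian g (at x))) (at x)"
      using smooth_on_imp_differentiable[OF g x] jacobian_works by blast
    show "(*v) (jacobian g (at x)) \<circ> (*v) (B x) = id"
      using B[OF x] by (auto simp: fun_eq_iff matrix_vector_mul_assoc)
  qed
  have part: "partial_derivative b (\<lambda>y. ?h y $ c) (g x) = ?R c b x" if x: "x \<in> X" for x b c
  proof -
    let ?v = "B x *v axis b 1"
    have "partial_derivative b (\<lambda>y. ?h y $ c) (g x) = ?v $ c"
      by (rule partial_derivative_eqI[OF bounded_linear.has_derivative[OF bounded_linear_vec_nth der[OF x]]])
    moreover have "jacobian g (at x) *v ?v = axis b 1"
      using B[OF x] by (simp add: matrix_vector_mul_assoc)
    ultimately show ?thesis
      using cramer[OF nz[OF x], of ?v "axis b 1"] by (simp add: divide_inverse)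
  qed
  have R: "smooth_on X (?R c b)" for c b
  proof -
    have "smooth_on X (\<lambda>x. if j = c then axis b 1 $ i else jacobian g (at x) $ i $ j)" for i j
      by (cases "j = c") (simp_all add: smooth_on_const smooth_on_jacobian_nth[OF X g])
    then show ?thesis
      by (intro smooth_on_mult[OF X] smooth_on_inverse[OF X] smooth_on_det[OF X] nz smooth_on_jacobian_nth[OF X g])
         simp_all
  qed
  have dif: "?h differentiable (at y)" if "y \<in> g ` X" for y
    using der that by (auto simp: differentiable_def)
  have difc: "(\<lambda>y. ?h y $ c) differentiable (at y)" if y: "y \<in> g ` X" for y c
  proof -
    obtain D where "(?h has_derivative D) (at y)" using dif[OF y] by (auto simp: differentiable_def)
    from bounded_linear.has_derivative[OF bounded_linear_vec_nth this]
    show ?thesis unfolding differentiable_def by blast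
  qed
  have "smooth_upto k (g ` X) (\<lambda>y. ?h y $ c)" for k c
  proof (induction k arbitrary: c)
    case 0
    show ?case by (simp add: smooth_upto_0 difc)
  next
    case (Suc k)
    have "smooth_upto k (g ` X) (partial_derivative b (\<lambda>y. ?h y $ c))" for b
    proof (rule smooth_upto_cong[OF op])
      show "?R c b (?h y) = partial_derivative b (\<lambda>y. ?h y $ c) y" if y: "y \<in> g ` X" for y
      proof -
        obtain x where x: "x \<in> X" "y = g x" using y by blast
        then have h: "?h (g x) = x" using inj by simp
        show ?thesis unfolding x(2) h by (rule part[OF x(1), symmetric])
      qed
      show "smooth_upto k (g ` X) (\<lambda>y. ?R c b (?h y))"
        by (rule smooth_upto_compose[OF op _ dif Suc, where f="?R c b" and Z=X])
           (use inj in auto, rule R)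
    qed
    then show ?case by (simp add: smooth_upto_Suc difc)
  qed
  then show "smooth_on (g ` X) ?h"
    by (intro smooth_on_vec_iff[OF op]) (simp add: smooth_on_iff_upto)
qed

section \<open>Bump functions and mollifiers\<close>

text \<open>
  The derivatives of \<open>t \<mapsto> exp (- 1 / t)\<close> on the positive half-line are \<open>t \<mapsto> p\<^sub>k (1 / t) exp (- 1 / t)\<close>; these
  are the polynomials \<open>p\<^sub>k\<close>.
\<close>

fun flat_poly :: "nat \<Rightarrow> real poly" where
  "flat_poly 0 = 1"
| "flat_poly (Suc k) = [:0, 0, 1:] * (flat_poly k - pderiv (flat_poly k))"

definition flat :: "nat \<Rightarrow> real \<Rightarrow> real" where
  "flat k t = (if 0 < t then poly (flat_poly k) (1 / t) * exp (- 1 / t) else 0)"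

lemma tendsto_poly_div_exp_0: "((\<lambda>s. poly p s / exp s) \<longlongrightarrow> 0) at_top" for p :: "real poly"
proof -
  have "((\<lambda>s. \<Sum>i\<le>degree p. coeff p i * (s ^ i / exp s)) \<longlongrightarrow> (\<Sum>i\<le>degree p. coeff p i * 0)) at_top"
    by (intro tendsto_sum tendsto_mult tendsto_const tendsto_power_div_exp_0)
  then show ?thesis by (simp add: poly_altdef sum_divide_distrib)
qed

text \<open>
  At the origin, the difference quotient from the right is \<open>p(s) / exp s\<close> for a polynomial \<open>p\<close> and
  \<open>s = 1 / t\<close>, which tends to zero.
\<close>

lemma flat_has_derivative: "(flat k has_real_derivative flat (Suc k) t) (at t)"
proof -
  consider "0 < t" | "t < 0" | "t = 0" by linarith
  then show ?thesis
  proof cases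
    case 1
    have "((\<lambda>t. poly (flat_poly k) (1 / t) * exp (- 1 / t)) has_real_derivative flat (Suc k) t) (at t)"
      using 1 by (auto intro!: derivative_eq_intros DERIV_chain'[OF _ poly_DERIV]
          simp: flat_def field_simps power2_eq_square)
    then show ?thesis
      by (rule has_field_derivative_transform_within_open[where S="{0<..}"]) (use 1 in \<open>auto simp: flat_def\<close>)
  next
    case 2
    have "((\<lambda>t. 0) has_real_derivative flat (Suc k) t) (at t)" using 2 by (simp add: flat_def)
    then show ?thesis
      by (rule has_field_derivative_transform_within_open[where S="{..<0}"]) (use 2 in \<open>auto simp: flat_def\<close>)
  next
    case 3
    have R: "((\<lambda>t. flat k t / t) \<longlongrightarrow> 0) (at_right 0)"
    proof -
      have "((\<lambda>s. poly ([:0, 1:] * flat_poly k) s / exp s) \<longlongrightarrow> 0) at_top"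
        by (rule tendsto_poly_div_exp_0)
      from filterlim_compose[OF this filterlim_inverse_at_top_right]
      have "((\<lambda>t. poly ([:0, 1:] * flat_poly k) (inverse t) / exp (inverse t)) \<longlongrightarrow> 0) (at_right 0)" .
      then show ?thesis
        by (rule Lim_transform_eventually)
           (auto simp: eventually_at_right_field flat_def exp_minus divide_inverse mult_ac intro!: exI[of _ 1])
    qed
    have L: "((\<lambda>t. flat k t / t) \<longlongrightarrow> 0) (at_left 0)"
      by (rule tendsto_eventually) (auto simp: eventually_at_left_field flat_def intro!: exI[of _ "- 1"])
    have "((\<lambda>t. flat k t / t) \<longlongrightarrow> 0) (at 0)"
      using filterlim_split_at[OF L R] .
    then show ?thesis using 3 by (simp add: has_field_derivative_iff flat_def)
  qed
qed

lemma flat_pos: "0 < t \<Longrightarrow> 0 < flat 0 t" and flat_nonpos: "t \<le> 0 \<Longrightarrow> flat 0 t = 0" and flat_nonneg: "0 \<le> flat 0 t"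
  by (simp_all add: flat_def)

lemma smooth_on_ident: "smooth_on X (\<lambda>x. x)"
proof -
  have "smooth_upto k X (\<lambda>x. x)" for k
  proof (cases k)
    case (Suc j)
    have "partial_derivative i (\<lambda>x. x) = (\<lambda>x. axis i 1)" for i :: 'a
      using partial_derivative_eqI[OF has_derivative_ident] by blast
    then show ?thesis using Suc by (simp add: smooth_upto_Suc smooth_upto_const)
  qed (simp add: smooth_upto_0)
  then show ?thesis by (simp add: smooth_on_iff_upto)
qed

lemma smooth_on_norm_square: "smooth_on UNIV (\<lambda>x. (norm (x - y))\<^sup>2)" for y :: "real^'n::finite"
proof -
  have "smooth_on UNIV (\<lambda>x. \<Sum>i\<in>UNIV. (x $ i + (- (y $ i))) * (x $ i + (- (y $ i))))"
    by (intro smooth_on_sum smooth_on_mult smooth_on_add smooth_on_component smooth_on_ident smooth_on_const open_UNIV)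
  moreover have "(norm (x - y))\<^sup>2 = (\<Sum>i\<in>UNIV. (x $ i + (- (y $ i))) * (x $ i + (- (y $ i))))" for x
    by (simp add: power2_norm_eq_inner inner_vec_def)
  ultimately show ?thesis by simp
qed

text \<open>
  The quotient \<open>u / (u + v)\<close> works, where \<open>u\<close> vanishes exactly off the larger ball and \<open>v\<close> exactly on the
  smaller one: the denominator has no zeros.
\<close>

lemma bump_function:
  fixes y :: "real^'n::finite"
  assumes r: "0 < r"
  obtains b :: "real^'n \<Rightarrow> real" where "smooth_on UNIV b" "\<And>x. 0 \<le> b x" "\<And>x. x \<in> ball y r \<Longrightarrow> b x = 1"
    "\<And>x. x \<notin> cball y (2 * r) \<Longrightarrow> b x = 0"
proof -
  let ?q = "\<lambda>x. (norm (x - y))\<^sup>2"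
  let ?u = "\<lambda>x. flat 0 (4 * r\<^sup>2 + (- 1) * ?q x)" and ?v = "\<lambda>x. flat 0 (?q x + (- (r\<^sup>2)))"
  have u: "smooth_on UNIV ?u"
    by (rule smooth_on_scalar_compose[where H=flat])
       (intro smooth_on_add smooth_on_mult smooth_on_const smooth_on_norm_square open_UNIV flat_has_derivative)+
  have v: "smooth_on UNIV ?v"
    by (rule smooth_on_scalar_compose[where H=flat])
       (intro smooth_on_add smooth_on_const smooth_on_norm_square open_UNIV flat_has_derivative)+
  have pos: "?u x + ?v x \<noteq> 0" for x
  proof -
    have "0 < 4 * r\<^sup>2 + (- 1) * ?q x \<or> 0 < ?q x + (- (r\<^sup>2))"
      using r zero_less_power[OF r, of 2] by linarith
    then show ?thesis
      using flat_pos[of "4 * r\<^sup>2 + (- 1) * ?q x"] flat_pos[of "?q x + (- (r\<^sup>2))"]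
        flat_nonneg[of "4 * r\<^sup>2 + (- 1) * ?q x"] flat_nonneg[of "?q x + (- (r\<^sup>2))"] by linarith
  qed
  show thesis
  proof (rule that)
    show "smooth_on UNIV (\<lambda>x. ?u x * inverse (?u x + ?v x))"
      by (intro smooth_on_mult smooth_on_inverse smooth_on_add u v open_UNIV pos)
    show "0 \<le> ?u x * inverse (?u x + ?v x)" for x
      by (intro mult_nonneg_nonneg flat_nonneg) (simp add: flat_nonneg)
    show "?u x * inverse (?u x + ?v x) = 1" if "x \<in> ball y r" for x
    proof -
      have "norm (x - y) < r" using that by (simp add: dist_norm norm_minus_commute)
      then have "?q x \<le> r\<^sup>2" by (intro power_mono) auto
      then have "?v x = 0" by (intro flat_nonpos) simp
      then show ?thesis using pos[of x] by simp
    qed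
    show "?u x * inverse (?u x + ?v x) = 0" if "x \<notin> cball y (2 * r)" for x
    proof -
      have "2 * r \<le> norm (x - y)" using that by (simp add: dist_norm norm_minus_commute)
      then have "(2 * r)\<^sup>2 \<le> ?q x" using r by (intro power_mono) auto
      then have "?u x = 0" by (intro flat_nonpos) (simp add: power_mult_distrib)
      then show ?thesis by simp
    qed
  qed
qed

lemma integrable_compact_support:
  fixes f :: "'a::euclidean_space \<Rightarrow> 'b::{banach,second_countable_topology}"
  assumes "continuous_on UNIV f" "compact K" "\<And>x. x \<notin> K \<Longrightarrow> f x = 0"
  shows "integrable lborel f"
proof -
  have "integrable lborel (\<lambda>x. indicator K x *\<^sub>R f x)"
    by (rule borel_integrable_compact[OF assms(2) continuous_on_subset[OF assms(1)]]) simp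
  moreover have "(\<lambda>x. indicator K x *\<^sub>R f x) = f" using assms(3) by (auto simp: fun_eq_iff indicator_def)
  ultimately show ?thesis by simp
qed

lemma mollifier:
  assumes e: "0 < e"
  obtains \<rho> :: "real^'n::finite \<Rightarrow> real" where "smooth_on UNIV \<rho>" "\<And>x. 0 \<le> \<rho> x"
    "\<And>x. x \<notin> cball 0 e \<Longrightarrow> \<rho> x = 0" "(LINT x|lborel. \<rho> x) = 1"
proof -
  obtain b :: "real^'n \<Rightarrow> real" where b: "smooth_on UNIV b" "\<And>x. 0 \<le> b x"
      "\<And>x. x \<in> ball 0 (e / 2) \<Longrightarrow> b x = 1" "\<And>x. x \<notin> cball 0 (2 * (e / 2)) \<Longrightarrow> b x = 0"
    using bump_function[of "e / 2" 0] e by (metis half_gt_zero)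
  have bint: "integrable lborel b"
    by (rule integrable_compact_support[OF smooth_on_imp_continuous_on[OF b(1)] compact_cball b(4)])
  have "0 < measure lborel (ball (0::real^'n) (e / 2))"
    using content_ball_pos[of "e / 2" "0::real^'n"] e by simp
  also have "\<dots> = (LINT x|lborel. indicator (ball (0::real^'n) (e / 2)) x)" by simp
  also have "\<dots> \<le> (LINT x|lborel. b x)"
    using b(2,3) bint emeasure_bounded_finite[OF bounded_ball, of "0::real^'n" "e / 2"]
    by (intro integral_mono integrable_real_indicator) (auto simp: indicator_def)
  finally have I: "0 < (LINT x|lborel. b x)" .
  show thesis
  proof (rule that[of "\<lambda>x. inverse (LINT x|lborel. b x) * b x"])
    show "smooth_on UNIV (\<lambda>x. inverse (LINT x|lborel. b x) * b x)"
      by (intro smooth_on_mult smooth_on_const b open_UNIV)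
  qed (use I b in auto)
qed

section \<open>Change of variables\<close>

text \<open>
  The theorem \<open>has_absolute_integral_change_of_variables\<close> is about vectors whose index type is
  well-ordered. An arbitrary finite index type is replaced by a copy of itself that is ordered by an enumeration; the
  isometry of the corresponding vector spaces transfers the theorem.
\<close>

typedef 'a well_ordered_copy = "UNIV :: 'a set" by simp

definition position :: "'a::finite \<Rightarrow> nat" where
  "position = (SOME f. inj f)"

lemma inj_position: "inj position"
proof -
  have "\<exists>f :: 'a \<Rightarrow> nat. inj f" using finite_imp_inj_to_nat_seg[OF finite_class.finite_UNIV] by blast
  then show ?thesis unfolding position_def by (rule someI_ex)
qed

instantiation well_ordered_copy :: (finite) "{finite, wellorder}"
begin

definition less_eq_well_ordered_copy :: "'a well_ordered_copy \<Rightarrow> 'a well_ordered_copy \<Rightarrow> bool" where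
  "x \<le> y \<longleftrightarrow> position (Rep_well_ordered_copy x) \<le> position (Rep_well_ordered_copy y)"

definition less_well_ordered_copy :: "'a well_ordered_copy \<Rightarrow> 'a well_ordered_copy \<Rightarrow> bool" where
  "x < y \<longleftrightarrow> position (Rep_well_ordered_copy x) < position (Rep_well_ordered_copy y)"

instance
proof
  have eq: "(UNIV :: 'a well_ordered_copy set) = range Abs_well_ordered_copy"
    by (metis Rep_well_ordered_copy_inverse UNIV_eq_I rangeI)
  show "finite (UNIV :: 'a well_ordered_copy set)"
    by (rule finite_surj[OF finite_class.finite_UNIV equalityD1[OF eq]])
next
  fix x y :: "'a well_ordered_copy"
  assume "x \<le> y" "y \<le> x"
  then have "position (Rep_well_ordered_copy x) = position (Rep_well_ordered_copy y)"
    unfolding less_eq_well_ordered_copy_def by (rule order_antisym)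
  then have "Rep_well_ordered_copy x = Rep_well_ordered_copy y" by (rule injD[OF inj_position])
  then show "x = y" by (rule Rep_well_ordered_copy_inject[THEN iffD1])
next
  fix P :: "'a well_ordered_copy \<Rightarrow> bool" and a
  assume *: "\<And>x. (\<And>y. y < x \<Longrightarrow> P y) \<Longrightarrow> P x"
  show "P a"
    by (induction a rule: measure_induct_rule[of "\<lambda>x. position (Rep_well_ordered_copy x)"])
       (rule *, simp add: less_well_ordered_copy_def)
qed (auto simp: less_eq_well_ordered_copy_def less_well_ordered_copy_def)

end

abbreviation "rep_index \<equiv> Rep_well_ordered_copy"

lemma bij_rep_index: "bij rep_index"
  by (metis Abs_well_ordered_copy_inverse Rep_well_ordered_copy_inject UNIV_I bijI')

definition to_copy :: "real^'n \<Rightarrow> real^('n::finite well_ordered_copy)" where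
  "to_copy x = (\<chi> i. x $ rep_index i)"

definition of_copy :: "real^('n::finite well_ordered_copy) \<Rightarrow> real^'n" where
  "of_copy x = (\<chi> i. x $ Abs_well_ordered_copy i)"

lemma of_copy_to_copy [simp]: "of_copy (to_copy x) = x"
  and to_copy_of_copy [simp]: "to_copy (of_copy y) = y"
  by (simp_all add: of_copy_def to_copy_def vec_eq_iff Abs_well_ordered_copy_inverse Rep_well_ordered_copy_inverse)

lemma linear_to_copy: "linear to_copy" and linear_of_copy: "linear of_copy"
  by (auto intro!: linearI simp: to_copy_def of_copy_def vec_eq_iff)

lemma to_copy_has_derivative: "(to_copy has_derivative to_copy) F"
  by (rule bounded_linear_imp_has_derivative) (use linear_to_copy linear_conv_bounded_linear in blast)

lemma of_copy_has_derivative: "(of_copy has_derivative of_copy) F"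
  by (rule bounded_linear_imp_has_derivative) (use linear_of_copy linear_conv_bounded_linear in blast)

lemma continuous_of_copy: "continuous_on UNIV of_copy"
  using linear_of_copy by (intro linear_continuous_on) (simp add: linear_conv_bounded_linear)

lemma measurable_of_copy: "of_copy \<in> measurable lborel borel"
  using borel_measurable_continuous_onI[OF continuous_of_copy] by simp

text \<open>
  Conjugation with the bijection \<open>r\<close> preserves the signs of permutations.
\<close>

lemma det_reindex:
  fixes A :: "real^'n::finite^'n" and r :: "'k::finite \<Rightarrow> 'n"
  assumes r: "bij r"
  shows "det (\<chi> i j. A $ r i $ r j) = det A"
proof -
  have inv: "inv r (r i) = i" "r (inv r k) = k" for i k
    using r by (simp_all add: bij_is_inj bij_is_surj surj_f_inv_f)
  have ri: "bij (inv r)" using r by (rule bij_imp_bij_inv)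
  have perm: "r \<circ> p \<circ> inv r permutes UNIV" "sign (r \<circ> p \<circ> inv r) = sign p" if p: "p permutes UNIV" for p
  proof -
    show "r \<circ> p \<circ> inv r permutes UNIV"
      using bij_comp[OF bij_comp[OF ri permutes_bij[OF p]] r] by (intro bij_imp_permutes) (simp_all add: o_assoc)
    have "map_permutation UNIV r p = r \<circ> p \<circ> inv r"
      using bij_is_surj[OF r] by (simp add: map_permutation_def restrict_id_def fun_eq_iff)
    then show "sign (r \<circ> p \<circ> inv r) = sign p"
      using sign_map_permutation[OF bij_is_inj[OF r] p] by simp
  qed
  have perm': "inv r \<circ> q \<circ> r permutes UNIV" if q: "q permutes UNIV" for q
    using bij_comp[OF bij_comp[OF r permutes_bij[OF q]] ri] by (intro bij_imp_permutes) (simp_all add: o_assoc)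
  have prod: "(\<Prod>i\<in>UNIV. A $ r i $ r (p i)) = (\<Prod>k\<in>UNIV. A $ k $ (r \<circ> p \<circ> inv r) k)" for p
    using prod.reindex_bij_betw[OF r[unfolded bij_def[symmetric]], of "\<lambda>k. A $ k $ (r \<circ> p \<circ> inv r) k"] by (simp add: inv)
  show ?thesis
    unfolding det_def
    by (rule sum.reindex_bij_witness[where i="\<lambda>q. inv r \<circ> q \<circ> r" and j="\<lambda>p. r \<circ> p \<circ> inv r"])
       (auto simp: perm perm' prod fun_eq_iff inv)
qed

lemma prod_Basis_cart: "(\<Prod>b\<in>Basis. v \<bullet> b) = (\<Prod>i\<in>UNIV. v $ i)" for v :: "real^'k::finite"
  by (simp add: Basis_vec_def cart_eq_inner_axis axis_eq_axis prod.UNION_disjoint)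

lemma distr_of_copy: "distr lborel borel (of_copy :: real^('n::finite well_ordered_copy) \<Rightarrow> real^'n) = lborel"
proof (rule lborel_eqI[symmetric])
  fix l u :: "real^'n" assume le: "\<And>b. b \<in> Basis \<Longrightarrow> l \<bullet> b \<le> u \<bullet> b"
  have le': "l $ i \<le> u $ i" for i using le[of "axis i 1"] by (simp add: inner_axis axis_in_Basis_iff)
  have vim: "of_copy -` box l u = box (to_copy l) (to_copy u)"
  proof (rule set_eqI)
    fix x :: "real^('n well_ordered_copy)"
    show "x \<in> of_copy -` box l u \<longleftrightarrow> x \<in> box (to_copy l) (to_copy u)"
      unfolding vimage_eq mem_box_cart of_copy_def to_copy_def
      by (simp, metis Abs_well_ordered_copy_inverse Rep_well_ordered_copy_inverse UNIV_I)
  qed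
  have "emeasure (distr lborel borel of_copy) (box l u) = emeasure lborel (box (to_copy l) (to_copy u))"
    by (subst emeasure_distr[OF measurable_of_copy]) (simp_all add: vim)
  also have "\<dots> = ennreal (\<Prod>b\<in>Basis. (to_copy u - to_copy l) \<bullet> b)"
    using le' by (intro emeasure_lborel_box) (auto simp: Basis_vec_def inner_axis to_copy_def)
  also have "(\<Prod>b\<in>Basis. (to_copy u - to_copy l) \<bullet> b) = (\<Prod>i\<in>UNIV. to_copy u $ i - to_copy l $ i)"
    by (simp add: prod_Basis_cart)
  also have "(\<Prod>i\<in>UNIV. to_copy u $ i - to_copy l $ i) = (\<Prod>k\<in>UNIV. u $ k - l $ k)"
    using prod.reindex_bij_betw[OF bij_rep_index, of "\<lambda>k. u $ k - l $ k"] by (simp add: to_copy_def)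
  also have "\<dots> = (\<Prod>b\<in>Basis. (u - l) \<bullet> b)" by (simp add: prod_Basis_cart)
  finally show "emeasure (distr lborel borel of_copy) (box l u) = (\<Prod>b\<in>Basis. (u - l) \<bullet> b)" .
qed simp

text \<open>
  The functions in \<open>has_absolute_integral_change_of_variables\<close> are vector-valued, so \<open>complex\<close> is
  identified with \<open>real^2\<close>. The transformed integrand \<open>k\<close> is named, so that its integrability may be shown by other means.
\<close>

lemma change_of_variables_wellorder:
  fixes g :: "real^'m::{finite,wellorder} \<Rightarrow> real^'m::_" and H k :: "real^'m::_ \<Rightarrow> complex"
  assumes S: "open S" and g: "\<And>x. x \<in> S \<Longrightarrow> (g has_derivative g' x) (at x)" and inj: "inj_on g S"
    and H: "integrable lborel H" "\<And>y. y \<notin> g ` S \<Longrightarrow> H y = 0"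
    and k: "integrable lborel k" "\<And>x. x \<in> S \<Longrightarrow> k x = \<bar>det (matrix (g' x))\<bar> *\<^sub>R H (g x)"
      "\<And>x. x \<notin> S \<Longrightarrow> k x = 0"
  shows "(LINT x|lborel. k x) = (LINT y|lborel. H y)"
proof -
  define P :: "complex \<Rightarrow> real^2" where "P = (\<lambda>z. vector [Re z, Im z])"
  have P: "bounded_linear P"
    unfolding linear_conv_bounded_linear[symmetric] P_def
    by (rule linearI) (simp_all add: vec_eq_iff forall_2)
  have injP: "P z = P w \<Longrightarrow> z = w" for z w
    by (simp add: P_def vec_eq_iff forall_2 complex_eq_iff)
  have HP: "H absolutely_integrable_on (g ` S)"
  proof -
    have "(\<lambda>x. indicator (g ` S) x *\<^sub>R H x) = H" using H(2) by (auto simp: fun_eq_iff indicator_def)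
    then show ?thesis using integrable_completion[of H lborel] H(1) by (simp add: set_integrable_def)
  qed
  have "(\<lambda>x. P (H x)) absolutely_integrable_on (g ` S)"
    using absolutely_integrable_linear[OF HP P] by (simp add: o_def)
  then have "integral S (\<lambda>x. \<bar>det (matrix (g' x))\<bar> *\<^sub>R P (H (g x))) = integral (g ` S) (\<lambda>x. P (H x))"
    using has_absolute_integral_change_of_variables[of S g g' "\<lambda>x. P (H x)" "integral (g ` S) (\<lambda>x. P (H x))"]
      S g inj by (auto intro: has_derivative_at_withinI)
  also have "(\<lambda>x. \<bar>det (matrix (g' x))\<bar> *\<^sub>R P (H (g x))) = (\<lambda>x. P (\<bar>det (matrix (g' x))\<bar> *\<^sub>R H (g x)))"
    by (simp add: linear_cmul[OF bounded_linear.linear[OF P]])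
  also have "integral S (\<lambda>x. P (\<bar>det (matrix (g' x))\<bar> *\<^sub>R H (g x))) = integral S (\<lambda>x. P (k x))"
    by (rule integral_cong) (simp add: k(2))
  finally have 1: "integral S (\<lambda>x. P (k x)) = integral (g ` S) (\<lambda>x. P (H x))" .
  have res: "integral T (\<lambda>x. P (f x)) = P (LINT x|lborel. f x)"
    if f: "integrable lborel f" "\<And>x. x \<notin> T \<Longrightarrow> f x = 0" for f :: "real^'m::_ \<Rightarrow> complex" and T
  proof -
    have P0: "P 0 = 0" using linear_0[OF bounded_linear.linear[OF P]] .
    have "integral T (\<lambda>x. P (f x)) = integral UNIV (\<lambda>x. if x \<in> T then P (f x) else 0)"
      by (simp add: integral_restrict_UNIV)
    also have "(\<lambda>x. if x \<in> T then P (f x) else 0) = P \<circ> f" using f(2) P0 by (auto simp: fun_eq_iff)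
    also have "integral UNIV (P \<circ> f) = P (integral UNIV f)"
      by (rule integral_linear[OF _ P]) (rule integrable_on_lborel[OF f(1)])
    finally show ?thesis by (simp add: integral_lborel[OF f(1)])
  qed
  have "P (LINT x|lborel. k x) = P (LINT y|lborel. H y)"
    using 1 res[OF k(1,3)] res[OF H] by simp
  then show ?thesis by (rule injP)
qed

lemma change_of_variables_lborel:
  fixes g :: "real^'n::finite \<Rightarrow> real^'n" and H k :: "real^'n \<Rightarrow> complex"
  assumes S: "open S" and g: "\<And>x. x \<in> S \<Longrightarrow> (g has_derivative g' x) (at x)" and inj: "inj_on g S"
    and H: "integrable lborel H" "\<And>y. y \<notin> g ` S \<Longrightarrow> H y = 0"
    and k: "integrable lborel k" "\<And>x. x \<in> S \<Longrightarrow> k x = \<bar>det (matrix (g' x))\<bar> *\<^sub>R H (g x)"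
      "\<And>x. x \<notin> S \<Longrightarrow> k x = 0"
  shows "(LINT x|lborel. k x) = (LINT y|lborel. H y)"
proof -
  have tr: "integrable lborel (\<lambda>x. f (of_copy x))" "(LINT x|lborel. f (of_copy x)) = (LINT x|lborel. f x)"
    if "integrable lborel f" for f :: "real^'n \<Rightarrow> complex"
  proof -
    have fm: "f \<in> borel_measurable borel" using borel_measurable_integrable[OF that] by simp
    show "integrable lborel (\<lambda>x. f (of_copy x))"
      using integrable_distr_eq[OF measurable_of_copy, of f] fm that by (simp add: distr_of_copy)
    show "(LINT x|lborel. f (of_copy x)) = (LINT x|lborel. f x)"
      using integral_distr[OF measurable_of_copy, of f] fm by (simp add: distr_of_copy)
  qed
  have "(LINT x|lborel. k (of_copy x)) = (LINT y|lborel. H (of_copy y))"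
  proof (rule change_of_variables_wellorder[where S="of_copy -` S" and g="\<lambda>x. to_copy (g (of_copy x))"
        and g'="\<lambda>x h. to_copy (g' (of_copy x) (of_copy h))"])
    show "open (of_copy -` S)" by (rule open_vimage[OF S continuous_of_copy])
    show "((\<lambda>x. to_copy (g (of_copy x))) has_derivative (\<lambda>h. to_copy (g' (of_copy x) (of_copy h)))) (at x)"
      if "x \<in> of_copy -` S" for x
    proof -
      have "(g has_derivative g' (of_copy x)) (at (of_copy x))" using g that by simp
      from has_derivative_compose[OF has_derivative_compose[OF of_copy_has_derivative this] to_copy_has_derivative]
      show ?thesis .
    qed
    show "inj_on (\<lambda>x. to_copy (g (of_copy x))) (of_copy -` S)"
    proof (rule inj_onI)
      fix x y assume xy: "x \<in> of_copy -` S" "y \<in> of_copy -` S"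
        and "to_copy (g (of_copy x)) = to_copy (g (of_copy y))"
      then have "of_copy (to_copy (g (of_copy x))) = of_copy (to_copy (g (of_copy y)))" by (simp only:)
      then have "of_copy x = of_copy y" using inj_onD[OF inj, of "of_copy x" "of_copy y"] xy by simp
      then have "to_copy (of_copy x) = to_copy (of_copy y)" by (simp only:)
      then show "x = y" by simp
    qed
    show "H (of_copy y) = 0" if "y \<notin> (\<lambda>x. to_copy (g (of_copy x))) ` (of_copy -` S)" for y
    proof (rule H(2), rule notI)
      assume "of_copy y \<in> g ` S"
      then obtain x where x: "x \<in> S" "of_copy y = g x" by blast
      have "y = to_copy (g x)" using arg_cong[where f=to_copy, OF x(2)] by simp
      with x have "to_copy x \<in> of_copy -` S" "y = to_copy (g (of_copy (to_copy x)))"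
        by simp_all
      with that show False by blast
    qed
    show "k (of_copy x) = \<bar>det (matrix (\<lambda>h. to_copy (g' (of_copy x) (of_copy h))))\<bar> *\<^sub>R H (of_copy (to_copy (g (of_copy x))))"
      if "x \<in> of_copy -` S" for x
    proof -
      let ?A = "matrix (g' (of_copy x))"
      have ax: "of_copy (axis j 1) = (axis (rep_index j) 1 :: real^'n)" for j
        by (auto simp: of_copy_def axis_def vec_eq_iff Abs_well_ordered_copy_inverse Rep_well_ordered_copy_inverse)
      have "matrix (\<lambda>h. to_copy (g' (of_copy x) (of_copy h))) = (\<chi> i j. ?A $ rep_index i $ rep_index j)"
        by (simp add: matrix_def ax to_copy_def vec_eq_iff)
      then show ?thesis using k(2)[of "of_copy x"] that det_reindex[OF bij_rep_index, of ?A] by simp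
    qed
  qed (use tr H k in auto)
  then show ?thesis using tr[OF H(1)] tr[OF k(1)] by simp
qed

section \<open>Topologies generated by seminorms\<close>

definition function_space :: "('a \<Rightarrow> complex) set \<Rightarrow> bool" where
  "function_space V \<longleftrightarrow> (\<lambda>_. 0) \<in> V \<and>
     (\<forall>f\<in>V. \<forall>g\<in>V. (\<lambda>x. f x + g x) \<in> V) \<and> (\<forall>c. \<forall>f\<in>V. (\<lambda>x. c * f x) \<in> V)"

lemma function_space_zero: "function_space V \<Longrightarrow> (\<lambda>_. 0) \<in> V"
  by (simp add: function_space_def)

lemma function_space_add: "function_space V \<Longrightarrow> f \<in> V \<Longrightarrow> g \<in> V \<Longrightarrow> (\<lambda>x. f x + g x) \<in> V"
  by (simp add: function_space_def)

lemma function_space_scale: "function_space V \<Longrightarrow> f \<in> V \<Longrightarrow> (\<lambda>x. c * f x) \<in> V"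
  by (simp add: function_space_def)

lemma function_space_minus: "function_space V \<Longrightarrow> f \<in> V \<Longrightarrow> (\<lambda>x. - f x) \<in> V"
  using function_space_scale[of V f "- 1"] by simp

lemma function_space_diff:
  assumes "function_space V" "f \<in> V" "g \<in> V"
  shows "(\<lambda>x. f x - g x) \<in> V"
  using function_space_add[OF assms(1,2) function_space_minus[OF assms(1,3)]] by simp

context
  fixes V :: "('a \<Rightarrow> complex) set" and p
  assumes V: "function_space V" and p: "seminorm_on V p"
begin

lemma seminorm_scale: "f \<in> V \<Longrightarrow> p (\<lambda>x. c * f x) = cmod c * p f"
  using p by (simp add: seminorm_on_def)

lemma seminorm_add: "f \<in> V \<Longrightarrow> g \<in> V \<Longrightarrow> p (\<lambda>x. f x + g x) \<le> p f + p g"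
  using p by (simp add: seminorm_on_def)

lemma seminorm_zero: "p (\<lambda>_. 0) = 0"
  using seminorm_scale[of "\<lambda>_. 0" 0] V by (simp add: function_space_def)

lemma seminorm_minus: "f \<in> V \<Longrightarrow> p (\<lambda>x. - f x) = p f"
  using seminorm_scale[of f "- 1"] by simp

lemma seminorm_nonneg: "f \<in> V \<Longrightarrow> 0 \<le> p f"
proof -
  assume f: "f \<in> V"
  have "p (\<lambda>x. f x + - f x) \<le> p f + p (\<lambda>x. - f x)"
    by (rule seminorm_add[OF f function_space_minus[OF V f]])
  then show ?thesis using seminorm_minus[OF f] seminorm_zero by simp
qed

lemma seminorm_diff_commute: "f \<in> V \<Longrightarrow> g \<in> V \<Longrightarrow> p (\<lambda>x. f x - g x) = p (\<lambda>x. g x - f x)"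
  using seminorm_minus[OF function_space_diff[OF V, of f g]] by simp

lemma seminorm_triangle:
  "f \<in> V \<Longrightarrow> g \<in> V \<Longrightarrow> h \<in> V \<Longrightarrow> p (\<lambda>x. f x - h x) \<le> p (\<lambda>x. f x - g x) + p (\<lambda>x. g x - h x)"
  using seminorm_add[OF function_space_diff[OF V, of f g] function_space_diff[OF V, of g h]] by simp

lemma seminorm_le_diff: "f \<in> V \<Longrightarrow> g \<in> V \<Longrightarrow> \<bar>p f - p g\<bar> \<le> p (\<lambda>x. f x - g x)"
  using seminorm_add[OF function_space_diff[OF V, of f g], of g]
    seminorm_add[OF function_space_diff[OF V, of g f], of f] seminorm_diff_commute[of f g]
  by simp

end

context
  fixes V :: "('a \<Rightarrow> complex) set" and P
  assumes V: "function_space V" and P: "\<And>p. p \<in> P \<Longrightarrow> seminorm_on V p"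
begin

lemma openin_seminorm_ball:
  "p \<in> P \<Longrightarrow> f \<in> V \<Longrightarrow> 0 < e \<Longrightarrow> openin (seminorm_topology V P) {g \<in> V. p (\<lambda>x. g x - f x) < e}"
  unfolding seminorm_topology_def
  by (rule openin_topology_generated_by_iff[THEN iffD2], rule generate_topology_on.Basis) blast

lemma topspace_seminorm_topology:
  assumes "P \<noteq> {}"
  shows "topspace (seminorm_topology V P) = V"
proof
  show "topspace (seminorm_topology V P) \<subseteq> V"
    unfolding seminorm_topology_def topology_generated_by_topspace by blast
  obtain p where p: "p \<in> P" using assms by blast
  show "V \<subseteq> topspace (seminorm_topology V P)"
  proof
    fix f assume f: "f \<in> V"
    have "f \<in> {g \<in> V. p (\<lambda>x. g x - f x) < 1}"
      using f seminorm_zero[OF V P[OF p]] by simp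
    then show "f \<in> topspace (seminorm_topology V P)"
      using openin_subset[OF openin_seminorm_ball[OF p f, of 1]] by auto
  qed
qed

text \<open>
  The subbasic sets may be centred anywhere; by the triangle inequality, a ball about \<open>h\<close> that
  contains \<open>f\<close> contains a ball about \<open>f\<close>.
\<close>

lemma seminorm_topology_nhd:
  assumes "openin (seminorm_topology V P) U" "f \<in> U"
  shows "\<exists>F e. finite F \<and> F \<subseteq> P \<and> 0 < e \<and> {g \<in> V. \<forall>p\<in>F. p (\<lambda>x. g x - f x) < e} \<subseteq> U"
proof -
  let ?S = "{{g \<in> V. p (\<lambda>x. g x - f x) < e} | p f e. p \<in> P \<and> f \<in> V \<and> 0 < e}"
  have "generate_topology_on ?S U"
    using assms(1) unfolding seminorm_topology_def openin_topology_generated_by_iff .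
  then show ?thesis using assms(2)
  proof (induction arbitrary: f)
    case Empty
    then show ?case by simp
  next
    case (Int a b)
    from Int.IH(1)[of f] Int.prems obtain F d where 1: "finite F" "F \<subseteq> P" "0 < d"
      "{g \<in> V. \<forall>p\<in>F. p (\<lambda>x. g x - f x) < d} \<subseteq> a" by auto
    from Int.IH(2)[of f] Int.prems obtain G e where 2: "finite G" "G \<subseteq> P" "0 < e"
      "{g \<in> V. \<forall>p\<in>G. p (\<lambda>x. g x - f x) < e} \<subseteq> b" by auto
    show ?case
      by (rule exI[of _ "F \<union> G"], rule exI[of _ "min d e"]) (use 1 2 in auto)
  next
    case (UN K)
    then obtain k where k: "k \<in> K" "f \<in> k" by blast
    from UN.IH[OF this] obtain F d where "finite F" "F \<subseteq> P" "0 < d"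
      "{g \<in> V. \<forall>p\<in>F. p (\<lambda>x. g x - f x) < d} \<subseteq> k" by auto
    then show ?case using k by (intro exI[of _ F] exI[of _ d]) auto
  next
    case (Basis s)
    then obtain p h e where s: "s = {g \<in> V. p (\<lambda>x. g x - h x) < e}" "p \<in> P" "h \<in> V" "0 < e"
      by auto
    have f: "f \<in> V" "p (\<lambda>x. f x - h x) < e" using Basis s by auto
    have "g \<in> s" if "g \<in> V" "p (\<lambda>x. g x - f x) < e - p (\<lambda>x. f x - h x)" for g
      using seminorm_triangle[OF V P[OF s(2)] that(1) f(1) s(3)] that by (simp add: s(1))
    then have "finite {p} \<and> {p} \<subseteq> P \<and> 0 < e - p (\<lambda>x. f x - h x) \<and>
        {g \<in> V. \<forall>q\<in>{p}. q (\<lambda>x. g x - f x) < e - p (\<lambda>x. f x - h x)} \<subseteq> s"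
      using s f by auto
    then show ?case by (intro exI)
  qed
qed

lemma continuous_map_seminorm_topology:
  fixes q :: "('a \<Rightarrow> complex) \<Rightarrow> 'b::metric_space"
  assumes F: "finite F" "F \<subseteq> P" "P \<noteq> {}" and c: "0 \<le> c"
    and q: "\<And>f g. f \<in> V \<Longrightarrow> g \<in> V \<Longrightarrow> dist (q f) (q g) \<le> c * (\<Sum>p\<in>F. p (\<lambda>x. f x - g x))"
  shows "continuous_map (seminorm_topology V P) euclidean q"
  unfolding continuous_map_def
proof (intro conjI allI impI)
  fix W :: "'b set" assume "openin euclidean W"
  then have W: "open W" by simp
  have "\<exists>T. openin (seminorm_topology V P) T \<and> f \<in> T \<and> T \<subseteq> {f \<in> V. q f \<in> W}"
    if f: "f \<in> V" "q f \<in> W" for f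
  proof -
    obtain e where e: "0 < e" "ball (q f) e \<subseteq> W" using W f(2) openE by blast
    \<comment> \<open>The summands \<open>1\<close> keep the denominator positive when \<open>c\<close> is zero or \<open>F\<close> is empty.\<close>
    define d where "d = e / (c * (real (card F) + 1) + 1)"
    have pos: "0 < c * (real (card F) + 1) + 1" using c by (simp add: add_nonneg_pos)
    have d: "0 < d" using e pos by (simp add: d_def)
    let ?T = "V \<inter> (\<Inter>p\<in>F. {g \<in> V. p (\<lambda>x. g x - f x) < d})"
    have "openin (seminorm_topology V P) V"
      using openin_topspace[of "seminorm_topology V P"] topspace_seminorm_topology[OF F(3)] by simp
    then have 1: "openin (seminorm_topology V P) ?T"
      using openin_Int_Inter[of "(\<lambda>p. {g \<in> V. p (\<lambda>x. g x - f x) < d}) ` F"] F(1)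
        openin_seminorm_ball[OF _ f(1) d] F(2) by (metis (no_types, lifting) finite_imageI imageE in_mono)
    have "p (\<lambda>x. f x - f x) < d" if "p \<in> F" for p
      using seminorm_zero[OF V P[OF subsetD[OF F(2) that]]] d by (simp only: diff_self)
    then have 2: "f \<in> ?T" using f(1) by blast
    have "q g \<in> W" if g: "g \<in> ?T" for g
    proof -
      have "dist (q g) (q f) \<le> c * (\<Sum>p\<in>F. p (\<lambda>x. g x - f x))" using q g f by auto
      also have "\<dots> \<le> c * (\<Sum>p\<in>F. d)"
        using g c by (intro mult_left_mono sum_mono) (auto intro: less_imp_le)
      also have "\<dots> = d * (c * real (card F))" by simp
      also have "\<dots> < d * (c * (real (card F) + 1) + 1)" using d c by (simp add: algebra_simps add_pos_nonneg)
      also have "\<dots> = e" using pos by (simp add: d_def)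
      finally show ?thesis using e(2) by (auto simp: dist_commute)
    qed
    then show ?thesis using 1 2 by blast
  qed
  then have "openin (seminorm_topology V P) {f \<in> V. q f \<in> W}"
    by (subst openin_subopen) blast
  then show "openin (seminorm_topology V P) {x \<in> topspace (seminorm_topology V P). q x \<in> W}"
    using topspace_seminorm_topology[OF F(3)] by simp
qed simp

lemma continuous_seminorm_sum:
  assumes F: "finite F" "F \<subseteq> P" "P \<noteq> {}" and c: "0 \<le> c" and q: "seminorm_on V q"
    and le: "\<And>f. f \<in> V \<Longrightarrow> q f \<le> c * (\<Sum>p\<in>F. p f)"
  shows "continuous_seminorm V (seminorm_topology V P) q"
  unfolding continuous_seminorm_def
proof
  show "continuous_map (seminorm_topology V P) euclideanreal q"
  proof (rule continuous_map_seminorm_topology[OF F c])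
    fix f g assume "f \<in> V" "g \<in> V"
    then show "dist (q f) (q g) \<le> c * (\<Sum>p\<in>F. p (\<lambda>x. f x - g x))"
      using seminorm_le_diff[OF V q, of f g] le[OF function_space_diff[OF V, of f g]]
      by (simp add: dist_real_def)
  qed
qed (rule q)

text \<open>
  A continuous seminorm is less than \<open>1\<close> on a neighbourhood of zero given by finitely many of the
  generating seminorms; the domination follows by scaling.
\<close>

lemma continuous_seminorm_dominated:
  assumes q: "continuous_seminorm V (seminorm_topology V P) q" and "P \<noteq> {}"
  shows "\<exists>F c. finite F \<and> F \<subseteq> P \<and> 0 \<le> c \<and> (\<forall>f\<in>V. q f \<le> c * (\<Sum>p\<in>F. p f))"
proof -
  note top = topspace_seminorm_topology[OF \<open>P \<noteq> {}\<close>]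
  have qs: "seminorm_on V q" and qc: "continuous_map (seminorm_topology V P) euclideanreal q"
    using q by (auto simp: continuous_seminorm_def)
  have z: "(\<lambda>_. 0) \<in> V" using V by (simp add: function_space_def)
  have op: "openin (seminorm_topology V P) {f \<in> V. q f \<in> {..<1}}"
    using openin_continuous_map_preimage[OF qc, of "{..<1}"] top by simp
  obtain F e where F: "finite F" "F \<subseteq> P" "0 < e"
    and sub: "{g \<in> V. \<forall>p\<in>F. p (\<lambda>x. g x - 0) < e} \<subseteq> {f \<in> V. q f \<in> {..<1}}"
    using seminorm_topology_nhd[OF op, of "\<lambda>_. 0"] z seminorm_zero[OF V qs] by auto
  have "q f \<le> 1 / e * (\<Sum>p\<in>F. p f)" if f: "f \<in> V" for f
  proof (rule field_le_epsilon)
    fix d :: real assume d: "0 < d"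
    let ?s = "\<Sum>p\<in>F. p f"
    \<comment> \<open>Scaling by \<open>e / t\<close> moves \<open>f\<close> into the neighbourhood, since \<open>p f < t\<close> for all \<open>p\<close> in \<open>F\<close>.\<close>
    define t where "t = ?s + d * e"
    have nn: "0 \<le> p f" if "p \<in> F" for p using seminorm_nonneg[OF V P f] F(2) that by blast
    have s0: "0 \<le> ?s" by (rule sum_nonneg) (rule nn)
    have t: "0 < t" using s0 d F(3) by (simp add: t_def add_nonneg_pos)
    let ?h = "\<lambda>x. complex_of_real (e / t) * f x"
    have h: "?h \<in> V" by (rule function_space_scale[OF V f])
    have ph: "p ?h < e" if p: "p \<in> F" for p
    proof -
      have "p ?h = e / t * p f"
        using seminorm_scale[OF V P f, of p "complex_of_real (e / t)"] p F(2,3) t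
        by (auto simp: norm_divide)
      moreover have "p f < t"
        using member_le_sum[of p F "\<lambda>p. p f"] nn p F(1,3) d by (auto simp: t_def intro: add_strict_increasing2 le_less_trans)
      moreover have "e / t * p f < e" if "p f < t"
        using that t F(3) by (simp add: field_simps)
      ultimately show ?thesis by simp
    qed
    then have "q ?h < 1" using sub h by auto
    then have "e / t * q f < 1"
      using seminorm_scale[OF V qs f, of "complex_of_real (e / t)"] t F(3) by (simp add: norm_divide)
    then have "q f \<le> t / e" using t F(3) by (simp add: field_simps)
    also have "t / e = 1 / e * ?s + d" using F(3) by (simp add: t_def field_simps)
    finally show "q f \<le> 1 / e * ?s + d" .
  qed
  then show ?thesis using F by (intro exI[of _ F] exI[of _ "1 / e"]) auto
qed

lemma bounded_subset_seminorm_topology: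
  assumes "P \<noteq> {}"
  shows "bounded_subset V (seminorm_topology V P) B \<longleftrightarrow> B \<subseteq> V \<and> (\<forall>p\<in>P. \<exists>M. \<forall>f\<in>B. p f \<le> M)"
proof (intro iffI conjI ballI)
  assume b: "bounded_subset V (seminorm_topology V P) B"
  then show "B \<subseteq> V" by (simp add: bounded_subset_def)
  fix p assume p: "p \<in> P"
  have z: "(\<lambda>_. 0) \<in> V" using V by (simp add: function_space_def)
  have "openin (seminorm_topology V P) {g \<in> V. p (\<lambda>x. g x - 0) < 1}"
    using openin_seminorm_ball[OF p z, of 1] by simp
  moreover have "(\<lambda>_. 0) \<in> {g \<in> V. p (\<lambda>x. g x - 0) < 1}" using z seminorm_zero[OF V P[OF p]] by simp
  ultimately have "\<exists>r>0. \<forall>c. r \<le> cmod c \<longrightarrow> B \<subseteq> (\<lambda>f x. c * f x) ` {g \<in> V. p (\<lambda>x. g x - 0) < 1}"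
    using b[unfolded bounded_subset_def, THEN conjunct2, rule_format, of "{g \<in> V. p (\<lambda>x. g x - 0) < 1}"]
    by simp
  then obtain r where r: "0 < r" "\<And>c. r \<le> cmod c \<Longrightarrow> B \<subseteq> (\<lambda>f x. c * f x) ` {g \<in> V. p (\<lambda>x. g x - 0) < 1}"
    by blast
  have "p f \<le> r" if "f \<in> B" for f
  proof -
    have "f \<in> (\<lambda>f x. complex_of_real r * f x) ` {g \<in> V. p (\<lambda>x. g x - 0) < 1}"
      using r(2)[of "complex_of_real r"] r(1) that by auto
    then obtain g where g: "f = (\<lambda>x. complex_of_real r * g x)" "g \<in> V" "p g < 1"
      by auto
    have "p f = r * p g" unfolding g(1) using seminorm_scale[OF V P[OF p] g(2), of "complex_of_real r"] r(1) by simp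
    also have "\<dots> \<le> r * 1" using g(3) r(1) by (intro mult_left_mono) auto
    finally show ?thesis by simp
  qed
  then show "\<exists>M. \<forall>f\<in>B. p f \<le> M" by blast
next
  assume *: "B \<subseteq> V \<and> (\<forall>p\<in>P. \<exists>M. \<forall>f\<in>B. p f \<le> M)"
  show "bounded_subset V (seminorm_topology V P) B"
    unfolding bounded_subset_def
  proof (intro conjI allI impI)
    show "B \<subseteq> V" using * by blast
    fix U assume U: "openin (seminorm_topology V P) U \<and> (\<lambda>_. 0) \<in> U"
    then obtain F e where F: "finite F" "F \<subseteq> P" "0 < e"
      and sub: "{g \<in> V. \<forall>p\<in>F. p (\<lambda>x. g x - 0) < e} \<subseteq> U"
      using seminorm_topology_nhd[of U "\<lambda>_. 0"] by auto
    obtain m where m: "\<And>p f. p \<in> P \<Longrightarrow> f \<in> B \<Longrightarrow> p f \<le> m p" using * by metis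
    define M where "M = (\<Sum>p\<in>F. \<bar>m p\<bar>)"
    have M0: "0 \<le> M" by (simp add: M_def sum_nonneg)
    have pM: "p f \<le> M" if "p \<in> F" "f \<in> B" for p f
      using m[of p f] member_le_sum[of p F "\<lambda>p. \<bar>m p\<bar>"] F that by (force simp: M_def)
    show "\<exists>r>0. \<forall>c. r \<le> cmod c \<longrightarrow> B \<subseteq> (\<lambda>f x. c * f x) ` U"
    proof (intro exI conjI allI impI subsetI)
      show r0: "0 < (M + 1) / e" using M0 F(3) by simp
      fix c f assume c: "(M + 1) / e \<le> cmod c" and f: "f \<in> B"
      have c0: "0 < cmod c" using c r0 by linarith
      let ?g = "\<lambda>x. inverse c * f x"
      have fV: "f \<in> V" using * f by blast
      have g: "?g \<in> V" by (rule function_space_scale[OF V fV])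
      have "p ?g < e" if p: "p \<in> F" for p
      proof -
        have "p ?g = p f / cmod c"
          using seminorm_scale[OF V P fV, of p "inverse c"] p F(2) by (auto simp: norm_inverse divide_inverse mult.commute)
        also have "\<dots> \<le> M / cmod c" using pM[OF p f] c0 by (simp add: divide_right_mono)
        also have "\<dots> < e" using c c0 F(3) M0 by (simp add: field_simps)
        finally show ?thesis .
      qed
      then have "?g \<in> U" using sub g by auto
      moreover have "f = (\<lambda>x. c * ?g x)" using c0 by (auto simp: fun_eq_iff)
      ultimately show "f \<in> (\<lambda>f x. c * f x) ` U" by (intro image_eqI[where f="\<lambda>f x. c * f x" and x="?g"])
    qed
  qed
qed

end

section \<open>Test functions supported in a compact set\<close>

lemma test_functions_on_iff:
  assumes "closed K"
  shows "\<phi> \<in> test_functions_on K \<longleftrightarrow> smooth_on UNIV \<phi> \<and> (\<forall>x. x \<notin> K \<longrightarrow> \<phi> x = 0)"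
proof -
  have "closure {x. \<phi> x \<noteq> 0} \<subseteq> K \<longleftrightarrow> {x. \<phi> x \<noteq> 0} \<subseteq> K"
    using closure_minimal[OF _ assms, of "{x. \<phi> x \<noteq> 0}"] closure_subset[of "{x. \<phi> x \<noteq> 0}"] by (meson subset_trans)
  then show ?thesis by (auto simp: test_functions_on_def)
qed

lemma test_functions_iff:
  "\<phi> \<in> test_functions X \<longleftrightarrow> (\<exists>K. compact K \<and> K \<subseteq> X \<and> \<phi> \<in> test_functions_on K)"
proof
  assume "\<phi> \<in> test_functions X"
  then show "\<exists>K. compact K \<and> K \<subseteq> X \<and> \<phi> \<in> test_functions_on K"
    unfolding test_functions_def test_functions_on_def by blast
next
  assume "\<exists>K. compact K \<and> K \<subseteq> X \<and> \<phi> \<in> test_functions_on K"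
  then obtain K where "compact K" "K \<subseteq> X" "\<phi> \<in> test_functions_on K" by blast
  moreover then have "compact (closure {x. \<phi> x \<noteq> 0})"
    using compact_Int_closed[of K "closure {x. \<phi> x \<noteq> 0}"]
    by (simp add: test_functions_on_def Int_absorb1)
  ultimately show "\<phi> \<in> test_functions X"
    by (auto simp: test_functions_def test_functions_on_def)
qed

lemma test_functions_on_subset:
  "compact K \<Longrightarrow> K \<subseteq> X \<Longrightarrow> test_functions_on K \<subseteq> test_functions X"
  by (auto simp: test_functions_iff)

lemma test_functions_on_mono: "K \<subseteq> L \<Longrightarrow> test_functions_on K \<subseteq> test_functions_on L"
  by (auto simp: test_functions_on_def)

lemma function_space_test_functions_on:
  assumes "closed K"
  shows "function_space (test_functions_on K)"
  unfolding function_space_def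
  by (simp add: test_functions_on_iff[OF assms] smooth_on_const smooth_on_add smooth_on_mult)

lemma function_space_test_functions: "function_space (test_functions X)"
  unfolding function_space_def
proof (intro conjI ballI allI)
  show "(\<lambda>_. 0) \<in> test_functions X"
    using function_space_zero[OF function_space_test_functions_on[of "{}"]]
      test_functions_on_subset[of "{}" X] by auto
next
  fix \<phi> \<theta> assume "\<phi> \<in> test_functions X" "\<theta> \<in> test_functions X"
  then obtain K L where K: "compact K" "K \<subseteq> X" "\<phi> \<in> test_functions_on K"
    and L: "compact L" "L \<subseteq> X" "\<theta> \<in> test_functions_on L"
    by (auto simp: test_functions_iff)
  have KL: "compact (K \<union> L)" using K(1) L(1) by (rule compact_Un)
  have "\<phi> \<in> test_functions_on (K \<union> L)" "\<theta> \<in> test_functions_on (K \<union> L)"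
    using K(3) L(3) test_functions_on_mono[of K "K \<union> L"] test_functions_on_mono[of L "K \<union> L"] by auto
  then have "(\<lambda>x. \<phi> x + \<theta> x) \<in> test_functions_on (K \<union> L)"
    by (rule function_space_add[OF function_space_test_functions_on[OF compact_imp_closed[OF KL]]])
  then show "(\<lambda>x. \<phi> x + \<theta> x) \<in> test_functions X"
    using test_functions_on_subset[OF KL, of X] K(2) L(2) by blast
next
  fix c \<phi> assume "\<phi> \<in> test_functions X"
  then obtain K where K: "compact K" "K \<subseteq> X" "\<phi> \<in> test_functions_on K"
    by (auto simp: test_functions_iff)
  have "(\<lambda>x. c * \<phi> x) \<in> test_functions_on K"
    by (rule function_space_scale[OF function_space_test_functions_on[OF compact_imp_closed[OF K(1)]] K(3)])
  then show "(\<lambda>x. c * \<phi> x) \<in> test_functions X"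
    using test_functions_on_subset[OF K(1,2)] by blast
qed

lemma test_functions_smooth: "\<phi> \<in> test_functions X \<Longrightarrow> smooth_on UNIV \<phi>"
  by (simp add: test_functions_def)

lemma iterated_partial_outside_support:
  assumes "closed K" "\<And>x. x \<notin> K \<Longrightarrow> \<phi> x = 0" "x \<notin> K"
  shows "iterated_partial is \<phi> x = 0"
proof -
  have "iterated_partial is \<phi> x = iterated_partial is (\<lambda>x. 0) x"
    by (rule iterated_partial_cong[of "- K"]) (use assms in auto)
  then show ?thesis by (simp add: iterated_partial_const)
qed

lemma jet_bound_outside_support:
  assumes "closed K" "\<And>x. x \<notin> K \<Longrightarrow> \<phi> x = 0" "x \<notin> K" "0 \<le> M"
  shows "jet_bound n \<phi> x M"
  using iterated_partial_outside_support[OF assms(1,2,3)] assms(4) by (simp add: jet_bound_def)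

lemma Cn_norm_le_iff:
  assumes "0 \<le> M"
  shows "Cn_norm n K f \<le> ennreal M \<longleftrightarrow> (\<forall>x\<in>K. jet_bound n f x M)"
proof -
  have "Cn_norm n K f \<le> ennreal M \<longleftrightarrow>
      (\<forall>is. length is \<le> n \<longrightarrow> (\<forall>x\<in>K. ennreal (norm (iterated_partial is f x)) \<le> ennreal M))"
    by (auto simp: Cn_norm_def SUP_le_iff)
  then show ?thesis using assms by (auto simp: jet_bound_def)
qed

lemma finite_lists_le: "finite {is :: 'n::finite list. length is \<le> n}"
  using finite_lists_length_le[of "UNIV :: 'n set" n] by simp

lemma jet_bound_compact:
  fixes f :: "real^'n::finite \<Rightarrow> 'b::real_normed_vector"
  assumes "smooth_on X f" "compact K" "K \<subseteq> X"
  shows "\<exists>M\<ge>0. \<forall>x\<in>K. jet_bound n f x M"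
proof -
  have "\<exists>M. \<forall>x\<in>K. norm (iterated_partial is f x) \<le> M" for "is" :: "'n list"
  proof -
    have "continuous_on K (iterated_partial is f)"
      using smooth_on_imp_continuous_on[OF smooth_on_iterated[OF smooth_on_subset[OF assms(1,3)]]] .
    from compact_continuous_image[OF this assms(2)]
    have "bounded (iterated_partial is f ` K)" by (rule compact_imp_bounded)
    then show ?thesis by (auto simp: bounded_iff)
  qed
  then obtain m where m: "\<And>is x. x \<in> K \<Longrightarrow> norm (iterated_partial is f x) \<le> m is" by metis
  let ?M = "\<Sum>is\<in>{is :: 'n list. length is \<le> n}. \<bar>m is\<bar>"
  have "m is \<le> ?M" if "length is \<le> n" for "is" :: "'n list"
    using member_le_sum[of "is" "{is. length is \<le> n}" "\<lambda>is. \<bar>m is\<bar>"] finite_lists_le that by fastforce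
  then have "jet_bound n f x ?M" if "x \<in> K" for x
    unfolding jet_bound_def using m[OF that] order_trans by blast
  then show ?thesis by (intro exI[of _ ?M]) (auto intro: sum_nonneg)
qed

context
  fixes K :: "(real^'n::finite) set"
  assumes K: "compact K"
begin

abbreviation "Cn n \<phi> \<equiv> enn2real (Cn_norm n K \<phi>)"

lemma test_function_jet_bound:
  assumes "\<phi> \<in> test_functions_on K"
  shows "\<exists>M\<ge>0. \<forall>x. jet_bound n \<phi> x M"
proof -
  have \<phi>: "smooth_on UNIV \<phi>" "\<And>x. x \<notin> K \<Longrightarrow> \<phi> x = 0"
    using assms by (auto simp: test_functions_on_iff[OF compact_imp_closed[OF K]])
  obtain M where M: "M \<ge> 0" "\<forall>x\<in>K. jet_bound n \<phi> x M"
    using jet_bound_compact[OF \<phi>(1) K] by auto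
  have "jet_bound n \<phi> x M" for x
    using M jet_bound_outside_support[where \<phi>=\<phi> and K=K and x=x and M=M and n=n, OF compact_imp_closed[OF K] \<phi>(2)] by (cases "x \<in> K") auto
  then show ?thesis using M by blast
qed

lemma jet_bound_Cn_norm:
  assumes "\<phi> \<in> test_functions_on K"
  shows "jet_bound n \<phi> x (Cn n \<phi>)"
proof -
  have \<phi>: "\<And>x. x \<notin> K \<Longrightarrow> \<phi> x = 0"
    using assms by (auto simp: test_functions_on_iff[OF compact_imp_closed[OF K]])
  obtain M where M: "M \<ge> 0" "\<forall>x. jet_bound n \<phi> x M" using test_function_jet_bound[OF assms] by blast
  then have "Cn_norm n K \<phi> \<le> ennreal M" by (simp add: Cn_norm_le_iff)
  then have "Cn_norm n K \<phi> < top" using ennreal_less_top le_less_trans by blast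
  then have "Cn_norm n K \<phi> \<le> ennreal (Cn n \<phi>)" by simp
  then have "\<forall>x\<in>K. jet_bound n \<phi> x (Cn n \<phi>)" by (subst (asm) Cn_norm_le_iff) auto
  then show ?thesis
    using jet_bound_outside_support[where \<phi>=\<phi> and K=K and x=x and M="Cn n \<phi>" and n=n, OF compact_imp_closed[OF K] \<phi>] by (cases "x \<in> K") auto
qed

lemma Cn_norm_le:
  assumes "0 \<le> M" "\<And>x. jet_bound n \<phi> x M"
  shows "Cn n \<phi> \<le> M"
  using assms Cn_norm_le_iff[of M n K \<phi>] enn2real_leI by blast

lemma jet_bound_cmult:
  fixes \<phi> :: "real^'n \<Rightarrow> complex"
  assumes "smooth_on UNIV \<phi>" "jet_bound n \<phi> x M"
  shows "jet_bound n (\<lambda>x. c * \<phi> x) x (cmod c * M)"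
  using assms(2) bounded_linear.iterated_partial_linear[OF bounded_linear_mult_right open_UNIV assms(1), of x _ c]
  by (simp add: jet_bound_def norm_mult mult_left_mono)

lemma seminorm_Cn_norm: "seminorm_on (test_functions_on K) (Cn n)"
  unfolding seminorm_on_def
proof (intro conjI ballI allI)
  fix \<phi> \<theta> assume pt: "\<phi> \<in> test_functions_on K" "\<theta> \<in> test_functions_on K"
  then have sm: "smooth_upto n UNIV \<phi>" "smooth_upto n UNIV \<theta>"
    using smooth_on_iff_upto test_functions_on_iff[OF compact_imp_closed[OF K]] by auto
  show "Cn n (\<lambda>x. \<phi> x + \<theta> x) \<le> Cn n \<phi> + Cn n \<theta>"
    by (intro Cn_norm_le jet_bound_add[OF open_UNIV sm UNIV_I] jet_bound_Cn_norm pt) simp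
next
  have le: "Cn n (\<lambda>x. c * \<phi> x) \<le> cmod c * Cn n \<phi>" if "\<phi> \<in> test_functions_on K" for c \<phi>
    using that by (intro Cn_norm_le jet_bound_cmult jet_bound_Cn_norm)
      (auto simp: test_functions_on_iff[OF compact_imp_closed[OF K]])
  fix c and \<phi> assume p: "\<phi> \<in> test_functions_on K"
  show "Cn n (\<lambda>x. c * \<phi> x) = cmod c * Cn n \<phi>"
  proof (cases "c = 0")
    case True
    then show ?thesis using le[OF p, of 0] by (simp add: antisym)
  next
    case False
    have "Cn n (\<lambda>x. inverse c * (c * \<phi> x)) \<le> cmod (inverse c) * Cn n (\<lambda>x. c * \<phi> x)"
      by (rule le[OF function_space_scale[OF function_space_test_functions_on[OF compact_imp_closed[OF K]] p]])
    moreover have "(\<lambda>x. inverse c * (c * \<phi> x)) = \<phi>" using False by (simp add: fun_eq_iff)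
    ultimately have "Cn n \<phi> \<le> cmod (inverse c) * Cn n (\<lambda>x. c * \<phi> x)" by simp
    then have "cmod c * Cn n \<phi> \<le> Cn n (\<lambda>x. c * \<phi> x)"
      using False by (simp add: norm_inverse norm_divide field_simps)
    then show ?thesis using le[OF p, of c] by simp
  qed
qed

text \<open>
  The defining norms increase with their order, so a continuous seminorm is dominated by a single one.
  Bounds on jets replace the extended real-valued norms from here on.
\<close>

lemma continuous_seminorm_test_functions_on_iff:
  assumes p: "seminorm_on (test_functions_on K) p"
  shows "continuous_map (test_functions_on_topology K) euclideanreal p \<longleftrightarrow>
    (\<exists>n c. 0 \<le> c \<and> (\<forall>\<phi>\<in>test_functions_on K. \<forall>M. (\<forall>x. jet_bound n \<phi> x M) \<longrightarrow> p \<phi> \<le> c * M))"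
    (is "_ \<longleftrightarrow> ?R")
proof
  note V = function_space_test_functions_on[OF compact_imp_closed[OF K]]
  have P: "\<And>p. p \<in> range Cn \<Longrightarrow> seminorm_on (test_functions_on K) p" using seminorm_Cn_norm by auto
  {
    assume "continuous_map (test_functions_on_topology K) euclideanreal p"
    then have "continuous_seminorm (test_functions_on K) (seminorm_topology (test_functions_on K) (range Cn)) p"
      using p by (simp add: continuous_seminorm_def test_functions_on_topology_def)
    from continuous_seminorm_dominated[OF V P this]
    obtain F c where F: "finite F" "F \<subseteq> range Cn" "0 \<le> c"
      "\<And>\<phi>. \<phi> \<in> test_functions_on K \<Longrightarrow> p \<phi> \<le> c * (\<Sum>q\<in>F. q \<phi>)" by auto
    obtain J where J: "finite J" "F = Cn ` J" using F(1,2) finite_subset_image by metis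
    define n where "n = Max (insert 0 J)"
    have nJ: "j \<le> n" if "j \<in> J" for j using J(1) that by (simp add: n_def)
    have "p \<phi> \<le> (c * real (card F)) * M" if \<phi>: "\<phi> \<in> test_functions_on K" and M: "\<forall>x. jet_bound n \<phi> x M" for \<phi> M
    proof -
      have M0: "0 \<le> M" using M jet_bound_nonneg by blast
      have "q \<phi> \<le> M" if q: "q \<in> F" for q
      proof -
        obtain j where j: "j \<in> J" "q = Cn j" using q J by auto
        show ?thesis unfolding j(2)
          by (rule Cn_norm_le[OF M0]) (use M jet_bound_mono[OF _ nJ[OF j(1)]] in blast)
      qed
      then have "(\<Sum>q\<in>F. q \<phi>) \<le> real (card F) * M" using sum_bounded_above[of F "\<lambda>q. q \<phi>" M] by simp
      then show ?thesis
        using F(4)[OF \<phi>] mult_left_mono[OF _ F(3)] by (simp add: mult.assoc order_trans)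
    qed
    then show ?R using F(3) by (intro exI[of _ n] exI[of _ "c * real (card F)"]) auto
  next
    assume ?R
    then obtain n c where c: "0 \<le> c"
      "\<And>\<phi> M. \<phi> \<in> test_functions_on K \<Longrightarrow> \<forall>x. jet_bound n \<phi> x M \<Longrightarrow> p \<phi> \<le> c * M" by blast
    have "continuous_seminorm (test_functions_on K) (seminorm_topology (test_functions_on K) (range Cn)) p"
    proof (rule continuous_seminorm_sum[OF V P _ _ _ c(1) p])
      show "p \<phi> \<le> c * (\<Sum>q\<in>{Cn n}. q \<phi>)" if "\<phi> \<in> test_functions_on K" for \<phi>
        using c(2)[OF that] jet_bound_Cn_norm[OF that] by simp
    qed auto
    then show "continuous_map (test_functions_on_topology K) euclideanreal p"
      by (simp add: continuous_seminorm_def test_functions_on_topology_def)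
  }
qed

end

section \<open>Distributions and bounded sets of test functions\<close>

text \<open>
  The continuity of a seminorm on each of the spaces \<open>test_functions_on K\<close>, in terms of jets.
\<close>

definition locally_Cn_dominated ::
    "(real^'n::finite) set \<Rightarrow> ((real^'n \<Rightarrow> complex) \<Rightarrow> real) \<Rightarrow> bool" where
  "locally_Cn_dominated X p \<longleftrightarrow> (\<forall>K. compact K \<and> K \<subseteq> X \<longrightarrow>
     (\<exists>n c. 0 \<le> c \<and> (\<forall>\<phi>\<in>test_functions_on K. \<forall>M. (\<forall>x. jet_bound n \<phi> x M) \<longrightarrow> p \<phi> \<le> c * M)))"

text \<open>
  The continuous seminorms of the inductive limit topology.
\<close>

definition test_seminorms :: "(real^'n::finite) set \<Rightarrow> ((real^'n \<Rightarrow> complex) \<Rightarrow> real) set" where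
  "test_seminorms X = {p. seminorm_on (test_functions X) p \<and> locally_Cn_dominated X p}"

lemma seminorm_on_subset: "seminorm_on V p \<Longrightarrow> W \<subseteq> V \<Longrightarrow> seminorm_on W p"
  by (simp add: seminorm_on_def subset_iff)

lemma test_functions_topology_eq:
  "test_functions_topology X = seminorm_topology (test_functions X) (test_seminorms X)"
proof -
  have "(\<forall>K. compact K \<and> K \<subseteq> X \<longrightarrow> continuous_map (test_functions_on_topology K) euclideanreal p)
      \<longleftrightarrow> locally_Cn_dominated X p" if p: "seminorm_on (test_functions X) p" for p
    unfolding locally_Cn_dominated_def
    using continuous_seminorm_test_functions_on_iff seminorm_on_subset[OF p test_functions_on_subset]
    by (metis (no_types, lifting))
  then have "{p. seminorm_on (test_functions X) p \<and> (\<forall>K. compact K \<and> K \<subseteq> X \<longrightarrow>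
      continuous_map (test_functions_on_topology K) euclideanreal p)} = test_seminorms X"
    unfolding test_seminorms_def by blast
  then show ?thesis unfolding test_functions_topology_def by simp
qed

lemma test_seminorms_nonempty: "test_seminorms X \<noteq> {}"
proof -
  have "(\<lambda>_. 0) \<in> test_seminorms X"
    by (auto simp: test_seminorms_def seminorm_on_def locally_Cn_dominated_def intro!: exI[of _ "0::real"])
  then show ?thesis by blast
qed

lemma test_seminorms_seminorm: "p \<in> test_seminorms X \<Longrightarrow> seminorm_on (test_functions X) p"
  by (simp add: test_seminorms_def)

lemma locally_Cn_dominated_sum:
  fixes X :: "(real^'n::finite) set"
  assumes "finite F" "\<And>p. p \<in> F \<Longrightarrow> locally_Cn_dominated X p"
  shows "locally_Cn_dominated X (\<lambda>\<phi>. \<Sum>p\<in>F. p \<phi>)"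
  unfolding locally_Cn_dominated_def
proof (intro allI impI)
  fix K assume K: "compact K \<and> K \<subseteq> X"
  have "\<forall>p\<in>F. \<exists>n c. 0 \<le> c \<and> (\<forall>\<phi>\<in>test_functions_on K. \<forall>M. (\<forall>x. jet_bound n \<phi> x M) \<longrightarrow> p \<phi> \<le> c * M)"
    using assms(2) K unfolding locally_Cn_dominated_def by blast
  then obtain n c where nc: "\<And>p. p \<in> F \<Longrightarrow> 0 \<le> c p"
    "\<And>p \<phi> M. p \<in> F \<Longrightarrow> \<phi> \<in> test_functions_on K \<Longrightarrow> \<forall>x. jet_bound (n p) \<phi> x M \<Longrightarrow> p \<phi> \<le> c p * M"
    by metis
  let ?n = "\<Sum>p\<in>F. n p" and ?c = "\<Sum>p\<in>F. c p"
  have "(\<Sum>p\<in>F. p \<phi>) \<le> ?c * M"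
    if \<phi>: "\<phi> \<in> test_functions_on K" and M: "\<forall>x. jet_bound ?n \<phi> x M" for \<phi> M
  proof -
    have "p \<phi> \<le> c p * M" if "p \<in> F" for p
    proof (rule nc(2)[OF that \<phi>])
      have "n p \<le> ?n" using member_le_sum[of p F n] assms(1) that by simp
      then show "\<forall>x. jet_bound (n p) \<phi> x M" using M jet_bound_mono by blast
    qed
    then show ?thesis by (simp add: sum_distrib_right sum_mono)
  qed
  moreover have "0 \<le> ?c" using nc(1) by (rule sum_nonneg)
  ultimately show "\<exists>n c. 0 \<le> c \<and> (\<forall>\<phi>\<in>test_functions_on K. \<forall>M. (\<forall>x. jet_bound n \<phi> x M) \<longrightarrow> (\<Sum>p\<in>F. p \<phi>) \<le> c * M)"
    by blast
qed

lemma locally_Cn_dominated_scale: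
  fixes X :: "(real^'n::finite) set"
  assumes p: "locally_Cn_dominated X p" and a: "0 \<le> a"
    and q: "\<And>\<phi>. \<phi> \<in> test_functions X \<Longrightarrow> q \<phi> \<le> a * p \<phi>"
  shows "locally_Cn_dominated X q"
  unfolding locally_Cn_dominated_def
proof (intro allI impI)
  fix K assume K: "compact K \<and> K \<subseteq> X"
  then obtain n c where nc: "0 \<le> c"
    "\<And>\<phi> M. \<phi> \<in> test_functions_on K \<Longrightarrow> \<forall>x. jet_bound n \<phi> x M \<Longrightarrow> p \<phi> \<le> c * M"
    using p unfolding locally_Cn_dominated_def by metis
  have "q \<phi> \<le> (a * c) * M" if "\<phi> \<in> test_functions_on K" "\<forall>x. jet_bound n \<phi> x M" for \<phi> M
  proof -
    have "\<phi> \<in> test_functions X" using test_functions_on_subset K that(1) by blast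
    from q[OF this] show ?thesis using mult_left_mono[OF nc(2)[OF that] a] by (simp add: mult.assoc)
  qed
  then show "\<exists>n c. 0 \<le> c \<and> (\<forall>\<phi>\<in>test_functions_on K. \<forall>M. (\<forall>x. jet_bound n \<phi> x M) \<longrightarrow> q \<phi> \<le> c * M)"
    using nc(1) a by (intro exI[of _ n] exI[of _ "a * c"]) auto
qed

lemma cSUP_mult_left:
  fixes f :: "'i \<Rightarrow> real"
  assumes "I \<noteq> {}" "bdd_above (f ` I)" "0 \<le> c"
  shows "(SUP i\<in>I. c * f i) = c * (SUP i\<in>I. f i)"
proof (cases "c = 0")
  case False
  have bdd: "bdd_above ((\<lambda>i. c * f i) ` I)"
    using assms(2,3) unfolding bdd_above_def by (auto intro: mult_left_mono)
  show ?thesis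
  proof (rule antisym)
    show "(SUP i\<in>I. c * f i) \<le> c * (SUP i\<in>I. f i)"
      by (rule cSUP_least[OF assms(1)]) (intro mult_left_mono cSUP_upper assms)
    have "(SUP i\<in>I. f i) \<le> (SUP i\<in>I. c * f i) / c"
    proof (rule cSUP_least[OF assms(1)])
      fix i assume "i \<in> I"
      then have "c * f i \<le> (SUP i\<in>I. c * f i)" by (rule cSUP_upper[OF _ bdd])
      then show "f i \<le> (SUP i\<in>I. c * f i) / c" using False assms(3) by (simp add: field_simps)
    qed
    then show "c * (SUP i\<in>I. f i) \<le> (SUP i\<in>I. c * f i)" using False assms(3) by (simp add: field_simps)
  qed
qed (use assms in simp)

text \<open>
  The modulus of a continuous linear functional is a continuous seminorm, and conversely the functional
  is continuous if its modulus is one of the generating seminorms.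
\<close>

lemma distributions_iff:
  "u \<in> distributions X \<longleftrightarrow>
     (\<forall>\<phi>\<in>test_functions X. \<forall>\<theta>\<in>test_functions X. u (\<lambda>x. \<phi> x + \<theta> x) = u \<phi> + u \<theta>) \<and>
     (\<forall>c. \<forall>\<phi>\<in>test_functions X. u (\<lambda>x. c * \<phi> x) = c * u \<phi>) \<and>
     locally_Cn_dominated X (\<lambda>\<phi>. cmod (u \<phi>)) \<and>
     (\<forall>\<phi>. \<phi> \<notin> test_functions X \<longrightarrow> u \<phi> = 0)"
proof -
  note V = function_space_test_functions[of X]
  let ?T = "seminorm_topology (test_functions X) (test_seminorms X)"
  have "continuous_map ?T euclidean u \<longleftrightarrow> locally_Cn_dominated X (\<lambda>\<phi>. cmod (u \<phi>))"
    if lin: "\<forall>\<phi>\<in>test_functions X. \<forall>\<theta>\<in>test_functions X. u (\<lambda>x. \<phi> x + \<theta> x) = u \<phi> + u \<theta>"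
      "\<forall>c. \<forall>\<phi>\<in>test_functions X. u (\<lambda>x. c * \<phi> x) = c * u \<phi>"
  proof -
    let ?q = "\<lambda>\<phi>. cmod (u \<phi>)"
    have q: "seminorm_on (test_functions X) ?q"
      using lin by (simp add: seminorm_on_def norm_mult norm_triangle_ineq)
    show ?thesis
    proof
      assume "continuous_map ?T euclidean u"
      then have "continuous_seminorm (test_functions X) ?T ?q"
        using q by (auto simp: continuous_seminorm_def intro: continuous_map_norm)
      from continuous_seminorm_dominated[OF V test_seminorms_seminorm this test_seminorms_nonempty]
      obtain F c where F: "finite F" "F \<subseteq> test_seminorms X" "0 \<le> c"
        "\<And>\<phi>. \<phi> \<in> test_functions X \<Longrightarrow> cmod (u \<phi>) \<le> c * (\<Sum>p\<in>F. p \<phi>)" by auto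
      have "locally_Cn_dominated X (\<lambda>\<phi>. \<Sum>p\<in>F. p \<phi>)"
        by (rule locally_Cn_dominated_sum[OF F(1)]) (use F(2) in \<open>auto simp: test_seminorms_def\<close>)
      from locally_Cn_dominated_scale[OF this F(3,4)]
      show "locally_Cn_dominated X ?q" .
    next
      assume "locally_Cn_dominated X ?q"
      then have qP: "?q \<in> test_seminorms X" using q by (simp add: test_seminorms_def)
      show "continuous_map ?T euclidean u"
      proof (rule continuous_map_seminorm_topology[OF V test_seminorms_seminorm, where F="{?q}" and c=1])
        fix \<phi> \<theta> assume pt: "\<phi> \<in> test_functions X" "\<theta> \<in> test_functions X"
        have "u (\<lambda>x. \<phi> x + (- 1) * \<theta> x) = u \<phi> + (- 1) * u \<theta>"
          using lin(1)[rule_format, OF pt(1) function_space_scale[OF V pt(2)], of "- 1"] lin(2)[rule_format, OF pt(2), of "- 1"]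
          by simp
        then show "dist (u \<phi>) (u \<theta>) \<le> 1 * (\<Sum>p\<in>{?q}. p (\<lambda>x. \<phi> x - \<theta> x))"
          by (simp add: dist_norm)
      qed (use qP in auto)
    qed
  qed
  then show ?thesis unfolding distributions_def test_functions_topology_eq by blast
qed

lemma distribution_add:
  "u \<in> distributions X \<Longrightarrow> \<phi> \<in> test_functions X \<Longrightarrow> \<theta> \<in> test_functions X \<Longrightarrow>
    u (\<lambda>x. \<phi> x + \<theta> x) = u \<phi> + u \<theta>"
  by (simp add: distributions_def)

lemma distribution_scale:
  "u \<in> distributions X \<Longrightarrow> \<phi> \<in> test_functions X \<Longrightarrow> u (\<lambda>x. c * \<phi> x) = c * u \<phi>"
  by (simp add: distributions_def)

lemma distribution_diff:
  assumes "u \<in> distributions X" "\<phi> \<in> test_functions X" "\<theta> \<in> test_functions X"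
  shows "u (\<lambda>x. \<phi> x - \<theta> x) = u \<phi> - u \<theta>"
  using distribution_add[OF assms(1,2) function_space_minus[OF function_space_test_functions assms(3)]]
    distribution_scale[OF assms(1,3), of "- 1"] by simp

lemma distribution_sum:
  assumes u: "u \<in> distributions X" and f: "\<And>j. j \<in> J \<Longrightarrow> f j \<in> test_functions X" and "finite J"
  shows "(\<lambda>x. \<Sum>j\<in>J. c j * f j x) \<in> test_functions X \<and> u (\<lambda>x. \<Sum>j\<in>J. c j * f j x) = (\<Sum>j\<in>J. c j * u (f j))"
  using \<open>finite J\<close> f
proof (induction J)
  case empty
  show ?case using function_space_zero[OF function_space_test_functions[of X]] distribution_scale[OF u, of "\<lambda>_. 0" 0] by simp
next
  case (insert j J)
  then have 1: "(\<lambda>x. c j * f j x) \<in> test_functions X"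
    by (intro function_space_scale[OF function_space_test_functions]) simp
  have 2: "(\<lambda>x. \<Sum>j\<in>J. c j * f j x) \<in> test_functions X" using insert by simp
  show ?case
    using function_space_add[OF function_space_test_functions 1 2] distribution_add[OF u 1 2] insert
      distribution_scale[OF u, of "f j" "c j"] by simp
qed

lemma distribution_dominated:
  assumes "u \<in> distributions X" "compact K" "K \<subseteq> X"
  shows "\<exists>n c. 0 \<le> c \<and> (\<forall>\<phi>\<in>test_functions_on K. \<forall>M. (\<forall>x. jet_bound n \<phi> x M) \<longrightarrow> cmod (u \<phi>) \<le> c * M)"
  using assms unfolding distributions_iff locally_Cn_dominated_def by simp

lemma function_space_distributions: "function_space (distributions X)"
proof -
  have 1: "locally_Cn_dominated X (\<lambda>\<phi>. cmod (u \<phi> + v \<phi>))"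
    if "locally_Cn_dominated X (\<lambda>\<phi>. cmod (u \<phi>))" "locally_Cn_dominated X (\<lambda>\<phi>. cmod (v \<phi>))" for u v
  proof -
    let ?F = "{\<lambda>\<phi>. cmod (u \<phi>), \<lambda>\<phi>. cmod (v \<phi>)}"
    have dom: "locally_Cn_dominated X (\<lambda>\<phi>. \<Sum>p\<in>?F. p \<phi>)"
      by (rule locally_Cn_dominated_sum) (use that in auto)
    have le: "cmod (u \<phi> + v \<phi>) \<le> 2 * (\<Sum>p\<in>?F. p \<phi>)" for \<phi>
    proof -
      have "cmod (u \<phi>) \<le> (\<Sum>p\<in>?F. p \<phi>)" "cmod (v \<phi>) \<le> (\<Sum>p\<in>?F. p \<phi>)"
        using member_le_sum[of "\<lambda>\<phi>. cmod (u \<phi>)" ?F "\<lambda>p. p \<phi>"]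
          member_le_sum[of "\<lambda>\<phi>. cmod (v \<phi>)" ?F "\<lambda>p. p \<phi>"] by force+
      then show ?thesis using norm_triangle_ineq[of "u \<phi>" "v \<phi>"] by linarith
    qed
    show ?thesis by (rule locally_Cn_dominated_scale[OF dom _ le]) simp
  qed
  have 2: "locally_Cn_dominated X (\<lambda>\<phi>. cmod (c * u \<phi>))"
    if "locally_Cn_dominated X (\<lambda>\<phi>. cmod (u \<phi>))" for c u
    by (rule locally_Cn_dominated_scale[OF that, of "cmod c"]) (simp_all add: norm_mult)
  have 0: "locally_Cn_dominated X (\<lambda>\<phi>. 0)"
    using locally_Cn_dominated_sum[of "{}" X] by simp
  have dom: "locally_Cn_dominated X (\<lambda>\<phi>. cmod (u \<phi>))"
    and out: "\<And>\<phi>. \<phi> \<notin> test_functions X \<Longrightarrow> u \<phi> = 0" if "u \<in> distributions X" for u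
    using that by (simp_all add: distributions_iff)
  show ?thesis
    unfolding function_space_def
  proof (intro conjI ballI allI)
    show "(\<lambda>_. 0) \<in> distributions X" by (subst distributions_iff) (simp add: 0)
  next
    fix u v assume uv: "u \<in> distributions X" "v \<in> distributions X"
    show "(\<lambda>\<phi>. u \<phi> + v \<phi>) \<in> distributions X"
      by (subst distributions_iff)
         (simp add: distribution_add[OF uv(1)] distribution_add[OF uv(2)] distribution_scale[OF uv(1)]
           distribution_scale[OF uv(2)] out uv dom 1 algebra_simps)
  next
    fix c u assume u: "u \<in> distributions X"
    show "(\<lambda>\<phi>. c * u \<phi>) \<in> distributions X"
      by (subst distributions_iff)
         (simp add: distribution_add[OF u] distribution_scale[OF u] out u dom 2 algebra_simps)
  qed
qed

text \<open>
  A gliding hump. If the supports leave every compact set \<open>C j\<close> of an exhaustion, pick members \<open>f j\<close> and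
  points \<open>a j\<close> outside \<open>C j\<close> with \<open>f j (a j) \<noteq> 0\<close>. On functions supported in a fixed compact set
  only finitely many of these points matter, so \<open>\<phi> \<mapsto> sup\<^sub>j j |\<phi>(a j)| / |f j (a j)|\<close> is a continuous
  seminorm; but it is at least \<open>j\<close> at \<open>f j\<close>.
\<close>

lemma bounded_test_functions_support:
  fixes X :: "(real^'n::finite) set"
  assumes X: "open X" and BX: "B \<subseteq> test_functions X"
    and B: "\<And>p. p \<in> test_seminorms X \<Longrightarrow> \<exists>M. \<forall>\<phi>\<in>B. p \<phi> \<le> M"
  shows "\<exists>K. compact K \<and> K \<subseteq> X \<and> B \<subseteq> test_functions_on K"
proof (rule ccontr)
  assume neg: "\<not> ?thesis"
  obtain C where C: "\<And>n. compact (C n)" "\<And>n. C n \<subseteq> X"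
    and "\<And>n. C n \<subseteq> interior (C (Suc n))" "\<Union> (range C) = X"
    and ex: "\<And>K. compact K \<Longrightarrow> K \<subseteq> X \<Longrightarrow> \<exists>N. \<forall>n\<ge>N. K \<subseteq> C n"
    by (rule open_Union_compact_subsets[OF X]) (rule that; assumption)
  have "\<exists>\<phi> x. \<phi> \<in> B \<and> x \<notin> C j \<and> \<phi> x \<noteq> 0" for j
  proof -
    obtain \<phi> where "\<phi> \<in> B" "\<phi> \<notin> test_functions_on (C j)" using neg C by blast
    moreover have "smooth_on UNIV \<phi>" using calculation(1) BX test_functions_smooth by blast
    ultimately show ?thesis
      by (auto simp: test_functions_on_iff[OF compact_imp_closed[OF C(1)]])
  qed
  then obtain f a where f: "\<And>j. f j \<in> B" "\<And>j. a j \<notin> C j" "\<And>j. f j (a j) \<noteq> 0" by metis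
  define t where "t = (\<lambda>j (\<phi>::real^'n \<Rightarrow> complex). real j / cmod (f j (a j)) * cmod (\<phi> (a j)))"
  define p where "p = (\<lambda>\<phi>. SUP j. t j \<phi>)"
  have tnn: "0 \<le> t j \<phi>" for j \<phi> by (simp add: t_def)
  have fin: "\<exists>N. \<forall>j\<ge>N. \<forall>\<phi>\<in>test_functions_on K. t j \<phi> = 0" if K: "compact K" "K \<subseteq> X" for K
  proof -
    obtain N where N: "\<forall>n\<ge>N. K \<subseteq> C n" using ex[OF K] by blast
    have "t j \<phi> = 0" if "N \<le> j" "\<phi> \<in> test_functions_on K" for j \<phi>
    proof -
      have "a j \<notin> K" using N that(1) f(2) by blast
      then show ?thesis using that(2) by (simp add: t_def test_functions_on_iff[OF compact_imp_closed[OF K(1)]])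
    qed
    then show ?thesis by blast
  qed
  have bdd: "bdd_above (range (\<lambda>j. t j \<phi>))" if "\<phi> \<in> test_functions X" for \<phi>
  proof -
    obtain K where K: "compact K" "K \<subseteq> X" "\<phi> \<in> test_functions_on K" using \<open>\<phi> \<in> test_functions X\<close> test_functions_iff by blast
    obtain N where N: "\<forall>j\<ge>N. t j \<phi> = 0" using fin[OF K(1,2)] K(3) by blast
    have "t j \<phi> \<le> (\<Sum>j<N. t j \<phi>)" for j
      using N tnn member_le_sum[of j "{..<N}" "\<lambda>j. t j \<phi>"] by (cases "j < N") (auto simp: sum_nonneg)
    then show ?thesis by (auto simp: bdd_above_def)
  qed
  have "p \<in> test_seminorms X"
    unfolding test_seminorms_def seminorm_on_def locally_Cn_dominated_def
  proof (intro CollectI conjI ballI allI impI)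
    fix \<phi> \<theta> assume pt: "\<phi> \<in> test_functions X" "\<theta> \<in> test_functions X"
    have "t j (\<lambda>x. \<phi> x + \<theta> x) \<le> p \<phi> + p \<theta>" for j
    proof -
      have "t j (\<lambda>x. \<phi> x + \<theta> x) \<le> t j \<phi> + t j \<theta>"
        unfolding t_def distrib_left[symmetric] by (intro mult_left_mono norm_triangle_ineq) simp
      moreover have "t j \<phi> \<le> p \<phi>" "t j \<theta> \<le> p \<theta>"
        using cSUP_upper[OF _ bdd] pt by (auto simp: p_def)
      ultimately show ?thesis by linarith
    qed
    then have "(SUP j. t j (\<lambda>x. \<phi> x + \<theta> x)) \<le> p \<phi> + p \<theta>" by (intro cSUP_least) simp_all
    then show "p (\<lambda>x. \<phi> x + \<theta> x) \<le> p \<phi> + p \<theta>" unfolding p_def .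
  next
    fix c \<phi> assume \<phi>: "\<phi> \<in> test_functions X"
    have eq: "t j (\<lambda>x. c * \<phi> x) = cmod c * t j \<phi>" for j by (simp add: t_def norm_mult)
    show "p (\<lambda>x. c * \<phi> x) = cmod c * p \<phi>"
      unfolding p_def eq by (rule cSUP_mult_left) (use bdd[OF \<phi>] in auto)
  next
    fix K assume K: "compact K \<and> K \<subseteq> X"
    then obtain N where "\<forall>j\<ge>N. \<forall>\<phi>\<in>test_functions_on K. t j \<phi> = 0" using fin[of K] by auto
    then have N: "t j \<phi> = 0" if "N \<le> j" "\<phi> \<in> test_functions_on K" for j \<phi> using that by simp
    let ?c = "\<Sum>j<N. real j / cmod (f j (a j))"
    have c0: "0 \<le> ?c" by (intro sum_nonneg) simp
    have "p \<phi> \<le> ?c * M" if \<phi>: "\<phi> \<in> test_functions_on K" and M: "\<forall>x. jet_bound 0 \<phi> x M" for \<phi> M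
      unfolding p_def
    proof (rule cSUP_least)
      fix j
      have M0: "0 \<le> M" using M jet_bound_nonneg by blast
      show "t j \<phi> \<le> ?c * M"
      proof (cases "j < N")
        case True
        have "t j \<phi> \<le> real j / cmod (f j (a j)) * M"
          using M by (simp add: t_def jet_bound_0 mult_left_mono divide_right_mono)
        also have "\<dots> \<le> ?c * M"
          using member_le_sum[of j "{..<N}" "\<lambda>j. real j / cmod (f j (a j))"] True M0 by (intro mult_right_mono) auto
        finally show ?thesis .
      qed (use N[OF _ \<phi>] c0 M0 in auto)
    qed simp
    then show "\<exists>n c. 0 \<le> c \<and> (\<forall>\<phi>\<in>test_functions_on K. \<forall>M. (\<forall>x. jet_bound n \<phi> x M) \<longrightarrow> p \<phi> \<le> c * M)"
      using c0 by blast
  qed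
  from B[OF this] obtain M where M: "\<And>\<phi>. \<phi> \<in> B \<Longrightarrow> p \<phi> \<le> M" by blast
  obtain j where j: "M < real j" using reals_Archimedean2 by blast
  have "real j = t j (f j)" using f(3) by (simp add: t_def)
  also have "\<dots> \<le> p (f j)" unfolding p_def using cSUP_upper[OF _ bdd] f(1) BX by auto
  finally show False using M[OF f(1)[of j]] j by simp
qed

lemma sup_jet_test_seminorm:
  fixes X :: "(real^'n::finite) set"
  shows "(\<lambda>\<phi>. SUP x. cmod (iterated_partial is \<phi> x)) \<in> test_seminorms X"
    and "\<phi> \<in> test_functions X \<Longrightarrow> cmod (iterated_partial is \<phi> x) \<le> (SUP x. cmod (iterated_partial is \<phi> x))"
proof -
  let ?p = "\<lambda>\<phi>. SUP x. cmod (iterated_partial is \<phi> x)"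
  have bdd: "bdd_above (range (\<lambda>x. cmod (iterated_partial is \<phi> x)))" if \<phi>: "\<phi> \<in> test_functions X" for \<phi>
  proof -
    obtain K where K: "compact K" "\<phi> \<in> test_functions_on K" using \<phi> test_functions_iff by blast
    then obtain M where "\<forall>x. jet_bound (length is) \<phi> x M" using test_function_jet_bound by blast
    then show ?thesis by (auto simp: bdd_above_def jet_bound_def)
  qed
  show up: "cmod (iterated_partial is \<phi> x) \<le> ?p \<phi>" if "\<phi> \<in> test_functions X" for \<phi> x
    using cSUP_upper[OF _ bdd[OF that]] by simp
  have sm: "smooth_upto (length is) UNIV \<phi>" if "\<phi> \<in> test_functions X" for \<phi>
    using test_functions_smooth[OF that] smooth_on_iff_upto by blast
  show "?p \<in> test_seminorms X"
    unfolding test_seminorms_def seminorm_on_def locally_Cn_dominated_def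
  proof (intro CollectI conjI ballI allI impI)
    fix \<phi> \<theta> assume pt: "\<phi> \<in> test_functions X" "\<theta> \<in> test_functions X"
    have eq: "iterated_partial is (\<lambda>x. \<phi> x + \<theta> x) x = iterated_partial is \<phi> x + iterated_partial is \<theta> x" for x
      by (rule iterated_partial_add[OF open_UNIV sm[OF pt(1)] sm[OF pt(2)]]) auto
    show "?p (\<lambda>x. \<phi> x + \<theta> x) \<le> ?p \<phi> + ?p \<theta>"
      unfolding eq by (intro cSUP_least norm_triangle_le add_mono up pt) simp
  next
    fix c \<phi> assume \<phi>: "\<phi> \<in> test_functions X"
    have eq: "iterated_partial is (\<lambda>x. c * \<phi> x) x = c * iterated_partial is \<phi> x" for x
      by (rule bounded_linear.iterated_partial_linear[OF bounded_linear_mult_right open_UNIV test_functions_smooth[OF \<phi>]]) simp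
    show "?p (\<lambda>x. c * \<phi> x) = cmod c * ?p \<phi>"
      unfolding eq norm_mult by (rule cSUP_mult_left) (use bdd[OF \<phi>] in auto)
  next
    fix K assume K: "compact K \<and> K \<subseteq> X"
    have "?p \<phi> \<le> 1 * M" if "\<forall>x. jet_bound (length is) \<phi> x M" for \<phi> M
      using that by (intro cSUP_least) (auto simp: jet_bound_def)
    then show "\<exists>n c. 0 \<le> c \<and> (\<forall>\<phi>\<in>test_functions_on K. \<forall>M. (\<forall>x. jet_bound n \<phi> x M) \<longrightarrow> ?p \<phi> \<le> c * M)"
      by (intro exI[of _ "length is"] exI[of _ 1] conjI ballI allI impI) simp_all
  qed
qed

lemma bounded_subset_test_functions_iff:
  "bounded_subset (test_functions X) (test_functions_topology X) B \<longleftrightarrow>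
     B \<subseteq> test_functions X \<and> (\<forall>p\<in>test_seminorms X. \<exists>M. \<forall>\<phi>\<in>B. p \<phi> \<le> M)"
  unfolding test_functions_topology_eq
  by (rule bounded_subset_seminorm_topology[OF function_space_test_functions test_seminorms_seminorm test_seminorms_nonempty])

lemma bounded_test_functions_iff:
  fixes X :: "(real^'n::finite) set"
  assumes X: "open X"
  shows "bounded_subset (test_functions X) (test_functions_topology X) B \<longleftrightarrow>
    (\<exists>K. compact K \<and> K \<subseteq> X \<and> B \<subseteq> test_functions_on K \<and> (\<forall>n. \<exists>M. \<forall>\<phi>\<in>B. \<forall>x. jet_bound n \<phi> x M))"
    (is "_ \<longleftrightarrow> (\<exists>K. ?R K)")
proof -
  have "bounded_subset (test_functions X) (test_functions_topology X) B \<longleftrightarrow>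
      B \<subseteq> test_functions X \<and> (\<forall>p\<in>test_seminorms X. \<exists>M. \<forall>\<phi>\<in>B. p \<phi> \<le> M)" (is "_ \<longleftrightarrow> ?L")
    by (rule bounded_subset_test_functions_iff)
  also have "\<dots> \<longleftrightarrow> (\<exists>K. ?R K)"
  proof
    assume L: ?L
    then obtain K where K: "compact K" "K \<subseteq> X" "B \<subseteq> test_functions_on K"
      using bounded_test_functions_support[OF X, of B] by blast
    have "\<exists>M. \<forall>\<phi>\<in>B. \<forall>x. cmod (iterated_partial is \<phi> x) \<le> M" for "is" :: "'n list"
    proof -
      obtain M where M: "\<And>\<phi>. \<phi> \<in> B \<Longrightarrow> (SUP x. cmod (iterated_partial is \<phi> x)) \<le> M"
        using L[THEN conjunct2, THEN bspec, OF sup_jet_test_seminorm(1)[of "is" X]] by blast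
      have "cmod (iterated_partial is \<phi> x) \<le> M" if "\<phi> \<in> B" for \<phi> x
        by (rule order_trans[OF sup_jet_test_seminorm(2) M[OF that]]) (use L that in blast)
      then show ?thesis by blast
    qed
    then obtain m where m: "\<And>is \<phi> x. \<phi> \<in> B \<Longrightarrow> cmod (iterated_partial is \<phi> x) \<le> m is" by metis
    have "\<exists>M. \<forall>\<phi>\<in>B. \<forall>x. jet_bound n \<phi> x M" for n
    proof -
      let ?M = "\<Sum>is\<in>{is :: 'n list. length is \<le> n}. \<bar>m is\<bar>"
      have "m is \<le> ?M" if "length is \<le> n" for "is" :: "'n list"
        using member_le_sum[of "is" "{is. length is \<le> n}" "\<lambda>is. \<bar>m is\<bar>"] finite_lists_le that by fastforce
      then have "jet_bound n \<phi> x ?M" if "\<phi> \<in> B" for \<phi> x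
        unfolding jet_bound_def using m[OF that] order_trans by blast
      then show ?thesis by blast
    qed
    then show "\<exists>K. ?R K" using K by blast
  next
    assume "\<exists>K. ?R K"
    then obtain K where K: "compact K" "K \<subseteq> X" "B \<subseteq> test_functions_on K"
      and M: "\<And>n. \<exists>M. \<forall>\<phi>\<in>B. \<forall>x. jet_bound n \<phi> x M" by blast
    have "\<exists>M. \<forall>\<phi>\<in>B. p \<phi> \<le> M" if p: "p \<in> test_seminorms X" for p
    proof -
      have "\<exists>n c. 0 \<le> c \<and> (\<forall>\<phi>\<in>test_functions_on K. \<forall>M. (\<forall>x. jet_bound n \<phi> x M) \<longrightarrow> p \<phi> \<le> c * M)"
        using p K(1,2) unfolding test_seminorms_def locally_Cn_dominated_def by simp
      then obtain n c where nc: "\<forall>\<phi>\<in>test_functions_on K. \<forall>M. (\<forall>x. jet_bound n \<phi> x M) \<longrightarrow> p \<phi> \<le> c * M"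
        by (elim exE conjE)
      obtain M where M: "\<forall>\<phi>\<in>B. \<forall>x. jet_bound n \<phi> x M" using M[of n] by (elim exE)
      have "p \<phi> \<le> c * M" if "\<phi> \<in> B" for \<phi>
        using nc[rule_format, of \<phi> M] M that K(3) by auto
      then show ?thesis by (intro exI[of _ "c * M"] ballI)
    qed
    then show ?L using K test_functions_on_subset[OF K(1,2)] by (intro conjI ballI) auto
  qed
  finally show ?thesis .
qed

section \<open>The strong dual\<close>

definition sup_seminorm :: "('a \<Rightarrow> complex) set \<Rightarrow> (('a \<Rightarrow> complex) \<Rightarrow> complex) \<Rightarrow> real" where
  "sup_seminorm B u = (SUP \<phi>\<in>B. cmod (u \<phi>))"

abbreviation "bounded_tests X B \<equiv>
  B \<noteq> {} \<and> bounded_subset (test_functions X) (test_functions_topology X) B"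

lemma strong_dual_topology_eq:
  "strong_dual_topology X = seminorm_topology (distributions X) {sup_seminorm B | B. bounded_tests X B}"
  unfolding strong_dual_topology_def sup_seminorm_def[abs_def] by simp

context
  fixes X :: "(real^'n::finite) set"
  assumes X: "open X"
begin

lemma bounded_tests_subset: "bounded_tests X B \<Longrightarrow> B \<subseteq> test_functions X"
  by (simp add: bounded_subset_def)

lemma bounded_tests_dist_bounded:
  assumes B: "bounded_tests X B" and u: "u \<in> distributions X"
  shows "bdd_above ((\<lambda>\<phi>. cmod (u \<phi>)) ` B)"
proof -
  obtain K where K: "compact K" "K \<subseteq> X" "B \<subseteq> test_functions_on K"
    and M: "\<forall>n. \<exists>M. \<forall>\<phi>\<in>B. \<forall>x. jet_bound n \<phi> x M"
    using B bounded_test_functions_iff[OF X, of B] by (elim exE conjE) auto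
  obtain n c where nc: "\<forall>\<phi>\<in>test_functions_on K. \<forall>M. (\<forall>x. jet_bound n \<phi> x M) \<longrightarrow> cmod (u \<phi>) \<le> c * M"
    using distribution_dominated[OF u K(1,2)] by (elim exE conjE)
  obtain M where M: "\<forall>\<phi>\<in>B. \<forall>x. jet_bound n \<phi> x M" using M[rule_format, of n] by (elim exE)
  have "cmod (u \<phi>) \<le> c * M" if "\<phi> \<in> B" for \<phi>
    by (rule nc[rule_format]) (use M K(3) that in auto)
  then show ?thesis by (auto simp: bdd_above_def)
qed

lemma sup_seminorm_upper:
  "bounded_tests X B \<Longrightarrow> u \<in> distributions X \<Longrightarrow> \<phi> \<in> B \<Longrightarrow> cmod (u \<phi>) \<le> sup_seminorm B u"
  unfolding sup_seminorm_def by (rule cSUP_upper[OF _ bounded_tests_dist_bounded])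

lemma sup_seminorm_least:
  "bounded_tests X B \<Longrightarrow> (\<And>\<phi>. \<phi> \<in> B \<Longrightarrow> cmod (u \<phi>) \<le> s) \<Longrightarrow> sup_seminorm B u \<le> s"
  unfolding sup_seminorm_def by (rule cSUP_least) auto

lemma seminorm_sup_seminorm:
  assumes B: "bounded_tests X B"
  shows "seminorm_on (distributions X) (sup_seminorm B)"
  unfolding seminorm_on_def
proof (intro conjI ballI allI)
  fix u v assume uv: "u \<in> distributions X" "v \<in> distributions X"
  show "sup_seminorm B (\<lambda>\<phi>. u \<phi> + v \<phi>) \<le> sup_seminorm B u + sup_seminorm B v"
    by (rule sup_seminorm_least[OF B]) (intro norm_triangle_le add_mono sup_seminorm_upper[OF B] uv)
next
  fix c u assume u: "u \<in> distributions X"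
  show "sup_seminorm B (\<lambda>\<phi>. c * u \<phi>) = cmod c * sup_seminorm B u"
    unfolding sup_seminorm_def norm_mult
    by (rule cSUP_mult_left) (use B bounded_tests_dist_bounded[OF B u] in auto)
qed

lemma bounded_tests_Union:
  assumes "finite \<F>" "\<F> \<noteq> {}" "\<And>B. B \<in> \<F> \<Longrightarrow> bounded_tests X B"
  shows "bounded_tests X (\<Union>\<F>)"
proof -
  have V: "\<Union>\<F> \<subseteq> test_functions X" using assms(3) bounded_tests_subset by blast
  have "\<exists>M. \<forall>\<phi>\<in>\<Union>\<F>. p \<phi> \<le> M" if p: "p \<in> test_seminorms X" for p
  proof -
    have "\<exists>M. \<forall>\<phi>\<in>B. p \<phi> \<le> M" if "B \<in> \<F>" for B
      using assms(3)[OF that] p by (simp add: bounded_subset_test_functions_iff)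
    then have "\<exists>m. \<forall>B\<in>\<F>. \<forall>\<phi>\<in>B. p \<phi> \<le> m B" by (intro bchoice ballI)
    then obtain m where m: "\<forall>B\<in>\<F>. \<forall>\<phi>\<in>B. p \<phi> \<le> m B" by (elim exE)
    have "p \<phi> \<le> Max (m ` \<F>)" if \<phi>: "\<phi> \<in> \<Union>\<F>" for \<phi>
    proof -
      obtain B where B: "B \<in> \<F>" "\<phi> \<in> B" using \<phi> by blast
      have "m B \<le> Max (m ` \<F>)" using B(1) assms(1) by simp
      then show ?thesis using m[rule_format, OF B] by linarith
    qed
    then show ?thesis by (intro exI ballI)
  qed
  then have "bounded_subset (test_functions X) (test_functions_topology X) (\<Union>\<F>)"
    using V by (simp add: bounded_subset_test_functions_iff)
  moreover obtain B where "B \<in> \<F>" using assms(2) by blast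
  ultimately show ?thesis using assms(3)[of B] by blast
qed

lemma bounded_tests_singleton:
  assumes "\<phi> \<in> test_functions X"
  shows "bounded_tests X {\<phi>}"
proof -
  obtain K where K: "compact K" "K \<subseteq> X" "\<phi> \<in> test_functions_on K"
    using assms test_functions_iff by blast
  have "\<exists>M. \<forall>\<theta>\<in>{\<phi>}. \<forall>x. jet_bound n \<theta> x M" for n
    using test_function_jet_bound[OF K(1,3), of n] by auto
  with K have "\<exists>K. compact K \<and> K \<subseteq> X \<and> {\<phi>} \<subseteq> test_functions_on K \<and> (\<forall>n. \<exists>M. \<forall>\<theta>\<in>{\<phi>}. \<forall>x. jet_bound n \<theta> x M)"
    by (intro exI[of _ K]) simp
  then show ?thesis using bounded_test_functions_iff[OF X, of "{\<phi>}"] by simp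
qed

abbreviation "dual_seminorms \<equiv> {sup_seminorm B | B. bounded_tests X B}"

lemma dual_seminorms_seminorm: "p \<in> dual_seminorms \<Longrightarrow> seminorm_on (distributions X) p"
  using seminorm_sup_seminorm by auto

lemma dual_seminorms_nonempty: "dual_seminorms \<noteq> {}"
  using bounded_tests_singleton[OF function_space_zero[OF function_space_test_functions]] by blast

text \<open>
  A finite union of bounded sets is bounded, so that one set suffices. The zero function is added to the
  union to make it nonempty.
\<close>

lemma continuous_seminorm_dual_dominated:
  assumes "continuous_seminorm (distributions X) (strong_dual_topology X) q"
  shows "\<exists>B c. bounded_tests X B \<and> 0 \<le> c \<and> (\<forall>u\<in>distributions X. q u \<le> c * sup_seminorm B u)"
proof -
  obtain F c where F: "finite F" "F \<subseteq> dual_seminorms" "0 \<le> c"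
    and q: "\<And>u. u \<in> distributions X \<Longrightarrow> q u \<le> c * (\<Sum>p\<in>F. p u)"
    using continuous_seminorm_dominated[OF function_space_distributions dual_seminorms_seminorm
        assms[unfolded strong_dual_topology_eq] dual_seminorms_nonempty] by auto
  have "\<forall>p\<in>F. \<exists>B. p = sup_seminorm B \<and> bounded_tests X B" using F(2) by blast
  then obtain b where b: "\<And>p. p \<in> F \<Longrightarrow> p = sup_seminorm (b p)" "\<And>p. p \<in> F \<Longrightarrow> bounded_tests X (b p)"
    by metis
  let ?F = "insert {\<lambda>_. 0} (b ` F)"
  have z: "bounded_tests X {\<lambda>_. 0}"
    by (rule bounded_tests_singleton[OF function_space_zero[OF function_space_test_functions]])
  have B: "bounded_tests X (\<Union>?F)"
    by (rule bounded_tests_Union) (use F(1) b(2) z in auto)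
  have "q u \<le> (c * real (card F)) * sup_seminorm (\<Union>?F) u" if u: "u \<in> distributions X" for u
  proof -
    have "p u \<le> sup_seminorm (\<Union>?F) u" if p: "p \<in> F" for p
    proof -
      have "sup_seminorm (b p) u \<le> sup_seminorm (\<Union>?F) u"
        by (rule sup_seminorm_least[OF b(2)[OF p]]) (rule sup_seminorm_upper[OF B u], use p in blast)
      then show ?thesis using b(1)[OF p] by simp
    qed
    then have "(\<Sum>p\<in>F. p u) \<le> real (card F) * sup_seminorm (\<Union>?F) u"
      by (rule sum_bounded_above)
    then show ?thesis using q[OF u] mult_left_mono[OF _ F(3)] by (simp add: mult.assoc order_trans)
  qed
  then show ?thesis using B F(3) by (intro exI[of _ "\<Union>?F"] exI[of _ "c * real (card F)"]) auto
qed

lemma continuous_seminorm_sup_seminorm: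
  assumes B: "bounded_tests X B" and c: "0 \<le> c"
  shows "continuous_seminorm (distributions X) (strong_dual_topology X) (\<lambda>u. c * sup_seminorm B u)"
  unfolding strong_dual_topology_eq
proof (rule continuous_seminorm_sum[OF function_space_distributions dual_seminorms_seminorm,
      where F="{sup_seminorm B}" and c=c])
  show "seminorm_on (distributions X) (\<lambda>u. c * sup_seminorm B u)"
    using seminorm_sup_seminorm[OF B] c
    by (simp add: seminorm_on_def mult_left_mono flip: distrib_left)
qed (use B c dual_seminorms_nonempty in auto)

lemma continuous_map_evaluation:
  assumes "\<phi> \<in> test_functions X"
  shows "continuous_map (strong_dual_topology X) euclidean (\<lambda>u. u \<phi>)"
  unfolding strong_dual_topology_eq
proof (rule continuous_map_seminorm_topology[OF function_space_distributions dual_seminorms_seminorm,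
      where F="{sup_seminorm {\<phi>}}" and c=1])
  show "{sup_seminorm {\<phi>}} \<subseteq> dual_seminorms" using bounded_tests_singleton[OF assms] by blast
  fix u v assume "u \<in> distributions X" "v \<in> distributions X"
  then show "dist (u \<phi>) (v \<phi>) \<le> 1 * (\<Sum>p\<in>{sup_seminorm {\<phi>}}. p (\<lambda>\<phi>. u \<phi> - v \<phi>))"
    by (simp add: sup_seminorm_def dist_norm)
qed (use dual_seminorms_nonempty in auto)

text \<open>
  The map \<open>u \<mapsto> |C u \<phi> - u \<theta>|\<close> is a continuous seminorm on the strong dual. It vanishes on the dense set
  \<open>R\<close>, hence everywhere. Density is needed with respect to uniform approximation on bounded sets.
\<close>

lemma strong_dual_functional_vanishes:
  assumes C: "continuous_linear_operator (distributions X) (strong_dual_topology X) C"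
    and pt: "\<phi> \<in> test_functions X" "\<theta> \<in> test_functions X"
    and R: "R \<subseteq> distributions X" and eq: "\<And>v. v \<in> R \<Longrightarrow> C v \<phi> = v \<theta>"
    and dense: "\<And>u B e. u \<in> distributions X \<Longrightarrow> bounded_tests X B \<Longrightarrow> 0 < e \<Longrightarrow>
       \<exists>v\<in>R. \<forall>\<phi>\<in>B. cmod (u \<phi> - v \<phi>) \<le> e"
    and u: "u \<in> distributions X"
  shows "C u \<phi> = u \<theta>"
proof -
  let ?q = "\<lambda>u. cmod (C u \<phi> - u \<theta>)"
  have CV: "C u \<in> distributions X" if "u \<in> distributions X" for u
    using C that by (auto simp: continuous_linear_operator_def)
  have Cadd: "C (\<lambda>x. u x + v x) = (\<lambda>x. C u x + C v x)" if "u \<in> distributions X" "v \<in> distributions X" for u v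
    using C that unfolding continuous_linear_operator_def by blast
  have Cscale: "C (\<lambda>x. c * u x) = (\<lambda>x. c * C u x)" if "u \<in> distributions X" for u c
    using C that unfolding continuous_linear_operator_def by blast
  have sq: "seminorm_on (distributions X) ?q"
    unfolding seminorm_on_def
  proof (intro conjI ballI allI)
    fix u v assume "u \<in> distributions X" "v \<in> distributions X"
    then have "C (\<lambda>x. u x + v x) \<phi> - (u \<theta> + v \<theta>) = (C u \<phi> - u \<theta>) + (C v \<phi> - v \<theta>)"
      by (simp add: Cadd)
    then show "?q (\<lambda>x. u x + v x) \<le> ?q u + ?q v" by (metis norm_triangle_ineq)
  next
    fix c u assume "u \<in> distributions X"
    then have "C (\<lambda>x. c * u x) \<phi> - c * u \<theta> = c * (C u \<phi> - u \<theta>)"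
      by (simp add: Cscale algebra_simps)
    then show "?q (\<lambda>x. c * u x) = cmod c * ?q u" by (simp add: norm_mult)
  qed
  have "continuous_map (strong_dual_topology X) (strong_dual_topology X) C"
    using C by (simp add: continuous_linear_operator_def)
  from continuous_map_compose[OF this continuous_map_evaluation[OF pt(1)]]
  have "continuous_map (strong_dual_topology X) euclidean (\<lambda>u. C u \<phi>)" by (simp add: o_def)
  then have "continuous_map (strong_dual_topology X) euclideanreal ?q"
    by (intro continuous_map_norm continuous_map_diff continuous_map_evaluation pt)
  then have "continuous_seminorm (distributions X) (strong_dual_topology X) ?q"
    using sq by (simp add: continuous_seminorm_def)
  from continuous_seminorm_dual_dominated[OF this]
  obtain B c where B: "bounded_tests X B" and c: "0 \<le> c"
    and q: "\<And>u. u \<in> distributions X \<Longrightarrow> ?q u \<le> c * sup_seminorm B u" by auto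
  have "?q u \<le> 0 + e" if e: "0 < e" for e
  proof -
    obtain v where v: "v \<in> R" "\<And>\<phi>. \<phi> \<in> B \<Longrightarrow> cmod (u \<phi> - v \<phi>) \<le> e / (c + 1)"
      using dense[OF u B, of "e / (c + 1)"] e c by auto
    have vD: "v \<in> distributions X" using v(1) R by blast
    note d = function_space_diff[OF function_space_distributions u vD]
    have "?q u \<le> ?q (\<lambda>x. u x - v x) + ?q v"
      using seminorm_add[OF function_space_distributions sq d vD] by simp
    also have "?q v = 0" using eq[OF v(1)] by simp
    also have "?q (\<lambda>x. u x - v x) \<le> c * sup_seminorm B (\<lambda>x. u x - v x)" by (rule q[OF d])
    also have "\<dots> \<le> c * (e / (c + 1))"
      by (intro mult_left_mono[OF _ c] sup_seminorm_least[OF B] v(2))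
    also have "\<dots> \<le> e" using c e by (simp add: field_simps)
    finally show ?thesis by simp
  qed
  then have "?q u \<le> 0" by (rule field_le_epsilon)
  then show ?thesis by simp
qed

end

section \<open>Convolution\<close>

definition conv :: "(real^'n::finite \<Rightarrow> complex) \<Rightarrow> (real^'n \<Rightarrow> complex) \<Rightarrow> real^'n \<Rightarrow> complex" where
  "conv a b x = (LINT z|lborel. a (x - z) * b z)"

lemma lborel_reflect: "lborel = distr lborel borel (\<lambda>z. x - z)" for x :: "'a::euclidean_space"
  using lborel_affine[of "-1" x] by (simp add: density_1)

lemma conv_commute:
  fixes a b :: "real^'n::finite \<Rightarrow> complex"
  assumes "continuous_on UNIV a" "continuous_on UNIV b"
  shows "conv a b x = conv b a x"
proof -
  have m: "(\<lambda>z. a (x - z) * b z) \<in> borel_measurable borel"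
    by (intro borel_measurable_continuous_onI continuous_intros continuous_on_compose2[OF assms(1)] assms(2)) auto
  have "conv a b x = (LINT z|distr lborel borel (\<lambda>z. x - z). a (x - z) * b z)"
    unfolding conv_def using lborel_reflect[of x] by simp
  also have "\<dots> = (LINT z|lborel. a (x - (x - z)) * b (x - z))"
    by (rule integral_distr) (use m in auto)
  finally show ?thesis by (simp add: conv_def mult.commute)
qed

text \<open>
  Differentiation under the integral sign, which extends over a box containing the support of \<open>b\<close>.
\<close>

lemma conv_partial_derivative:
  fixes a b :: "real^'n::finite \<Rightarrow> complex"
  assumes a: "smooth_on UNIV a" and b: "continuous_on UNIV b" "compact K" "\<And>x. x \<notin> K \<Longrightarrow> b x = 0"
  shows "partial_derivative i (conv a b) x = conv (partial_derivative i a) b x"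
proof -
  obtain l r where lr: "K \<subseteq> cbox l r" using compact_imp_bounded[OF b(2)] bounded_subset_cbox_symmetric by metis
  have ca: "continuous_on UNIV a'" if "smooth_on UNIV a'" for a' :: "real^'n \<Rightarrow> complex"
    using smooth_on_imp_continuous_on[OF that] .
  have conv: "conv a' b y = integral (cbox l r) (\<lambda>z. a' (y - z) * b z)" if "smooth_on UNIV a'" for a' y
  proof -
    have c: "continuous_on UNIV (\<lambda>z. a' (y - z) * b z)"
      by (intro continuous_intros continuous_on_compose2[OF ca[OF that]] b(1)) auto
    have z: "a' (y - z) * b z = 0" if "z \<notin> K" for z using b(3)[OF that] by simp
    have "conv a' b y = integral UNIV (\<lambda>z. a' (y - z) * b z)"
      unfolding conv_def by (rule integral_lborel[symmetric, OF integrable_compact_support[OF c b(2) z]])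
    also have "\<dots> = integral UNIV (\<lambda>z. if z \<in> cbox l r then a' (y - z) * b z else 0)"
      by (rule arg_cong[where f="integral UNIV"]) (use lr b(3) in \<open>auto simp: fun_eq_iff\<close>)
    finally show ?thesis by (simp add: integral_restrict_UNIV)
  qed
  have "((\<lambda>t. integral (cbox l r) (\<lambda>z. a (x + t *\<^sub>R axis i 1 - z) * b z)) has_vector_derivative
      integral (cbox l r) (\<lambda>z. partial_derivative i a (x + 0 *\<^sub>R axis i 1 - z) * b z)) (at 0 within UNIV)"
  proof (rule leibniz_rule_vector_derivative)
    fix t :: real and z
    obtain D where D: "(a has_derivative D) (at (x + t *\<^sub>R axis i 1 - z))"
      using smooth_on_imp_differentiable[OF a] by (auto simp: differentiable_def)
    have "((\<lambda>t. a (x + t *\<^sub>R axis i 1 - z)) has_derivative (\<lambda>s. D (s *\<^sub>R axis i 1))) (at t)"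
      by (rule has_derivative_compose[where f="\<lambda>t. x + t *\<^sub>R axis i 1 - z" and g=a])
         (use D in \<open>auto intro!: derivative_eq_intros\<close>)
    then have "((\<lambda>t. a (x + t *\<^sub>R axis i 1 - z)) has_vector_derivative D (axis i 1)) (at t)"
      using linear_cmul[OF has_derivative_linear[OF D]] by (simp add: has_vector_derivative_def)
    then have "((\<lambda>t. a (x + t *\<^sub>R axis i 1 - z)) has_vector_derivative
        partial_derivative i a (x + t *\<^sub>R axis i 1 - z)) (at t)"
      by (simp add: partial_derivative_eqI[OF D])
    from has_vector_derivative_mult_left[OF this]
    show "((\<lambda>t. a (x + t *\<^sub>R axis i 1 - z) * b z) has_vector_derivative
        partial_derivative i a (x + t *\<^sub>R axis i 1 - z) * b z) (at t within UNIV)" by simp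
  next
    fix t :: real
    show "(\<lambda>z. a (x + t *\<^sub>R axis i 1 - z) * b z) integrable_on cbox l r"
      by (intro integrable_continuous continuous_intros continuous_on_compose2[OF ca[OF a]]
          continuous_on_subset[OF b(1)]) auto
  next
    show "continuous_on (UNIV \<times> cbox l r) (\<lambda>(t, z). partial_derivative i a (x + t *\<^sub>R axis i 1 - z) * b z)"
      unfolding case_prod_unfold
      by (intro continuous_intros continuous_on_compose2[OF ca[OF smooth_on_partial[OF a]]]
          continuous_on_compose2[OF b(1)]) auto
  qed auto
  then have "partial_derivative i (conv a b) x = integral (cbox l r) (\<lambda>z. partial_derivative i a (x - z) * b z)"
    unfolding partial_derivative_def[of i "conv a b"] conv[OF a] by (intro vector_derivative_at) simp
  then show ?thesis by (simp add: conv[OF smooth_on_partial[OF a]])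
qed

text \<open>
  Differentiating \<open>a * b = b * a\<close> under the integral sign can be done in either factor. Deriving this
  from the commutativity of convolution, rather than by integrating by parts, keeps the order of the
  differentiations.
\<close>

lemma iterated_partial_conv:
  fixes a b :: "real^'n::finite \<Rightarrow> complex"
  assumes a: "smooth_on UNIV a" "compact K" "\<And>x. x \<notin> K \<Longrightarrow> a x = 0"
    and b: "smooth_on UNIV b" "compact L" "\<And>x. x \<notin> L \<Longrightarrow> b x = 0"
  shows "conv (iterated_partial is a) b x = conv a (iterated_partial is b) x"
proof (induction "is" arbitrary: x)
  case (Cons i js)
  note A = smooth_on_iterated[OF a(1)] and B = smooth_on_iterated[OF b(1)]
  note ca = smooth_on_imp_continuous_on[OF a(1)] and cb = smooth_on_imp_continuous_on[OF b(1)]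
  have "conv (iterated_partial (i # js) a) b x = partial_derivative i (conv (iterated_partial js a) b) x"
    using conv_partial_derivative[OF A cb b(2,3)] by simp
  also have "conv (iterated_partial js a) b = conv a (iterated_partial js b)" using Cons by (simp add: fun_eq_iff)
  also have "\<dots> = conv (iterated_partial js b) a"
    using conv_commute[OF ca smooth_on_imp_continuous_on[OF B]] by (simp add: fun_eq_iff)
  also have "partial_derivative i \<dots> x = conv (iterated_partial (i # js) b) a x"
    using conv_partial_derivative[OF B ca a(2,3)] by simp
  also have "\<dots> = conv a (iterated_partial (i # js) b) x"
    by (rule conv_commute[OF smooth_on_imp_continuous_on[OF B] ca])
  finally show ?case .
qed simp

lemma lipschitz_partial_bound:
  fixes f :: "real^'n::finite \<Rightarrow> 'b::real_normed_vector"
  assumes f: "smooth_on UNIV f" and M: "\<And>i x. norm (partial_derivative i f x) \<le> M"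
  shows "norm (f x - f y) \<le> real CARD('n) * M * norm (x - y)"
proof (rule differentiable_bound[OF convex_UNIV])
  fix z :: "real^'n"
  let ?D = "\<lambda>h. \<Sum>i\<in>UNIV. (h $ i) *\<^sub>R partial_derivative i f z"
  show "(f has_derivative ?D) (at z within UNIV)"
    using has_derivative_sum_partial[OF smooth_on_imp_differentiable[OF f UNIV_I]] .
  show "onorm ?D \<le> real CARD('n) * M"
  proof (rule onorm_le)
    fix h :: "real^'n"
    have M0: "0 \<le> M" using M norm_ge_zero order_trans by blast
    have "norm (?D h) \<le> (\<Sum>i\<in>(UNIV::'n set). norm h * M)"
    proof (rule sum_norm_le)
      fix i
      show "norm (h $ i *\<^sub>R partial_derivative i f z) \<le> norm h * M"
        using component_le_norm_cart[of h i] M[of i z] M0 by (auto intro!: mult_mono)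
    qed
    then show "norm (?D h) \<le> real CARD('n) * M * norm h" by (simp add: mult_ac)
  qed
qed auto

lemma iterated_partial_lipschitz:
  fixes f :: "real^'n::finite \<Rightarrow> 'b::real_normed_vector"
  assumes f: "smooth_on UNIV f" and M: "\<And>x. jet_bound (Suc n) f x M" and "length is \<le> n"
  shows "norm (iterated_partial is f x - iterated_partial is f y) \<le> real CARD('n) * M * norm (x - y)"
proof (rule lipschitz_partial_bound[OF smooth_on_iterated[OF f]])
  fix i z
  have "norm (iterated_partial (i # is) f z) \<le> M" using M[of z] assms(3) unfolding jet_bound_def by (metis Suc_le_mono length_Cons)
  then show "norm (partial_derivative i (iterated_partial is f) z) \<le> M" by simp
qed

lemma iterated_partial_translate:
  fixes f :: "real^'n::finite \<Rightarrow> 'b::real_normed_vector"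
  shows "iterated_partial is (\<lambda>x. f (x - y)) x = iterated_partial is f (x - y)"
  by (induction "is" arbitrary: x) (simp_all add: partial_derivative_def algebra_simps)

lemma smooth_on_translate:
  fixes f :: "real^'n::finite \<Rightarrow> 'b::real_normed_vector"
  assumes "smooth_on UNIV f"
  shows "smooth_on UNIV (\<lambda>x. f (x - y))"
proof -
  have "smooth_on UNIV (\<lambda>x. x + (- y))"
    by (intro smooth_on_add smooth_on_ident smooth_on_const open_UNIV)
  then have "smooth_on UNIV (\<lambda>x. x - y)" by simp
  from smooth_on_compose[OF open_UNIV _ this assms] show ?thesis by simp
qed

text \<open>
  The functions \<open>h y / (\<Sum>\<^sub>y h y + infdist z K)\<close>, where \<open>h y\<close> are tent functions on small balls. The distance
  to \<open>K\<close> vanishes on \<open>K\<close> and keeps the denominator positive elsewhere, so that they are continuous on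
  the whole space.
\<close>

lemma continuous_partition:
  fixes K :: "'a::metric_space set"
  assumes K: "compact K" and d: "0 < d"
  shows "\<exists>Y g. finite Y \<and> Y \<subseteq> K \<and> (\<forall>y\<in>Y. continuous_on UNIV (g y)) \<and>
    (\<forall>y z. (0::real) \<le> g y z) \<and> (\<forall>y z. g y z \<noteq> 0 \<longrightarrow> dist z y < d) \<and> (\<forall>z\<in>K. (\<Sum>y\<in>Y. g y z) = 1)"
proof -
  obtain Y where Y: "finite Y" "Y \<subseteq> K" "K \<subseteq> (\<Union>y\<in>Y. ball y d)"
    using compactE_image[OF K, of K "\<lambda>y. ball y d"] d by (metis (no_types, lifting) UN_I centre_in_ball open_ball subsetI)
  define h where "h = (\<lambda>(y::'a) z. max 0 (d - dist z y))"
  define H where "H = (\<lambda>z. (\<Sum>y\<in>Y. h y z) + infdist z K)"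
  have h0: "0 \<le> h y z" for y z by (simp add: h_def)
  have sh: "0 \<le> (\<Sum>y\<in>Y. h y z)" for z by (intro sum_nonneg h0)
  have HK: "0 < (\<Sum>y\<in>Y. h y z)" if z: "z \<in> K" for z
  proof -
    obtain y where y: "y \<in> Y" "z \<in> ball y d" using Y(3) z by blast
    have "0 < h y z" using y(2) by (simp add: h_def dist_commute)
    also have "\<dots> \<le> (\<Sum>y\<in>Y. h y z)" by (rule member_le_sum[OF y(1)]) (auto simp: h0 Y(1))
    finally show ?thesis .
  qed
  have H0: "0 < H z" if Yne: "Y \<noteq> {}" for z
  proof (cases "z \<in> K")
    case True
    then show ?thesis using HK[OF True] infdist_nonneg[of z K] by (simp add: H_def)
  next
    case False
    have "K \<noteq> {}" using Yne Y(2) by blast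
    then have "0 < infdist z K" using False compact_imp_closed[OF K] by (simp add: infdist_pos_not_in_closed)
    then show ?thesis using sh[of z] by (simp add: H_def)
  qed
  show ?thesis
  proof (intro exI conjI ballI allI impI)
    show "finite Y" "Y \<subseteq> K" by fact+
    show "continuous_on UNIV (\<lambda>z. h y z / H z)" if "y \<in> Y" for y
    proof (rule continuous_on_divide)
      show "continuous_on UNIV (\<lambda>z. h y z)" "continuous_on UNIV H"
        unfolding h_def H_def by (intro continuous_intros)+
      show "\<forall>z\<in>UNIV. H z \<noteq> 0" using H0 that by (metis empty_iff less_irrefl)
    qed
    show "0 \<le> h y z / H z" for y z using h0 sh[of z] infdist_nonneg[of z K] by (simp add: H_def)
    show "dist z y < d" if "h y z / H z \<noteq> 0" for y z
      using that by (auto simp: h_def max_def split: if_splits)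
    show "(\<Sum>y\<in>Y. h y z / H z) = 1" if "z \<in> K" for z
      using HK[OF that] infdist_zero[OF that] by (simp add: H_def flip: sum_divide_distrib)
  qed
qed

section \<open>Density of the regular distributions\<close>

text \<open>
  The product is continuous on \<open>X\<close> and vanishes on the complement of \<open>K\<close>, and these open sets cover the
  space.
\<close>

lemma continuous_extension_by_zero:
  fixes f :: "real^'n::finite \<Rightarrow> complex"
  assumes X: "open X" and f: "continuous_on X f" and K: "compact K" "K \<subseteq> X"
    and \<phi>: "continuous_on UNIV \<phi>" "\<And>x. x \<notin> K \<Longrightarrow> \<phi> x = 0"
  shows "continuous_on UNIV (\<lambda>x. f x * \<phi> x)"
proof -
  have "continuous_on (- K) (\<lambda>x. f x * \<phi> x) \<longleftrightarrow> continuous_on (- K) (\<lambda>x. 0::complex)"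
    by (rule continuous_on_cong) (use \<phi>(2) in auto)
  then have 1: "continuous_on (- K) (\<lambda>x. f x * \<phi> x)" by simp
  have 2: "continuous_on X (\<lambda>x. f x * \<phi> x)"
    by (intro continuous_on_mult f continuous_on_subset[OF \<phi>(1)]) auto
  have "X \<union> - K = UNIV" using K(2) by blast
  with continuous_on_open_Un[OF X open_Compl[OF compact_imp_closed[OF K(1)]] 2 1] show ?thesis by simp
qed

lemma regular_distribution_eq:
  fixes f :: "real^'n::finite \<Rightarrow> complex"
  assumes X: "open X" and f: "continuous_on X f" and K: "compact K" "K \<subseteq> X" and \<phi>: "\<phi> \<in> test_functions_on K"
  shows "regular_distribution X f \<phi> = (LINT x|lborel. f x * \<phi> x)" "integrable lborel (\<lambda>x. f x * \<phi> x)"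
proof -
  have \<phi>': "smooth_on UNIV \<phi>" "\<And>x. x \<notin> K \<Longrightarrow> \<phi> x = 0"
    using \<phi> by (auto simp: test_functions_on_iff[OF compact_imp_closed[OF K(1)]])
  have c: "continuous_on UNIV (\<lambda>x. f x * \<phi> x)"
    by (rule continuous_extension_by_zero[OF X f K smooth_on_imp_continuous_on[OF \<phi>'(1)] \<phi>'(2)])
  show "integrable lborel (\<lambda>x. f x * \<phi> x)"
    by (rule integrable_compact_support[OF c K(1)]) (simp add: \<phi>'(2))
  have "\<phi> \<in> test_functions X" using \<phi> test_functions_on_subset[OF K] by blast
  then have "regular_distribution X f \<phi> = (LINT x|lebesgue. indicator X x *\<^sub>R (f x * \<phi> x))"
    by (simp add: regular_distribution_def set_lebesgue_integral_def)
  also have "(\<lambda>x. indicator X x *\<^sub>R (f x * \<phi> x)) = (\<lambda>x. f x * \<phi> x)"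
    using \<phi>'(2) K(2) by (auto simp: fun_eq_iff indicator_def)
  also have "(LINT x|lebesgue. f x * \<phi> x) = (LINT x|lborel. f x * \<phi> x)"
    by (rule integral_completion) (use borel_measurable_continuous_onI[OF c] in simp)
  finally show "regular_distribution X f \<phi> = (LINT x|lborel. f x * \<phi> x)" .
qed

lemma regular_distribution_in_distributions:
  fixes f :: "real^'n::finite \<Rightarrow> complex"
  assumes X: "open X" and f: "continuous_on X f"
  shows "regular_distribution X f \<in> distributions X"
  unfolding distributions_iff
proof (intro conjI ballI allI impI)
  fix \<phi> \<theta> assume pt: "\<phi> \<in> test_functions X" "\<theta> \<in> test_functions X"
  obtain K L where K: "compact K" "K \<subseteq> X" "\<phi> \<in> test_functions_on K" and L: "compact L" "L \<subseteq> X" "\<theta> \<in> test_functions_on L"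
    using pt by (auto simp: test_functions_iff)
  have KL: "compact (K \<union> L)" "K \<union> L \<subseteq> X" using K L by auto
  have m: "\<phi> \<in> test_functions_on (K \<union> L)" "\<theta> \<in> test_functions_on (K \<union> L)"
    using K(3) L(3) test_functions_on_mono[of K "K \<union> L"] test_functions_on_mono[of L "K \<union> L"] by auto
  note s = function_space_add[OF function_space_test_functions_on[OF compact_imp_closed[OF KL(1)]] m]
  show "regular_distribution X f (\<lambda>x. \<phi> x + \<theta> x) = regular_distribution X f \<phi> + regular_distribution X f \<theta>"
    unfolding regular_distribution_eq(1)[OF X f KL s] regular_distribution_eq(1)[OF X f KL m(1)]
      regular_distribution_eq(1)[OF X f KL m(2)]
    using Bochner_Integration.integral_add[OF regular_distribution_eq(2)[OF X f KL m(1)] regular_distribution_eq(2)[OF X f KL m(2)]]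
    by (simp add: distrib_left)
next
  fix c \<phi> assume "\<phi> \<in> test_functions X"
  then obtain K where K: "compact K" "K \<subseteq> X" "\<phi> \<in> test_functions_on K"
    by (auto simp: test_functions_iff)
  note s = function_space_scale[OF function_space_test_functions_on[OF compact_imp_closed[OF K(1)]] K(3)]
  show "regular_distribution X f (\<lambda>x. c * \<phi> x) = c * regular_distribution X f \<phi>"
    unfolding regular_distribution_eq(1)[OF X f K(1,2) s] regular_distribution_eq(1)[OF X f K]
    by (simp add: mult.left_commute)
next
  show "locally_Cn_dominated X (\<lambda>\<phi>. cmod (regular_distribution X f \<phi>))"
    unfolding locally_Cn_dominated_def
  proof (intro allI impI)
    fix K assume "compact K \<and> K \<subseteq> X"
    then have K: "compact K" "K \<subseteq> X" by auto
    let ?g = "\<lambda>x. indicator K x *\<^sub>R cmod (f x)"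
    have g: "integrable lborel ?g"
      by (rule borel_integrable_compact[OF K(1)]) (intro continuous_intros continuous_on_subset[OF f K(2)])
    let ?c = "LINT x|lborel. ?g x"
    have "cmod (regular_distribution X f \<phi>) \<le> ?c * M"
      if \<phi>: "\<phi> \<in> test_functions_on K" and M: "\<forall>x. jet_bound 0 \<phi> x M" for \<phi> M
    proof -
      have z: "\<And>x. x \<notin> K \<Longrightarrow> \<phi> x = 0" using \<phi> by (auto simp: test_functions_on_iff[OF compact_imp_closed[OF K(1)]])
      have "cmod (LINT x|lborel. f x * \<phi> x) \<le> (LINT x|lborel. cmod (f x * \<phi> x))"
        by (rule integral_norm_bound)
      also have "\<dots> \<le> (LINT x|lborel. ?g x * M)"
      proof (rule integral_mono)
        show "integrable lborel (\<lambda>x. cmod (f x * \<phi> x))"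
          using regular_distribution_eq(2)[OF X f K \<phi>] by (rule integrable_norm)
        show "integrable lborel (\<lambda>x. ?g x * M)" using g by simp
        show "cmod (f x * \<phi> x) \<le> ?g x * M" for x
          using M z[of x] by (cases "x \<in> K") (auto simp: norm_mult jet_bound_0 intro: mult_left_mono)
      qed
      finally show ?thesis by (simp add: regular_distribution_eq(1)[OF X f K \<phi>])
    qed
    moreover have "0 \<le> ?c" by (intro Bochner_Integration.integral_nonneg) simp
    ultimately show "\<exists>n c. 0 \<le> c \<and> (\<forall>\<phi>\<in>test_functions_on K. \<forall>M. (\<forall>x. jet_bound n \<phi> x M) \<longrightarrow>
        cmod (regular_distribution X f \<phi>) \<le> c * M)"
      by (intro exI[of _ 0] exI[of _ ?c]) auto
  qed
qed (simp add: regular_distribution_def)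

text \<open>
  Since \<open>\<rho>\<close> is a probability density on the ball of radius \<open>e\<close>, the difference is an average of the
  values \<open>f (x - z) - f x\<close> with \<open>|z| \<le> e\<close>, where \<open>f\<close> is the derivative, and \<open>f\<close> is Lipschitz.
\<close>

lemma mollification_error:
  fixes \<phi> :: "real^'n::finite \<Rightarrow> complex" and \<rho> :: "real^'n \<Rightarrow> real"
  assumes \<phi>: "smooth_on UNIV \<phi>" and M: "\<And>x. jet_bound (Suc n) \<phi> x M" and is_n: "length is \<le> n"
    and \<rho>: "smooth_on UNIV \<rho>" "\<And>x. 0 \<le> \<rho> x" "\<And>x. x \<notin> cball 0 e \<Longrightarrow> \<rho> x = 0" "(LINT x|lborel. \<rho> x) = 1"
  shows "cmod (conv (iterated_partial is \<phi>) (\<lambda>x. of_real (\<rho> x)) x - iterated_partial is \<phi> x) \<le> real CARD('n) * M * e"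
proof -
  let ?f = "iterated_partial is \<phi>"
  have cf: "continuous_on UNIV ?f" by (rule smooth_on_imp_continuous_on[OF smooth_on_iterated[OF \<phi>]])
  have c\<rho>: "continuous_on UNIV \<rho>" by (rule smooth_on_imp_continuous_on[OF \<rho>(1)])
  have M0: "0 \<le> M" using M jet_bound_nonneg by blast
  have i1: "integrable lborel (\<lambda>z. ?f (x - z) * complex_of_real (\<rho> z))"
    by (rule integrable_compact_support[OF _ compact_cball[of 0 e]])
       (auto simp: \<rho>(3)[simplified] intro!: continuous_intros continuous_on_compose2[OF cf] c\<rho>)
  have i\<rho>: "integrable lborel \<rho>" by (rule integrable_compact_support[OF c\<rho> compact_cball \<rho>(3)])
  have i2: "integrable lborel (\<lambda>z. ?f x * complex_of_real (\<rho> z))"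
    using i\<rho> by simp
  have "conv ?f (\<lambda>x. of_real (\<rho> x)) x - ?f x
      = (LINT z|lborel. ?f (x - z) * complex_of_real (\<rho> z)) - (LINT z|lborel. ?f x * complex_of_real (\<rho> z))"
    using \<rho>(4) by (simp add: conv_def)
  also have "\<dots> = (LINT z|lborel. ?f (x - z) * complex_of_real (\<rho> z) - ?f x * complex_of_real (\<rho> z))"
    using i1 i2 by simp
  finally have eq: "conv ?f (\<lambda>x. of_real (\<rho> x)) x - ?f x
      = (LINT z|lborel. ?f (x - z) * complex_of_real (\<rho> z) - ?f x * complex_of_real (\<rho> z))" .
  have "cmod (conv ?f (\<lambda>x. of_real (\<rho> x)) x - ?f x)
      \<le> (LINT z|lborel. cmod (?f (x - z) * complex_of_real (\<rho> z) - ?f x * complex_of_real (\<rho> z)))"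
    unfolding eq by (rule integral_norm_bound)
  also have "\<dots> \<le> (LINT z|lborel. (real CARD('n) * M * e) * \<rho> z)"
  proof (rule integral_mono)
    show "integrable lborel (\<lambda>z. cmod (?f (x - z) * complex_of_real (\<rho> z) - ?f x * complex_of_real (\<rho> z)))"
      using i1 i2 by (intro integrable_norm Bochner_Integration.integrable_diff)
    show "integrable lborel (\<lambda>z. (real CARD('n) * M * e) * \<rho> z)" using i\<rho> by simp
    fix z
    show "cmod (?f (x - z) * complex_of_real (\<rho> z) - ?f x * complex_of_real (\<rho> z)) \<le> (real CARD('n) * M * e) * \<rho> z"
    proof (cases "z \<in> cball 0 e")
      case True
      have "cmod (?f (x - z) - ?f x) \<le> real CARD('n) * M * norm ((x - z) - x)"
        by (rule iterated_partial_lipschitz[OF \<phi> M is_n])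
      also have "\<dots> \<le> real CARD('n) * M * e" using True M0 by (intro mult_left_mono) auto
      finally have "cmod (?f (x - z) - ?f x) * \<rho> z \<le> (real CARD('n) * M * e) * \<rho> z"
        by (intro mult_right_mono \<rho>(2))
      moreover have "cmod (?f (x - z) * complex_of_real (\<rho> z) - ?f x * complex_of_real (\<rho> z)) = cmod (?f (x - z) - ?f x) * \<rho> z"
        using \<rho>(2)[of z] by (simp add: norm_mult flip: left_diff_distrib)
      ultimately show ?thesis by simp
    qed (use \<rho>(3)[of z] in simp)
  qed
  finally show ?thesis using \<rho>(4) by simp
qed

text \<open>
  Inserting \<open>\<Sum>\<^sub>y g y = 1\<close> into the convolution integral, the difference becomes an integral over \<open>K\<close>
  in which \<open>R (x - y)\<close> is compared with \<open>R (x - z)\<close> only for \<open>|y - z| < d\<close>.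
\<close>

lemma discretization_error:
  fixes \<phi> R :: "real^'n::finite \<Rightarrow> complex" and g :: "real^'n \<Rightarrow> real^'n \<Rightarrow> real"
  assumes K: "compact K" and \<phi>: "\<phi> \<in> test_functions_on K" "\<And>x. cmod (\<phi> x) \<le> M"
    and R: "smooth_on UNIV R" "\<And>x. jet_bound (Suc n) R x A" and is_n: "length is \<le> n"
    and Y: "finite Y" "\<And>y. y \<in> Y \<Longrightarrow> continuous_on UNIV (g y)" "\<And>y z. 0 \<le> g y z"
      "\<And>y z. g y z \<noteq> 0 \<Longrightarrow> dist z y < d" "\<And>z. z \<in> K \<Longrightarrow> (\<Sum>y\<in>Y. g y z) = 1"
  shows "cmod (iterated_partial is (\<lambda>x. \<Sum>y\<in>Y. (LINT z|lborel. g y z * \<phi> z) * R (x - y)) x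
      - conv (iterated_partial is R) \<phi> x) \<le> (real CARD('n) * A * d) * M * measure lborel K"
proof -
  let ?D = "iterated_partial is R"
  have \<phi>': "smooth_on UNIV \<phi>" "\<And>x. x \<notin> K \<Longrightarrow> \<phi> x = 0"
    using \<phi>(1) by (auto simp: test_functions_on_iff[OF compact_imp_closed[OF K]])
  have c\<phi>: "continuous_on UNIV \<phi>" by (rule smooth_on_imp_continuous_on[OF \<phi>'(1)])
  have cD: "continuous_on UNIV ?D" by (rule smooth_on_imp_continuous_on[OF smooth_on_iterated[OF R(1)]])
  have A0: "0 \<le> A" using R(2) jet_bound_nonneg by blast
  have M0: "0 \<le> M" using \<phi>(2)[of x] norm_ge_zero order_trans by blast
  have i1: "integrable lborel (\<lambda>z. g y z * \<phi> z)" if "y \<in> Y" for y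
    by (rule integrable_compact_support[OF _ K]) (auto simp: \<phi>'(2) intro!: continuous_intros Y(2) that c\<phi>)
  have i2: "integrable lborel (\<lambda>z. ?D (x - z) * \<phi> z)"
    by (rule integrable_compact_support[OF _ K])
       (auto simp: \<phi>'(2) intro!: continuous_intros continuous_on_compose2[OF cD] c\<phi>)
  have "iterated_partial is (\<lambda>x. \<Sum>y\<in>Y. (LINT z|lborel. g y z * \<phi> z) * R (x - y)) x
      = (\<Sum>y\<in>Y. iterated_partial is (\<lambda>x. (LINT z|lborel. g y z * \<phi> z) * R (x - y)) x)"
    by (intro iterated_partial_sum[OF open_UNIV] smooth_on_mult smooth_on_const smooth_on_translate R(1) open_UNIV) simp
  also have "\<dots> = (\<Sum>y\<in>Y. (LINT z|lborel. g y z * \<phi> z) * ?D (x - y))"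
  proof (rule sum.cong[OF refl])
    fix y
    have "iterated_partial is (\<lambda>x. (LINT z|lborel. g y z * \<phi> z) * R (x - y)) x
        = (LINT z|lborel. g y z * \<phi> z) * iterated_partial is (\<lambda>x. R (x - y)) x"
      by (rule bounded_linear.iterated_partial_linear[OF bounded_linear_mult_right open_UNIV smooth_on_translate[OF R(1)]]) simp
    then show "iterated_partial is (\<lambda>x. (LINT z|lborel. g y z * \<phi> z) * R (x - y)) x
        = (LINT z|lborel. g y z * \<phi> z) * ?D (x - y)"
      by (simp add: iterated_partial_translate)
  qed
  also have "\<dots> = (\<Sum>y\<in>Y. (LINT z|lborel. (g y z * \<phi> z) * ?D (x - y)))" by simp
  also have "\<dots> = (LINT z|lborel. (\<Sum>y\<in>Y. (g y z * \<phi> z) * ?D (x - y)))"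
    using i1 by (intro Bochner_Integration.integral_sum[symmetric]) simp
  finally have "iterated_partial is (\<lambda>x. \<Sum>y\<in>Y. (LINT z|lborel. g y z * \<phi> z) * R (x - y)) x - conv ?D \<phi> x
      = (LINT z|lborel. (\<Sum>y\<in>Y. (g y z * \<phi> z) * ?D (x - y))) - (LINT z|lborel. ?D (x - z) * \<phi> z)"
    by (simp add: conv_def)
  also have "\<dots> = (LINT z|lborel. (\<Sum>y\<in>Y. (g y z * \<phi> z) * ?D (x - y)) - ?D (x - z) * \<phi> z)"
    using i1 i2 by (intro Bochner_Integration.integral_diff[symmetric] Bochner_Integration.integrable_sum) simp_all
  finally have eq: "iterated_partial is (\<lambda>x. \<Sum>y\<in>Y. (LINT z|lborel. g y z * \<phi> z) * R (x - y)) x - conv ?D \<phi> x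
      = (LINT z|lborel. (\<Sum>y\<in>Y. (g y z * \<phi> z) * ?D (x - y)) - ?D (x - z) * \<phi> z)" .
  let ?c = "(real CARD('n) * A * d) * M"
  have pt: "cmod ((\<Sum>y\<in>Y. (g y z * \<phi> z) * ?D (x - y)) - ?D (x - z) * \<phi> z) \<le> ?c * indicator K z" for z
  proof (cases "z \<in> K")
    case True
    have "(\<Sum>y\<in>Y. complex_of_real (g y z)) = 1"
      using Y(5)[OF True] by (metis of_real_1 of_real_sum)
    then have "?D (x - z) * \<phi> z = (\<Sum>y\<in>Y. complex_of_real (g y z)) * (?D (x - z) * \<phi> z)" by simp
    also have "\<dots> = (\<Sum>y\<in>Y. (g y z * \<phi> z) * ?D (x - z))" unfolding sum_distrib_right by (simp add: mult_ac)
    finally have "(\<Sum>y\<in>Y. (g y z * \<phi> z) * ?D (x - y)) - ?D (x - z) * \<phi> z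
        = (\<Sum>y\<in>Y. (g y z * \<phi> z) * (?D (x - y) - ?D (x - z)))"
      by (simp add: sum_subtractf right_diff_distrib)
    also have "cmod \<dots> \<le> (\<Sum>y\<in>Y. g y z * ?c)"
    proof (rule sum_norm_le)
      fix y assume "y \<in> Y"
      show "cmod ((g y z * \<phi> z) * (?D (x - y) - ?D (x - z))) \<le> g y z * ?c"
      proof (cases "g y z = 0")
        case False
        have "cmod (?D (x - y) - ?D (x - z)) \<le> real CARD('n) * A * norm ((x - y) - (x - z))"
          by (rule iterated_partial_lipschitz[OF R is_n])
        also have "\<dots> \<le> real CARD('n) * A * d"
          using Y(4)[OF False] A0 by (intro mult_left_mono) (auto simp: dist_norm)
        finally have "cmod (?D (x - y) - ?D (x - z)) * cmod (\<phi> z) \<le> (real CARD('n) * A * d) * M"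
          using \<phi>(2) by (intro mult_mono') auto
        from mult_left_mono[OF this Y(3)[of y z]] show ?thesis
          using Y(3)[of y z] by (simp add: norm_mult mult_ac)
      qed simp
    qed
    also have "\<dots> = ?c * indicator K z" using Y(5)[OF True] True by (simp flip: sum_distrib_right)
    finally show ?thesis .
  qed (simp add: \<phi>'(2))
  have iK: "integrable lborel (indicator K :: real^'n \<Rightarrow> real)"
    using K by (intro integrable_real_indicator emeasure_bounded_finite compact_imp_bounded) (auto simp: borel_compact)
  have "cmod (LINT z|lborel. (\<Sum>y\<in>Y. (g y z * \<phi> z) * ?D (x - y)) - ?D (x - z) * \<phi> z)
      \<le> (LINT z|lborel. ?c * indicator K z)"
    using iK pt by (intro Bochner_Integration.integral_norm_bound_integral Bochner_Integration.integrable_diff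
        Bochner_Integration.integrable_sum i2 integrable_mult_left i1) simp_all
  also have "\<dots> = ?c * measure lborel K" by simp
  finally show ?thesis unfolding eq .
qed

text \<open>
  For \<open>\<phi>\<close> in \<open>B\<close>, let \<open>S \<phi> = \<Sum>\<^sub>y (\<integral> g y \<phi>) R(\<cdot> - y)\<close> be the discretized mollification. It approximates \<open>\<phi>\<close>
  with all derivatives up to the order of \<open>u\<close>, uniformly on \<open>B\<close>, and
  \<open>u (S \<phi>) = \<integral> f \<phi>\<close> with the continuous function \<open>f = \<Sum>\<^sub>y u(R(\<cdot> - y)) g y\<close>.
\<close>

lemma regular_distributions_dense:
  fixes X :: "(real^'n::finite) set"
  assumes X: "open X" and u: "u \<in> distributions X" and B: "bounded_tests X B" and e: "0 < e"
  shows "\<exists>v \<in> {regular_distribution X f | f. continuous_on X f}. \<forall>\<phi>\<in>B. cmod (u \<phi> - v \<phi>) \<le> e"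
proof -
  obtain K where K: "compact K" "K \<subseteq> X" "B \<subseteq> test_functions_on K"
    and jets: "\<forall>n. \<exists>M. \<forall>\<phi>\<in>B. \<forall>x. jet_bound n \<phi> x M"
    using B bounded_test_functions_iff[OF X, of B] by (elim exE conjE) auto
  obtain e0 where e0: "0 < e0" "(\<Union>x\<in>K. cball x e0) \<subseteq> X"
    using compact_subset_open_imp_cball_epsilon_subset[OF K(1) X K(2)] by blast
  define K' where "K' = (\<Union>x\<in>K. \<Union>z\<in>cball 0 e0. {x + z})"
  have K'_eq: "K' = (\<Union>x\<in>K. cball x e0)"
  proof -
    have "(\<Union>z\<in>cball 0 e0. {x + z}) = cball x e0" for x :: "real^'n"
      by (auto simp: dist_norm norm_minus_commute intro!: bexI[of _ "_ - x"])
    then show ?thesis by (simp add: K'_def)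
  qed
  have K': "compact K'" "K' \<subseteq> X"
    using compact_sums'[OF K(1) compact_cball[of 0 e0]] e0(2) unfolding K'_def[symmetric] K'_eq by auto
  obtain n c where c: "0 \<le> c"
    and nc: "\<forall>\<phi>\<in>test_functions_on K'. \<forall>M. (\<forall>x. jet_bound n \<phi> x M) \<longrightarrow> cmod (u \<phi>) \<le> c * M"
    using distribution_dominated[OF u K'] by (elim exE conjE)
  obtain M where M: "\<forall>\<phi>\<in>B. \<forall>x. jet_bound (Suc n) \<phi> x M" using jets[rule_format, of "Suc n"] by (elim exE)
  define N where "N = \<bar>M\<bar>"
  have N: "jet_bound (Suc n) \<phi> x N" if "\<phi> \<in> B" for \<phi> x
    using M that jet_bound_mono[of "Suc n" \<phi> x M "Suc n" N] by (simp add: N_def)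
  have N0: "0 \<le> N" by (simp add: N_def)
  define \<eta> where "\<eta> = e / (c + 1)"
  have \<eta>: "0 < \<eta>" "c * \<eta> \<le> e" using c e by (auto simp: \<eta>_def field_simps)
  define d where "d = real CARD('n)"
  have d0: "0 \<le> d" by (simp add: d_def)
  \<comment> \<open>The mollification error \<open>d N \<epsilon>\<close> uses up half of \<open>\<eta>\<close>; and \<open>\<epsilon> \<le> e0\<close> keeps supports in \<open>K'\<close>.\<close>
  define \<epsilon> where "\<epsilon> = min e0 (\<eta> / (2 * (d * N + 1)))"
  have half_cancel: "a * (\<eta> / (2 * a)) = \<eta> / 2" if "0 < a" for a :: real using that by simp
  have dN: "0 < d * N + 1" using d0 N0 by (simp add: add_nonneg_pos)
  have \<epsilon>: "0 < \<epsilon>" "\<epsilon> \<le> e0" using e0(1) \<eta>(1) dN by (auto simp: \<epsilon>_def)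
  have "d * N * \<epsilon> \<le> (d * N + 1) * (\<eta> / (2 * (d * N + 1)))"
    using d0 N0 \<epsilon>(1) by (intro mult_mono) (auto simp: \<epsilon>_def)
  also have "(d * N + 1) * (\<eta> / (2 * (d * N + 1))) = \<eta> / 2" by (rule half_cancel[OF dN])
  finally have err1: "d * N * \<epsilon> \<le> \<eta> / 2" .
  obtain \<rho> :: "real^'n \<Rightarrow> real" where \<rho>: "smooth_on UNIV \<rho>" "\<And>x. 0 \<le> \<rho> x"
      "\<And>x. x \<notin> cball 0 \<epsilon> \<Longrightarrow> \<rho> x = 0" "(LINT x|lborel. \<rho> x) = 1"
    by (rule mollifier[OF \<epsilon>(1)]) (rule that; assumption)
  define R where "R = (\<lambda>x. complex_of_real (\<rho> x))"
  have R: "smooth_on UNIV R" "\<And>x. x \<notin> cball 0 \<epsilon> \<Longrightarrow> R x = 0"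
    using smooth_on_of_real[OF open_UNIV \<rho>(1)] \<rho>(3) by (auto simp: R_def)
  have "R \<in> test_functions_on (cball 0 \<epsilon>)" using R by (simp add: test_functions_on_iff)
  then obtain A where A: "0 \<le> A" "\<forall>x. jet_bound (Suc n) R x A"
    using test_function_jet_bound[OF compact_cball] by blast
  define V where "V = measure lborel K"
  \<comment> \<open>The mesh is chosen after the mollifier, as the discretization error depends on the bound \<open>A\<close> of its derivatives.\<close>
  define \<delta> where "\<delta> = \<eta> / (2 * (d * A * N * V + 1))"
  have P: "0 \<le> d * A * N * V" using d0 A(1) N0 by (simp add: V_def)
  have \<delta>: "0 < \<delta>" using \<eta>(1) P by (simp add: \<delta>_def add_nonneg_pos)
  have "(d * A * \<delta>) * N * V = (d * A * N * V) * \<delta>" by (simp add: mult_ac)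
  also have "\<dots> \<le> (d * A * N * V + 1) * \<delta>" using \<delta> by (intro mult_right_mono) auto
  also have "\<dots> = \<eta> / 2" unfolding \<delta>_def by (rule half_cancel) (use P in simp)
  finally have err2: "(d * A * \<delta>) * N * V \<le> \<eta> / 2" .
  obtain Y g where Y: "finite Y" "Y \<subseteq> K" "\<forall>y\<in>Y. continuous_on UNIV (g y)"
    "\<forall>y z. (0::real) \<le> g y z" "\<forall>y z. g y z \<noteq> 0 \<longrightarrow> dist z y < \<delta>" "\<forall>z\<in>K. (\<Sum>y\<in>Y. g y z) = 1"
    using continuous_partition[OF K(1) \<delta>] by (elim exE conjE)
  have Rt: "(\<lambda>x. R (x - y)) \<in> test_functions_on K'" if y: "y \<in> Y" for y
    unfolding test_functions_on_iff[OF compact_imp_closed[OF K'(1)]]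
  proof (intro conjI allI impI)
    show "smooth_on UNIV (\<lambda>x. R (x - y))" by (rule smooth_on_translate[OF R(1)])
    fix x assume "x \<notin> K'"
    then have "x \<notin> cball y e0" using y Y(2) unfolding K'_eq by blast
    then have "x - y \<notin> cball 0 \<epsilon>" using \<epsilon>(2) by (auto simp: dist_norm norm_minus_commute)
    then show "R (x - y) = 0" by (rule R(2))
  qed
  have RtX: "(\<lambda>x. R (x - y)) \<in> test_functions X" if "y \<in> Y" for y
    using Rt[OF that] test_functions_on_subset[OF K'] by blast
  define f where "f = (\<lambda>z. \<Sum>y\<in>Y. u (\<lambda>x. R (x - y)) * complex_of_real (g y z))"
  have f: "continuous_on X f"
    unfolding f_def using Y(3) by (intro continuous_intros) (auto intro: continuous_on_subset)
  have "cmod (u \<phi> - regular_distribution X f \<phi>) \<le> e" if \<phi>B: "\<phi> \<in> B" for \<phi>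
  proof -
    have \<phi>: "\<phi> \<in> test_functions_on K" using \<phi>B K(3) by blast
    then have \<phi>': "smooth_on UNIV \<phi>" "\<And>x. x \<notin> K \<Longrightarrow> \<phi> x = 0"
      by (auto simp: test_functions_on_iff[OF compact_imp_closed[OF K(1)]])
    have \<phi>X: "\<phi> \<in> test_functions X" using \<phi> test_functions_on_subset[OF K(1,2)] by blast
    define a where "a = (\<lambda>y. LINT z|lborel. complex_of_real (g y z) * \<phi> z)"
    define S where "S = (\<lambda>x. \<Sum>y\<in>Y. a y * R (x - y))"
    have gi: "integrable lborel (\<lambda>z. complex_of_real (g y z) * \<phi> z)" if "y \<in> Y" for y
      by (rule integrable_compact_support[OF _ K(1)])
         (use Y(3) that \<phi>'(2) smooth_on_imp_continuous_on[OF \<phi>'(1)] in \<open>auto intro!: continuous_intros\<close>)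
    have SX: "S \<in> test_functions X" and uS: "u S = (\<Sum>y\<in>Y. a y * u (\<lambda>x. R (x - y)))"
      unfolding S_def using distribution_sum[where f="\<lambda>y x. R (x - y)" and c=a, OF u RtX Y(1)] by auto
    have "u S = (\<Sum>y\<in>Y. (LINT z|lborel. u (\<lambda>x. R (x - y)) * (complex_of_real (g y z) * \<phi> z)))"
      unfolding uS a_def by (simp add: mult.commute)
    also have "\<dots> = (LINT z|lborel. (\<Sum>y\<in>Y. u (\<lambda>x. R (x - y)) * (complex_of_real (g y z) * \<phi> z)))"
      using gi by (intro Bochner_Integration.integral_sum[symmetric]) simp
    also have "\<dots> = (LINT z|lborel. f z * \<phi> z)"
      by (simp add: f_def sum_distrib_right mult.assoc)
    finally have uS': "u S = regular_distribution X f \<phi>"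
      by (simp add: regular_distribution_eq(1)[OF X f K(1,2) \<phi>])
    have sS: "smooth_on UNIV S" by (rule test_functions_smooth[OF SX])
    let ?h = "\<lambda>x. \<phi> x - S x"
    have "?h \<in> test_functions_on K'"
    proof -
      have KK': "K \<subseteq> K'" unfolding K'_eq using e0(1) by force
      have "?h x = 0" if x: "x \<notin> K'" for x
      proof -
        have "R (x - y) = 0" if "y \<in> Y" for y
          using Rt[OF that] x by (simp add: test_functions_on_iff[OF compact_imp_closed[OF K'(1)]])
        then show ?thesis using \<phi>'(2)[of x] x KK' by (auto simp: S_def)
      qed
      then show ?thesis
        using test_functions_smooth[OF function_space_diff[OF function_space_test_functions \<phi>X SX]]
        by (simp add: test_functions_on_iff[OF compact_imp_closed[OF K'(1)]])
    qed
    moreover have "\<forall>x. jet_bound n ?h x \<eta>"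
      unfolding jet_bound_def
    proof (intro allI impI)
      fix x and "is" :: "'n list" assume is_n: "length is \<le> n"
      have sm: "smooth_upto (length is) UNIV \<phi>" "smooth_upto (length is) UNIV (\<lambda>x. - 1 * S x)"
        using \<phi>'(1) smooth_on_mult[OF open_UNIV smooth_on_const[of UNIV "- 1"] sS] smooth_on_iff_upto by blast+
      have "iterated_partial is ?h x = iterated_partial is \<phi> x + iterated_partial is (\<lambda>x. - 1 * S x) x"
        using iterated_partial_add[OF open_UNIV sm, of x "is"] by simp
      also have "iterated_partial is (\<lambda>x. - 1 * S x) x = - 1 * iterated_partial is S x"
        by (rule bounded_linear.iterated_partial_linear[OF bounded_linear_mult_right open_UNIV sS UNIV_I])
      finally have h: "iterated_partial is ?h x = iterated_partial is \<phi> x - iterated_partial is S x" by simp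
      have "conv (iterated_partial is \<phi>) R x = conv \<phi> (iterated_partial is R) x"
        by (rule iterated_partial_conv[OF \<phi>'(1) K(1) \<phi>'(2) R(1) compact_cball R(2)])
      also have "\<dots> = conv (iterated_partial is R) \<phi> x"
        by (intro conv_commute smooth_on_imp_continuous_on smooth_on_iterated \<phi>'(1) R(1))
      finally have cc: "conv (iterated_partial is \<phi>) R x = conv (iterated_partial is R) \<phi> x" .
      have 1: "cmod (conv (iterated_partial is \<phi>) R x - iterated_partial is \<phi> x) \<le> d * N * \<epsilon>"
        unfolding R_def d_def by (rule mollification_error[OF \<phi>'(1) N[OF \<phi>B] is_n \<rho>])
      have \<phi>N: "cmod (\<phi> x) \<le> N" for x using N[OF \<phi>B, of x] by (simp add: jet_bound_Suc)
      have 2: "cmod (iterated_partial is S x - conv (iterated_partial is R) \<phi> x) \<le> (d * A * \<delta>) * N * V"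
        unfolding S_def a_def d_def V_def
        by (rule discretization_error[OF K(1) \<phi> \<phi>N R(1) _ is_n Y(1)]) (use A(2) Y in auto)
      have "cmod (iterated_partial is \<phi> x - iterated_partial is S x)
          \<le> cmod (conv (iterated_partial is \<phi>) R x - iterated_partial is \<phi> x)
            + cmod (iterated_partial is S x - conv (iterated_partial is R) \<phi> x)"
        unfolding cc by (metis add.commute dist_commute dist_norm dist_triangle2)
      then show "cmod (iterated_partial is ?h x) \<le> \<eta>" unfolding h using 1 2 err1 err2 by linarith
    qed
    ultimately have "cmod (u ?h) \<le> c * \<eta>" using nc[rule_format, of ?h \<eta>] by simp
    moreover have "u ?h = u \<phi> - u S" by (rule distribution_diff[OF u \<phi>X SX])
    ultimately show ?thesis using \<eta>(2) uS' by simp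
  qed
  then show ?thesis using f by blast
qed

section \<open>The transposed operator\<close>

text \<open>
  Translates the conditions on the extended real-valued norms into bounds on jets, uniform in \<open>m\<close>.
\<close>

lemma SUP_Cn_norm_finite_iff:
  "(SUP m\<in>{1..}. Cn_norm n (K m) (f m)) < \<infinity> \<longleftrightarrow>
     (\<exists>M\<ge>0. \<forall>m\<ge>1. \<forall>y\<in>K m. jet_bound n (f m) y M)"
proof
  assume fin: "(SUP m\<in>{1..}. Cn_norm n (K m) (f m)) < \<infinity>"
  define M where "M = enn2real (SUP m\<in>{1..}. Cn_norm n (K m) (f m))"
  have M: "ennreal M = (SUP m\<in>{1..}. Cn_norm n (K m) (f m))" unfolding M_def using fin by simp
  have "Cn_norm n (K m) (f m) \<le> ennreal M" if "m \<ge> 1" for m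
    unfolding M by (rule SUP_upper) (use that in simp)
  then have "\<forall>y\<in>K m. jet_bound n (f m) y M" if "m \<ge> 1" for m
    using Cn_norm_le_iff[of M n "K m" "f m"] that by (simp add: M_def)
  moreover have "0 \<le> M" by (simp add: M_def)
  ultimately show "\<exists>M\<ge>0. \<forall>m\<ge>1. \<forall>y\<in>K m. jet_bound n (f m) y M" by (intro exI[of _ M]) simp
next
  assume "\<exists>M\<ge>0. \<forall>m\<ge>1. \<forall>y\<in>K m. jet_bound n (f m) y M"
  then obtain M where "0 \<le> M" "\<forall>m\<ge>1. \<forall>y\<in>K m. jet_bound n (f m) y M" by (elim exE conjE)
  then have "(SUP m\<in>{1..}. Cn_norm n (K m) (f m)) \<le> ennreal M"
    by (intro SUP_least) (simp add: Cn_norm_le_iff)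
  then show "(SUP m\<in>{1..}. Cn_norm n (K m) (f m)) < \<infinity>" by (rule le_less_trans) simp
qed

text \<open>
  The functional \<open>\<phi> \<mapsto> \<partial>\<^sup>\<alpha>\<phi>(y)\<close>, which is a derivative of a point mass up to sign.
\<close>

definition delta_derivative ::
    "(real^'n::finite) set \<Rightarrow> 'n list \<Rightarrow> real^'n \<Rightarrow> (real^'n \<Rightarrow> complex) \<Rightarrow> complex" where
  "delta_derivative X is y = (\<lambda>\<phi>. if \<phi> \<in> test_functions X then iterated_partial is \<phi> y else 0)"

lemma delta_derivative_in_distributions: "delta_derivative X is y \<in> distributions X"
  unfolding distributions_iff
proof (intro conjI ballI allI impI)
  fix \<phi> \<theta> assume pt: "\<phi> \<in> test_functions X" "\<theta> \<in> test_functions X"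
  have sm: "smooth_upto (length is) UNIV \<phi>" "smooth_upto (length is) UNIV \<theta>"
    using test_functions_smooth[OF pt(1)] test_functions_smooth[OF pt(2)] by (simp_all add: smooth_on_iff_upto)
  show "delta_derivative X is y (\<lambda>x. \<phi> x + \<theta> x) = delta_derivative X is y \<phi> + delta_derivative X is y \<theta>"
    using function_space_add[OF function_space_test_functions pt] pt iterated_partial_add[OF open_UNIV sm, of y "is"]
    by (simp add: delta_derivative_def)
next
  fix c \<phi> assume p: "\<phi> \<in> test_functions X"
  have "iterated_partial is (\<lambda>x. c * \<phi> x) y = c * iterated_partial is \<phi> y"
    by (rule bounded_linear.iterated_partial_linear[OF bounded_linear_mult_right open_UNIV test_functions_smooth[OF p] UNIV_I])
  then show "delta_derivative X is y (\<lambda>x. c * \<phi> x) = c * delta_derivative X is y \<phi>"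
    using function_space_scale[OF function_space_test_functions p] p by (simp add: delta_derivative_def)
next
  show "locally_Cn_dominated X (\<lambda>\<phi>. cmod (delta_derivative X is y \<phi>))"
    unfolding locally_Cn_dominated_def
  proof (intro allI impI)
    fix K assume K: "compact K \<and> K \<subseteq> X"
    have "cmod (delta_derivative X is y \<phi>) \<le> 1 * M" if "\<forall>x. jet_bound (length is) \<phi> x M" for \<phi> M
    proof -
      have "cmod (iterated_partial is \<phi> y) \<le> M" using that by (simp add: jet_bound_def)
      moreover have "0 \<le> M" using that jet_bound_nonneg by blast
      ultimately show ?thesis by (simp add: delta_derivative_def)
    qed
    then show "\<exists>n c. 0 \<le> c \<and> (\<forall>\<phi>\<in>test_functions_on K. \<forall>M. (\<forall>x. jet_bound n \<phi> x M) \<longrightarrow>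
        cmod (delta_derivative X is y \<phi>) \<le> c * M)"
      by (intro exI[of _ "length is"] exI[of _ 1] conjI ballI allI impI) simp_all
  qed
qed (simp add: delta_derivative_def)

lemma local_bump_test_function:
  fixes X :: "(real^'n::finite) set"
  assumes X: "open X" and x: "x \<in> X"
  shows "\<exists>r \<phi>. 0 < r \<and> ball x r \<subseteq> X \<and> \<phi> \<in> test_functions X \<and> (\<forall>z\<in>ball x r. \<phi> z = 1)"
proof -
  obtain e where e: "0 < e" "cball x e \<subseteq> X" using X x open_contains_cball by blast
  obtain b :: "real^'n \<Rightarrow> real" where b: "smooth_on UNIV b" "\<And>z. 0 \<le> b z" "\<And>z. z \<in> ball x (e / 2) \<Longrightarrow> b z = 1"
      "\<And>z. z \<notin> cball x (2 * (e / 2)) \<Longrightarrow> b z = 0"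
    by (rule bump_function[OF half_gt_zero[OF e(1)], of x]) (rule that; assumption)
  have "(\<lambda>z. complex_of_real (b z)) \<in> test_functions_on (cball x e)"
    using smooth_on_of_real[OF open_UNIV b(1)] b(4) by (simp add: test_functions_on_iff)
  then have "(\<lambda>z. complex_of_real (b z)) \<in> test_functions X"
    using test_functions_on_subset[OF compact_cball e(2)] by blast
  moreover have "ball x (e / 2) \<subseteq> X" using e by (auto simp: subset_iff)
  ultimately show ?thesis using e(1) b(3)
    by (intro exI[of _ "e / 2"] exI[of _ "\<lambda>z. complex_of_real (b z)"]) simp
qed

locale weighted_composition =
  fixes X :: "(real^'n::finite) set"
    and w :: "real^'n \<Rightarrow> complex"
    and \<psi> :: "real^'n \<Rightarrow> real^'n"
    and C :: "((real^'n \<Rightarrow> complex) \<Rightarrow> complex) \<Rightarrow> ((real^'n \<Rightarrow> complex) \<Rightarrow> complex)"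
  assumes X: "open X"
    and w: "smooth_on X w"
    and w_dense: "X \<subseteq> closure {x \<in> X. w x \<noteq> 0}"
    and \<psi>_into: "\<psi> ` X \<subseteq> X"
    and \<psi>: "smooth_on X \<psi>"
    and \<psi>_inj: "inj_on \<psi> X"
    and \<psi>_det: "\<forall>x\<in>X. det (jacobian \<psi> (at x)) \<noteq> 0"
    and C: "weighted_composition_operator X w \<psi> C"
begin

text \<open>
  The operator \<open>T\<close> whose transpose is \<open>C\<close>. The weight product with a single factor is the quotient of \<open>w\<close>
  by the modulus of the Jacobian determinant.
\<close>

definition transposed :: "(real^'n \<Rightarrow> complex) \<Rightarrow> real^'n \<Rightarrow> complex" where
  "transposed \<phi> y = (if y \<in> \<psi> ` X then weight_product w \<psi> 1 (inv_into X \<psi> y) * \<phi> (inv_into X \<psi> y) else 0)"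

abbreviation "inverse_iterate m \<equiv> inv_into X (\<psi> ^^ m)"

lemma iterate_into: "x \<in> X \<Longrightarrow> (\<psi> ^^ m) x \<in> X"
  using \<psi>_into by (induction m) auto

lemma iterate_inj: "inj_on (\<psi> ^^ m) X"
proof (induction m)
  case (Suc m)
  have "inj_on \<psi> ((\<psi> ^^ m) ` X)" using \<psi>_inj iterate_into by (meson image_subsetI inj_on_subset)
  then show ?case using comp_inj_on[OF Suc] by (simp add: o_def)
qed simp

lemma iterate_smooth: "smooth_on X (\<psi> ^^ m)"
proof (induction m)
  case 0
  show ?case by (simp add: id_def smooth_on_ident)
next
  case (Suc m)
  have "(\<psi> ^^ m) ` X \<subseteq> X" using iterate_into by blast
  from smooth_on_compose[OF X this Suc \<psi>] show ?case by (simp add: o_def)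
qed

lemma iterate_continuous: "continuous_on X (\<psi> ^^ m)"
  by (rule smooth_on_imp_continuous_on[OF iterate_smooth])

lemma open_iterate_image: "open U \<Longrightarrow> U \<subseteq> X \<Longrightarrow> open ((\<psi> ^^ m) ` U)"
  by (rule invariance_of_domain[OF continuous_on_subset[OF iterate_continuous] _ inj_on_subset[OF iterate_inj]])

lemma compact_iterate_image: "compact K \<Longrightarrow> K \<subseteq> X \<Longrightarrow> compact ((\<psi> ^^ m) ` K)"
  by (rule compact_continuous_image[OF continuous_on_subset[OF iterate_continuous]])

lemma inverse_iterate_left [simp]: "x \<in> X \<Longrightarrow> inverse_iterate m ((\<psi> ^^ m) x) = x"
  using iterate_inj by simp

lemma inverse_smooth: "smooth_on (\<psi> ` X) (inv_into X \<psi>)"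
  using smooth_on_inverse_function(2)[OF X \<psi> \<psi>_inj] \<psi>_det by blast

lemma inverse_iterate_smooth: "smooth_on ((\<psi> ^^ m) ` X) (inverse_iterate m)"
proof (induction m)
  case 0
  show ?case by (rule smooth_on_cong[OF _ _ smooth_on_ident]) (use X inverse_iterate_left[of _ 0] in simp_all)
next
  case (Suc m)
  have op: "open ((\<psi> ^^ Suc m) ` X)" by (rule open_iterate_image[OF X order_refl])
  have left: "inv_into X \<psi> (\<psi> ((\<psi> ^^ m) x)) = (\<psi> ^^ m) x" if "x \<in> X" for x
    using iterate_into[OF that] \<psi>_inj by simp
  have "inv_into X \<psi> ` (\<psi> ^^ Suc m) ` X \<subseteq> (\<psi> ^^ m) ` X" using left by auto
  moreover have "smooth_on ((\<psi> ^^ Suc m) ` X) (inv_into X \<psi>)"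
    by (rule smooth_on_subset[OF inverse_smooth]) (use iterate_into in auto)
  ultimately have "smooth_on ((\<psi> ^^ Suc m) ` X) (\<lambda>y. inverse_iterate m (inv_into X \<psi> y))"
    by (rule smooth_on_compose[OF op _ _ Suc])
  then show ?case
  proof (rule smooth_on_cong[OF op, rotated])
    fix y assume "y \<in> (\<psi> ^^ Suc m) ` X"
    then obtain x where x: "x \<in> X" "y = \<psi> ((\<psi> ^^ m) x)" by auto
    have "inverse_iterate (Suc m) y = x" using inverse_iterate_left[OF x(1), of "Suc m"] x(2) by simp
    then show "inverse_iterate m (inv_into X \<psi> y) = inverse_iterate (Suc m) y"
      using left[OF x(1)] x inverse_iterate_left[OF x(1), of m] by simp
  qed
qed

lemma weight_product_smooth: "smooth_on X (weight_product w \<psi> m)"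
proof -
  have "smooth_on X (\<lambda>x. w x * complex_of_real (inverse \<bar>det (jacobian \<psi> (at x))\<bar>))"
    using \<psi>_det by (intro smooth_on_mult[OF X w] smooth_on_of_real[OF X] smooth_on_inverse[OF X] smooth_on_abs[OF X]
        smooth_on_det[OF X] smooth_on_jacobian_nth[OF X \<psi>]) auto
  then have 1: "smooth_on X (\<lambda>x. w x / complex_of_real \<bar>det (jacobian \<psi> (at x))\<bar>)"
    by (simp add: divide_inverse of_real_inverse)
  have "smooth_on X (\<lambda>x. w ((\<psi> ^^ j) x) / complex_of_real \<bar>det (jacobian \<psi> (at ((\<psi> ^^ j) x)))\<bar>)" for j
    by (rule smooth_on_compose[OF X _ iterate_smooth 1]) (use iterate_into in auto)
  then have "smooth_on X (\<lambda>x. \<Prod>j<m. w ((\<psi> ^^ j) x) / complex_of_real \<bar>det (jacobian \<psi> (at ((\<psi> ^^ j) x)))\<bar>)"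
    by (intro smooth_on_prod[OF X])
  then show ?thesis by (simp add: weight_product_def[abs_def])
qed

lemma weight_product_Suc: "weight_product w \<psi> (Suc m) x = weight_product w \<psi> m x * weight_product w \<psi> 1 ((\<psi> ^^ m) x)"
  by (simp add: weight_product_def)

text \<open>
  By induction: the set of \<open>z\<close> in \<open>U\<close> where the product of the first \<open>m\<close> factors does not vanish is open,
  so its image under \<open>\<psi>\<^sup>m\<close> is open and meets the dense set where \<open>w\<close> does not vanish.
\<close>

lemma weight_product_nonzero_dense:
  "open U \<Longrightarrow> U \<subseteq> X \<Longrightarrow> U \<noteq> {} \<Longrightarrow> \<exists>z\<in>U. weight_product w \<psi> m z \<noteq> 0"
proof (induction m)
  case (Suc m)
  let ?U = "{z \<in> U. weight_product w \<psi> m z \<noteq> 0}"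
  have "continuous_on U (weight_product w \<psi> m)"
    by (rule smooth_on_imp_continuous_on[OF smooth_on_subset[OF weight_product_smooth Suc.prems(2)]])
  from continuous_open_preimage[OF this Suc.prems(1) open_Compl[OF closed_singleton[of 0]]]
  have U: "open ?U" by (simp add: vimage_def Int_def)
  have sub: "?U \<subseteq> X" using Suc.prems(2) by blast
  obtain z where z: "z \<in> ?U" using Suc by blast
  have op: "open ((\<psi> ^^ m) ` ?U)" by (rule open_iterate_image[OF U sub])
  have "(\<psi> ^^ m) z \<in> closure {x \<in> X. w x \<noteq> 0}" using z sub iterate_into w_dense by blast
  then have "(\<psi> ^^ m) ` ?U \<inter> {x \<in> X. w x \<noteq> 0} \<noteq> {}"
    using op z open_Int_closure_eq_empty[OF op] by blast
  then obtain z' where z': "z' \<in> ?U" "w ((\<psi> ^^ m) z') \<noteq> 0" by blast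
  have "(\<psi> ^^ m) z' \<in> X" using z'(1) sub iterate_into by blast
  then have "weight_product w \<psi> 1 ((\<psi> ^^ m) z') \<noteq> 0" using z'(2) \<psi>_det by (simp add: weight_product_def)
  then have "weight_product w \<psi> (Suc m) z' \<noteq> 0" unfolding weight_product_Suc using z'(1) by simp
  then show ?case using z'(1) by blast
qed (auto simp: weight_product_def)

lemma transposed_image: "x \<in> X \<Longrightarrow> transposed \<phi> (\<psi> x) = weight_product w \<psi> 1 x * \<phi> x"
  using \<psi>_inj by (simp add: transposed_def)

text \<open>
  The function is smooth on \<open>\<psi>(X)\<close> by composition and vanishes off the compact set \<open>\<psi>(K)\<close>.
\<close>

lemma transposed_test_function:
  assumes K: "compact K" "K \<subseteq> X" and \<phi>: "\<phi> \<in> test_functions_on K"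
  shows "transposed \<phi> \<in> test_functions_on (\<psi> ` K)"
proof -
  have \<phi>': "smooth_on UNIV \<phi>" "\<And>x. x \<notin> K \<Longrightarrow> \<phi> x = 0"
    using \<phi> by (auto simp: test_functions_on_iff[OF compact_imp_closed[OF K(1)]])
  have c: "closed (\<psi> ` K)" using compact_iterate_image[OF K, of 1] by (simp add: compact_imp_closed)
  have op: "open (\<psi> ` X)" using open_iterate_image[OF X order_refl, of 1] by simp
  have zero: "transposed \<phi> y = 0" if y: "y \<notin> \<psi> ` K" for y
  proof (cases "y \<in> \<psi> ` X")
    case True
    then obtain x where x: "x \<in> X" "y = \<psi> x" by blast
    then have "x \<notin> K" using y by blast
    then show ?thesis using transposed_image[OF x(1)] x(2) \<phi>'(2) by simp
  qed (simp add: transposed_def)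
  have 1: "smooth_on (- (\<psi> ` K)) (transposed \<phi>)"
    by (rule smooth_on_cong[OF _ _ smooth_on_const[of _ 0]]) (use c zero in auto)
  have "smooth_on X (\<lambda>x. weight_product w \<psi> 1 x * \<phi> x)"
    by (intro smooth_on_mult[OF X weight_product_smooth] smooth_on_subset[OF \<phi>'(1)]) simp
  from smooth_on_compose[OF op _ inverse_smooth this]
  have "smooth_on (\<psi> ` X) (\<lambda>y. weight_product w \<psi> 1 (inv_into X \<psi> y) * \<phi> (inv_into X \<psi> y))"
    by (simp add: image_subset_iff inv_into_into)
  then have 2: "smooth_on (\<psi> ` X) (transposed \<phi>)"
    by (rule smooth_on_cong[OF op, rotated]) (simp add: transposed_def)
  have "- (\<psi> ` K) \<union> \<psi> ` X = UNIV" using K(2) by blast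
  then have "smooth_on UNIV (transposed \<phi>)" using smooth_on_union[OF 1 2] by simp
  then show ?thesis using zero by (simp add: test_functions_on_iff[OF c])
qed

lemma iterated_transposed_test_function:
  assumes K: "compact K" "K \<subseteq> X" and \<phi>: "\<phi> \<in> test_functions_on K"
  shows "(transposed ^^ m) \<phi> \<in> test_functions_on ((\<psi> ^^ m) ` K)"
proof (induction m)
  case (Suc m)
  have "transposed ((transposed ^^ m) \<phi>) \<in> test_functions_on (\<psi> ` (\<psi> ^^ m) ` K)"
    by (rule transposed_test_function[OF compact_iterate_image[OF K] _ Suc]) (use K(2) iterate_into in blast)
  then show ?case by (simp add: image_comp)
qed (use \<phi> in simp)

lemma transposed_in_test_functions: "\<phi> \<in> test_functions X \<Longrightarrow> (transposed ^^ m) \<phi> \<in> test_functions X"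
proof -
  assume "\<phi> \<in> test_functions X"
  then obtain K where K: "compact K" "K \<subseteq> X" "\<phi> \<in> test_functions_on K" by (auto simp: test_functions_iff)
  have "(\<psi> ^^ m) ` K \<subseteq> X" using K(2) iterate_into by blast
  then show ?thesis
    using iterated_transposed_test_function[OF K] test_functions_on_subset[OF compact_iterate_image[OF K(1,2)]] by blast
qed

lemma iterated_transposed_image:
  "x \<in> X \<Longrightarrow> (transposed ^^ m) \<phi> ((\<psi> ^^ m) x) = weight_product w \<psi> m x * \<phi> x"
proof (induction m)
  case (Suc m)
  have "transposed ((transposed ^^ m) \<phi>) (\<psi> ((\<psi> ^^ m) x))
      = weight_product w \<psi> 1 ((\<psi> ^^ m) x) * (transposed ^^ m) \<phi> ((\<psi> ^^ m) x)"
    by (rule transposed_image[OF iterate_into[OF Suc.prems]])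
  then show ?case using Suc by (simp add: weight_product_Suc[of m] mult_ac)
qed (simp add: weight_product_def)

text \<open>
  Change of variables: the factor \<open>|det J\<psi>|\<close> cancels against the one in the definition of \<open>T\<close>.
\<close>

lemma operator_regular:
  assumes f: "continuous_on X f" and \<phi>: "\<phi> \<in> test_functions X"
  shows "C (regular_distribution X f) \<phi> = regular_distribution X f (transposed \<phi>)"
proof -
  obtain K where K: "compact K" "K \<subseteq> X" "\<phi> \<in> test_functions_on K" using \<phi> by (auto simp: test_functions_iff)
  have z: "\<phi> x = 0" if "x \<notin> K" for x
    using K(3) that by (simp add: test_functions_on_iff[OF compact_imp_closed[OF K(1)]])
  have K': "compact (\<psi> ` K)" "\<psi> ` K \<subseteq> X"
    using compact_iterate_image[OF K(1,2), of 1] K(2) \<psi>_into by auto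
  have t: "transposed \<phi> \<in> test_functions_on (\<psi> ` K)" by (rule transposed_test_function[OF K])
  have wf: "continuous_on X (\<lambda>x. w x * f (\<psi> x))"
    by (intro continuous_on_mult smooth_on_imp_continuous_on[OF w]
        continuous_on_compose2[OF f smooth_on_imp_continuous_on[OF \<psi>] \<psi>_into])
  have "C (regular_distribution X f) = regular_distribution X (\<lambda>x. w x * f (\<psi> x))"
    using C f by (simp add: weighted_composition_operator_def)
  then have "C (regular_distribution X f) \<phi> = (LINT x|lborel. w x * f (\<psi> x) * \<phi> x)"
    by (simp add: regular_distribution_eq(1)[OF X wf K])
  also have "\<dots> = (LINT y|lborel. f y * transposed \<phi> y)"
  proof (rule change_of_variables_lborel[OF X _ \<psi>_inj])
    show "(\<psi> has_derivative frechet_derivative \<psi> (at x)) (at x)" if "x \<in> X" for x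
      using smooth_on_imp_differentiable[OF \<psi> that] by (simp add: frechet_derivative_works)
    show "integrable lborel (\<lambda>y. f y * transposed \<phi> y)" by (rule regular_distribution_eq(2)[OF X f K' t])
    show "f y * transposed \<phi> y = 0" if "y \<notin> \<psi> ` X" for y using that by (simp add: transposed_def)
    show "integrable lborel (\<lambda>x. w x * f (\<psi> x) * \<phi> x)" by (rule regular_distribution_eq(2)[OF X wf K])
    show "w x * f (\<psi> x) * \<phi> x = 0" if "x \<notin> X" for x using z[of x] that K(2) by auto
    show "w x * f (\<psi> x) * \<phi> x = \<bar>det (matrix (frechet_derivative \<psi> (at x)))\<bar> *\<^sub>R (f (\<psi> x) * transposed \<phi> (\<psi> x))"
      if "x \<in> X" for x
      using \<psi>_det that by (simp add: transposed_image[OF that] weight_product_def scaleR_conv_of_real flip: jacobian_def)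
  qed
  also have "\<dots> = regular_distribution X f (transposed \<phi>)"
    by (rule regular_distribution_eq(1)[OF X f K' t, symmetric])
  finally show ?thesis .
qed

lemma operator_continuous_linear: "continuous_linear_operator (distributions X) (strong_dual_topology X) C"
  using C by (simp add: weighted_composition_operator_def)

lemma operator_distribution: "u \<in> distributions X \<Longrightarrow> (C ^^ m) u \<in> distributions X"
  using operator_continuous_linear by (induction m) (auto simp: continuous_linear_operator_def)

lemma operator_eq_transposed:
  assumes u: "u \<in> distributions X" and \<phi>: "\<phi> \<in> test_functions X"
  shows "C u \<phi> = u (transposed \<phi>)"
proof (rule strong_dual_functional_vanishes[OF X operator_continuous_linear \<phi> _ _ _ _ u])
  show "transposed \<phi> \<in> test_functions X" using transposed_in_test_functions[OF \<phi>, of 1] by simp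
  show "{regular_distribution X f |f. continuous_on X f} \<subseteq> distributions X"
    using regular_distribution_in_distributions[OF X] by blast
  show "C v \<phi> = v (transposed \<phi>)" if "v \<in> {regular_distribution X f |f. continuous_on X f}" for v
    using that operator_regular[OF _ \<phi>] by blast
  show "\<exists>v\<in>{regular_distribution X f |f. continuous_on X f}. \<forall>\<phi>\<in>B. cmod (u \<phi> - v \<phi>) \<le> e"
    if "u \<in> distributions X" "bounded_tests X B" "0 < e" for u B e
    by (rule regular_distributions_dense[OF X that])
qed

lemma iterated_operator:
  assumes u: "u \<in> distributions X"
  shows "\<phi> \<in> test_functions X \<Longrightarrow> (C ^^ m) u \<phi> = u ((transposed ^^ m) \<phi>)"
proof (induction m arbitrary: \<phi>)
  case (Suc m)
  have t: "transposed \<phi> \<in> test_functions X" using transposed_in_test_functions[OF Suc.prems, of 1] by simp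
  have "(C ^^ Suc m) u \<phi> = (C ^^ m) u (transposed \<phi>)"
    using operator_eq_transposed[OF operator_distribution[OF u] Suc.prems] by simp
  also have "\<dots> = u ((transposed ^^ m) (transposed \<phi>))" by (rule Suc.IH[OF t])
  finally show ?case by (simp add: funpow_swap1)
qed simp

section \<open>Power boundedness from orbit bounds\<close>

text \<open>
  Stable orbits provide the common support. On \<open>\<psi>\<^sup>m(K)\<close> the derivatives of
  \<open>T\<^sup>m \<phi> = (W\<^sub>m \<circ> (\<psi>\<^sup>m)\<^sup>-\<^sup>1) \<cdot> (\<phi> \<circ> (\<psi>\<^sup>m)\<^sup>-\<^sup>1)\<close> are controlled by the two conditions, and off this set they
  vanish.
\<close>

lemma transposed_iterates_bounded:
  assumes so: "stable_orbits X \<psi>" and wc: "weight_condition X w \<psi>" and ic: "inverse_condition X \<psi>"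
    and B: "bounded_tests X B"
  shows "bounded_tests X (\<Union>m\<in>{1..}. (transposed ^^ m) ` B)"
proof -
  let ?B = "\<Union>m\<in>{1..}. (transposed ^^ m) ` B"
  have "\<exists>K. compact K \<and> K \<subseteq> X \<and> B \<subseteq> test_functions_on K \<and> (\<forall>n. \<exists>M. \<forall>\<phi>\<in>B. \<forall>x. jet_bound n \<phi> x M)"
    by (rule bounded_test_functions_iff[OF X, THEN iffD1, OF conjunct2[OF B]])
  then obtain K where K: "compact K" "K \<subseteq> X" "B \<subseteq> test_functions_on K"
    and jets: "\<forall>n. \<exists>M. \<forall>\<phi>\<in>B. \<forall>x. jet_bound n \<phi> x M"
    by (elim exE conjE)
  have "\<exists>L. compact L \<and> L \<subseteq> X \<and> (\<forall>m\<ge>1. (\<psi> ^^ m) ` K \<subseteq> L)"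
    using so K(1,2) unfolding stable_orbits_def by simp
  then obtain L where L: "compact L" "L \<subseteq> X" "\<forall>m\<ge>1. (\<psi> ^^ m) ` K \<subseteq> L"
    by (elim exE conjE)
  have support: "(transposed ^^ m) \<phi> \<in> test_functions_on ((\<psi> ^^ m) ` K)" if "\<phi> \<in> B" for m \<phi>
    by (rule iterated_transposed_test_function[OF K(1,2) subsetD[OF K(3) that]])
  have sub: "?B \<subseteq> test_functions_on L"
  proof
    fix \<theta> assume "\<theta> \<in> ?B"
    then obtain m \<phi> where m: "m \<ge> 1" "\<phi> \<in> B" "\<theta> = (transposed ^^ m) \<phi>" by auto
    show "\<theta> \<in> test_functions_on L"
      unfolding m(3) by (rule subsetD[OF test_functions_on_mono[OF L(3)[rule_format, OF m(1)]] support[OF m(2)]])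
  qed
  have bound: "\<exists>M. \<forall>\<theta>\<in>?B. \<forall>y. jet_bound n \<theta> y M" for n
  proof -
    have "\<exists>M\<ge>0. \<forall>m\<ge>1. \<forall>y\<in>(\<psi> ^^ m) ` K. jet_bound n (weight_product w \<psi> m \<circ> inverse_iterate m) y M"
      using wc K(1,2) unfolding weight_condition_def SUP_Cn_norm_finite_iff by simp
    then obtain M1 where M1: "0 \<le> M1"
      "\<forall>m\<ge>1. \<forall>y\<in>(\<psi> ^^ m) ` K. jet_bound n (weight_product w \<psi> m \<circ> inverse_iterate m) y M1" by (elim exE conjE)
    have "\<forall>c. \<exists>M\<ge>0. \<forall>m\<ge>1. \<forall>y\<in>(\<psi> ^^ m) ` K. jet_bound n (\<lambda>y. inverse_iterate m y $ c) y M"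
      using ic K(1,2) unfolding inverse_condition_def SUP_Cn_norm_finite_iff by simp
    then have "\<exists>M2. \<forall>c. 0 \<le> M2 c \<and> (\<forall>m\<ge>1. \<forall>y\<in>(\<psi> ^^ m) ` K. jet_bound n (\<lambda>y. inverse_iterate m y $ c) y (M2 c))"
      by (rule choice)
    then obtain M2 where M2: "\<forall>c. 0 \<le> M2 c"
      "\<forall>c. \<forall>m\<ge>1. \<forall>y\<in>(\<psi> ^^ m) ` K. jet_bound n (\<lambda>y. inverse_iterate m y $ c) y (M2 c)" by auto
    define M where "M = (\<Sum>c\<in>UNIV. M2 c)"
    have M: "0 \<le> M" "M2 c \<le> M" for c
      unfolding M_def using M2(1) by (auto intro!: sum_nonneg member_le_sum)
    obtain M3 where M3: "\<forall>\<phi>\<in>B. \<forall>x. jet_bound n \<phi> x M3" using jets[rule_format, of n] by (elim exE)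
    obtain c where c: "\<forall>(f::real^'n \<Rightarrow> complex) (g::real^'n \<Rightarrow> real^'n) Y Z y A.
        open Y \<longrightarrow> g ` Y \<subseteq> Z \<longrightarrow> smooth_on Y g \<longrightarrow> smooth_on Z f \<longrightarrow> y \<in> Y \<longrightarrow>
        (\<forall>c. jet_bound n (\<lambda>y. g y $ c) y M) \<longrightarrow> jet_bound n f (g y) A \<longrightarrow>
        jet_bound n (\<lambda>y. f (g y)) y (c * A)"
      using jet_bound_compose[where 'm='n and 'n='n and 'b=complex, OF M(1), of n] by (elim exE conjE)
    define M4 where "M4 = \<bar>2 ^ n * M1 * (c * M3)\<bar>"
    have "jet_bound n ((transposed ^^ m) \<phi>) y M4" if m: "m \<ge> 1" and \<phi>B: "\<phi> \<in> B" for m \<phi> y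
    proof (cases "y \<in> (\<psi> ^^ m) ` K")
      case False
      have z: "(transposed ^^ m) \<phi> y = 0" if "y \<notin> (\<psi> ^^ m) ` K" for y
        using support[OF \<phi>B, of m] that
        by (simp add: test_functions_on_iff[OF compact_imp_closed[OF compact_iterate_image[OF K(1,2)]]])
      show ?thesis
        by (rule jet_bound_outside_support[where K="(\<psi> ^^ m) ` K"])
           (use z False compact_imp_closed[OF compact_iterate_image[OF K(1,2)]] in \<open>auto simp: M4_def\<close>)
    next
      case True
      let ?Y = "(\<psi> ^^ m) ` X"
      have Y: "open ?Y" by (rule open_iterate_image[OF X order_refl])
      have y: "y \<in> ?Y" using True K(2) by blast
      have \<phi>s: "smooth_on UNIV \<phi>" using \<phi>B K(3) by (auto simp: test_functions_on_def)
      have inv_into: "inverse_iterate m ` ?Y \<subseteq> X" by (auto intro: inv_into_into)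
      have s1: "smooth_on ?Y (\<lambda>y. weight_product w \<psi> m (inverse_iterate m y))"
        by (rule smooth_on_compose[OF Y inv_into inverse_iterate_smooth weight_product_smooth])
      have s2: "smooth_on ?Y (\<lambda>y. \<phi> (inverse_iterate m y))"
        by (rule smooth_on_compose[OF Y subset_UNIV inverse_iterate_smooth \<phi>s])
      have j2: "jet_bound n (\<lambda>y. \<phi> (inverse_iterate m y)) y (c * M3)"
      proof (rule c[rule_format, OF Y subset_UNIV inverse_iterate_smooth \<phi>s y])
        show "jet_bound n (\<lambda>y. inverse_iterate m y $ c) y M" for c
          by (rule jet_bound_mono[OF M2(2)[rule_format, OF m True] order_refl M(2)])
        show "jet_bound n \<phi> (inverse_iterate m y) M3" by (rule M3[rule_format, OF \<phi>B])
      qed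
      have j1: "jet_bound n (\<lambda>y. weight_product w \<psi> m (inverse_iterate m y)) y M1"
        using M1(2)[rule_format, OF m True] by (simp add: o_def)
      have "jet_bound n (\<lambda>y. weight_product w \<psi> m (inverse_iterate m y) * \<phi> (inverse_iterate m y)) y (2 ^ n * M1 * (c * M3))"
        by (rule bounded_bilinear.jet_bound_prod[OF bounded_bilinear_mult Y y _ _ _ j1 j2])
           (use s1 s2 in \<open>simp_all add: norm_mult smooth_on_iff_upto\<close>)
      then have "jet_bound n (\<lambda>y. weight_product w \<psi> m (inverse_iterate m y) * \<phi> (inverse_iterate m y)) y M4"
        by (rule jet_bound_mono) (simp_all add: M4_def)
      then show ?thesis
        by (rule jet_bound_cong[OF Y _ y, rotated]) (use iterated_transposed_image in auto)
    qed
    then show ?thesis by (intro exI[of _ M4]) auto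
  qed
  have "\<exists>K. compact K \<and> K \<subseteq> X \<and> ?B \<subseteq> test_functions_on K \<and> (\<forall>n. \<exists>M. \<forall>\<theta>\<in>?B. \<forall>y. jet_bound n \<theta> y M)"
    using L(1,2) sub bound by (intro exI[of _ L]) simp
  then have "bounded_subset (test_functions X) (test_functions_topology X) ?B"
    using bounded_test_functions_iff[OF X, of ?B] by simp
  then show ?thesis using B by auto
qed

lemma power_bounded_if:
  assumes "stable_orbits X \<psi>" "weight_condition X w \<psi>" "inverse_condition X \<psi>"
  shows "power_bounded (distributions X) (strong_dual_topology X) C"
  unfolding power_bounded_def
proof (intro conjI allI impI operator_continuous_linear)
  fix p assume "continuous_seminorm (distributions X) (strong_dual_topology X) p"
  from continuous_seminorm_dual_dominated[OF X this]
  obtain B c where Bcp: "bounded_tests X B \<and> 0 \<le> c \<and> (\<forall>u\<in>distributions X. p u \<le> c * sup_seminorm B u)"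
    by (elim exE)
  then have B: "bounded_tests X B" and c: "0 \<le> c" and p: "\<forall>u\<in>distributions X. p u \<le> c * sup_seminorm B u"
    by simp_all
  let ?B = "\<Union>m\<in>{1..}. (transposed ^^ m) ` B"
  note B' = transposed_iterates_bounded[OF assms B]
  have "p ((C ^^ m) u) \<le> c * sup_seminorm ?B u" if m: "m \<ge> 1" and u: "u \<in> distributions X" for m u
  proof -
    have "sup_seminorm B ((C ^^ m) u) \<le> sup_seminorm ?B u"
    proof (rule sup_seminorm_least[OF X B])
      fix \<phi> assume \<phi>: "\<phi> \<in> B"
      have "(C ^^ m) u \<phi> = u ((transposed ^^ m) \<phi>)"
        by (rule iterated_operator[OF u subsetD[OF bounded_tests_subset[OF X B] \<phi>]])
      moreover have "(transposed ^^ m) \<phi> \<in> ?B" using m \<phi> by auto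
      ultimately show "cmod ((C ^^ m) u \<phi>) \<le> sup_seminorm ?B u"
        using sup_seminorm_upper[OF X B' u] by simp
    qed
    from mult_left_mono[OF this c] p[rule_format, OF operator_distribution[OF u], of m]
    show ?thesis by linarith
  qed
  then show "\<exists>q. continuous_seminorm (distributions X) (strong_dual_topology X) q \<and>
      (\<forall>m\<ge>1. \<forall>u\<in>distributions X. p ((C ^^ m) u) \<le> q u)"
    using continuous_seminorm_sup_seminorm[OF X B' c] by (intro exI[of _ "\<lambda>u. c * sup_seminorm ?B u"]) simp
qed

section \<open>Orbit bounds from power boundedness\<close>

text \<open>
  Power boundedness is applied to the seminorm \<open>u \<mapsto> |u \<phi>|\<close> only; the resulting inequality is tested with
  the functionals \<open>\<theta> \<mapsto> \<partial>\<^sup>\<alpha>\<theta>(y)\<close>. At points \<open>y\<close> outside the common support \<open>L\<close> of \<open>B\<close> it gives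
  \<open>T\<^sup>m \<phi> y = 0\<close>.
\<close>

lemma power_bounded_orbit_bounds:
  assumes pb: "power_bounded (distributions X) (strong_dual_topology X) C" and \<phi>: "\<phi> \<in> test_functions X"
  shows "\<exists>L. compact L \<and> L \<subseteq> X \<and> (\<forall>m\<ge>1. \<forall>y. y \<notin> L \<longrightarrow> (transposed ^^ m) \<phi> y = 0) \<and>
     (\<forall>n. \<exists>M. \<forall>m\<ge>1. \<forall>y. jet_bound n ((transposed ^^ m) \<phi>) y M)"
proof -
  note single = bounded_tests_singleton[OF X \<phi>]
  have "continuous_seminorm (distributions X) (strong_dual_topology X) (\<lambda>u. 1 * sup_seminorm {\<phi>} u)"
    by (rule continuous_seminorm_sup_seminorm[OF X single]) simp
  then have "\<exists>q. continuous_seminorm (distributions X) (strong_dual_topology X) q \<and>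
      (\<forall>m\<ge>1. \<forall>u\<in>distributions X. 1 * sup_seminorm {\<phi>} ((C ^^ m) u) \<le> q u)"
    using pb unfolding power_bounded_def by blast
  then obtain q where q: "continuous_seminorm (distributions X) (strong_dual_topology X) q"
    "\<forall>m\<ge>1. \<forall>u\<in>distributions X. 1 * sup_seminorm {\<phi>} ((C ^^ m) u) \<le> q u" by (elim exE conjE)
  from continuous_seminorm_dual_dominated[OF X q(1)]
  obtain B c where Bcq: "bounded_tests X B \<and> 0 \<le> c \<and> (\<forall>u\<in>distributions X. q u \<le> c * sup_seminorm B u)"
    by (elim exE)
  then have B: "bounded_tests X B" and c: "0 \<le> c" and qB: "\<forall>u\<in>distributions X. q u \<le> c * sup_seminorm B u"
    by simp_all
  have "\<exists>K. compact K \<and> K \<subseteq> X \<and> B \<subseteq> test_functions_on K \<and> (\<forall>n. \<exists>M. \<forall>\<phi>\<in>B. \<forall>x. jet_bound n \<phi> x M)"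
    by (rule bounded_test_functions_iff[OF X, THEN iffD1, OF conjunct2[OF B]])
  then obtain L where L: "compact L" "L \<subseteq> X" "B \<subseteq> test_functions_on L"
    and jets: "\<forall>n. \<exists>M. \<forall>\<theta>\<in>B. \<forall>x. jet_bound n \<theta> x M"
    by (elim exE conjE)
  have est: "cmod (iterated_partial is ((transposed ^^ m) \<phi>) y) \<le> c * s"
    if m: "m \<ge> 1" and s: "\<And>\<theta>. \<theta> \<in> B \<Longrightarrow> cmod (iterated_partial is \<theta> y) \<le> s" for m "is" y s
  proof -
    let ?u = "delta_derivative X is y"
    have u: "?u \<in> distributions X" by (rule delta_derivative_in_distributions)
    have "cmod (iterated_partial is ((transposed ^^ m) \<phi>) y) = cmod ((C ^^ m) ?u \<phi>)"
      unfolding iterated_operator[OF u \<phi>]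
      using transposed_in_test_functions[OF \<phi>, of m] by (simp add: delta_derivative_def)
    also have "\<dots> = 1 * sup_seminorm {\<phi>} ((C ^^ m) ?u)" by (simp add: sup_seminorm_def)
    also have "\<dots> \<le> q ?u" by (rule q(2)[rule_format, OF m u])
    also have "\<dots> \<le> c * sup_seminorm B ?u" by (rule qB[rule_format, OF u])
    also have "\<dots> \<le> c * s"
    proof (intro mult_left_mono[OF _ c] sup_seminorm_least[OF X B])
      fix \<theta> assume \<theta>: "\<theta> \<in> B"
      then show "cmod (?u \<theta>) \<le> s"
        using s[OF \<theta>] subsetD[OF bounded_tests_subset[OF X B] \<theta>] by (simp add: delta_derivative_def)
    qed
    finally show ?thesis .
  qed
  have "(transposed ^^ m) \<phi> y = 0" if "m \<ge> 1" "y \<notin> L" for m y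
  proof -
    have "cmod (iterated_partial [] \<theta> y) \<le> 0" if "\<theta> \<in> B" for \<theta>
      using subsetD[OF L(3) that] \<open>y \<notin> L\<close> by (simp add: test_functions_on_iff[OF compact_imp_closed[OF L(1)]])
    from est[OF \<open>m \<ge> 1\<close> this] show ?thesis by simp
  qed
  moreover have "\<exists>M. \<forall>m\<ge>1. \<forall>y. jet_bound n ((transposed ^^ m) \<phi>) y M" for n
  proof -
    obtain M where M: "\<forall>\<theta>\<in>B. \<forall>x. jet_bound n \<theta> x M" using jets[rule_format, of n] by (elim exE)
    have "jet_bound n ((transposed ^^ m) \<phi>) y (c * M)" if "m \<ge> 1" for m y
      unfolding jet_bound_def
    proof (intro allI impI)
      fix "is" :: "'n list" assume "length is \<le> n"
      then show "cmod (iterated_partial is ((transposed ^^ m) \<phi>) y) \<le> c * M"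
        using M by (intro est[OF that]) (simp add: jet_bound_def)
    qed
    then show ?thesis by (intro exI[of _ "c * M"]) simp
  qed
  ultimately show ?thesis using L(1,2) by (intro exI[of _ L]) simp
qed

text \<open>
  A bump function that equals \<open>1\<close> on a ball about \<open>x\<close> makes the orbit bounds into statements about \<open>\<psi>\<^sup>m\<close> and
  \<open>W\<^sub>m\<close> on that ball; compactness reduces an arbitrary compact set to finitely many balls.
\<close>

lemma power_bounded_imp:
  assumes pb: "power_bounded (distributions X) (strong_dual_topology X) C"
  shows "stable_orbits X \<psi> \<and> weight_condition X w \<psi>"
proof -
  have "\<forall>x\<in>X. \<exists>r. \<exists>\<phi>. 0 < r \<and> ball x r \<subseteq> X \<and> \<phi> \<in> test_functions X \<and> (\<forall>z\<in>ball x r. \<phi> z = 1)"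
    using local_bump_test_function[OF X] by simp
  then have "\<exists>r. \<forall>x\<in>X. \<exists>\<phi>. 0 < r x \<and> ball x (r x) \<subseteq> X \<and> \<phi> \<in> test_functions X \<and> (\<forall>z\<in>ball x (r x). \<phi> z = 1)"
    by (rule bchoice)
  then obtain r where "\<forall>x\<in>X. \<exists>\<phi>. 0 < r x \<and> ball x (r x) \<subseteq> X \<and> \<phi> \<in> test_functions X \<and> (\<forall>z\<in>ball x (r x). \<phi> z = 1)"
    by (elim exE)
  then have "\<exists>\<phi>. \<forall>x\<in>X. 0 < r x \<and> ball x (r x) \<subseteq> X \<and> \<phi> x \<in> test_functions X \<and> (\<forall>z\<in>ball x (r x). \<phi> x z = 1)"
    by (rule bchoice)
  then obtain \<phi> where r\<phi>: "\<forall>x\<in>X. 0 < r x \<and> ball x (r x) \<subseteq> X \<and> \<phi> x \<in> test_functions X \<and> (\<forall>z\<in>ball x (r x). \<phi> x z = 1)"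
    by (elim exE)
  have r: "0 < r x" "ball x (r x) \<subseteq> X" if "x \<in> X" for x using r\<phi> that by simp_all
  have \<phi>: "\<phi> x \<in> test_functions X" "\<And>z. z \<in> ball x (r x) \<Longrightarrow> \<phi> x z = 1" if "x \<in> X" for x
    using r\<phi> that by simp_all
  have cover: "\<exists>F. finite F \<and> F \<subseteq> K \<and> K \<subseteq> (\<Union>x\<in>F. ball x (r x))" if K: "compact K" "K \<subseteq> X" for K
  proof -
    have "K \<subseteq> (\<Union>x\<in>K. ball x (r x))" using r(1) K(2) by force
    from compactE_image[OF K(1) _ this] show ?thesis by (metis open_ball)
  qed
  have orbit: "\<exists>L. compact L \<and> L \<subseteq> X \<and> (\<forall>m\<ge>1. (\<psi> ^^ m) ` ball x (r x) \<subseteq> L)" if x: "x \<in> X" for x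
  proof -
    from power_bounded_orbit_bounds[OF pb \<phi>(1)[OF x]]
    obtain L where L: "compact L" "L \<subseteq> X" and zero: "\<forall>m\<ge>1. \<forall>y. y \<notin> L \<longrightarrow> (transposed ^^ m) (\<phi> x) y = 0"
      by (elim exE conjE)
    have "(\<psi> ^^ m) z \<in> L" if m: "m \<ge> 1" and z: "z \<in> ball x (r x)" for m z
    proof (rule ccontr)
      assume nL: "(\<psi> ^^ m) z \<notin> L"
      \<comment> \<open>This open set is not empty, so the weight product is nonzero at one of its points.\<close>
      let ?U = "{z \<in> ball x (r x). (\<psi> ^^ m) z \<notin> L}"
      have "open ?U"
        using continuous_open_preimage[OF continuous_on_subset[OF iterate_continuous r(2)[OF x]] open_ball
            open_Compl[OF compact_imp_closed[OF L(1)]], of m]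
        by (simp add: vimage_def Int_def)
      moreover have "?U \<subseteq> X" using r(2)[OF x] by blast
      moreover have "?U \<noteq> {}" using z nL by blast
      ultimately have "\<exists>z'\<in>?U. weight_product w \<psi> m z' \<noteq> 0" by (rule weight_product_nonzero_dense)
      then obtain z' where z': "z' \<in> ball x (r x)" "(\<psi> ^^ m) z' \<notin> L" "weight_product w \<psi> m z' \<noteq> 0" by blast
      have "z' \<in> X" using z'(1) r(2)[OF x] by blast
      from iterated_transposed_image[OF this, of m "\<phi> x"]
      have "(transposed ^^ m) (\<phi> x) ((\<psi> ^^ m) z') \<noteq> 0" using z'(3) \<phi>(2)[OF x z'(1)] by simp
      moreover have "(transposed ^^ m) (\<phi> x) ((\<psi> ^^ m) z') = 0" by (rule zero[rule_format, OF m z'(2)])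
      ultimately show False by simp
    qed
    then show ?thesis using L by (intro exI[of _ L]) auto
  qed
  have "stable_orbits X \<psi>"
    unfolding stable_orbits_def
  proof (intro allI impI)
    fix K assume "compact K \<and> K \<subseteq> X"
    then have K: "compact K" "K \<subseteq> X" by auto
    obtain F where F: "finite F" "F \<subseteq> K" "K \<subseteq> (\<Union>x\<in>F. ball x (r x))" using cover[OF K] by (elim exE conjE)
    have "\<exists>L. \<forall>x\<in>F. compact (L x) \<and> L x \<subseteq> X \<and> (\<forall>m\<ge>1. (\<psi> ^^ m) ` ball x (r x) \<subseteq> L x)"
      using orbit F(2) K(2) by (intro bchoice) blast
    then obtain L where L: "\<forall>x\<in>F. compact (L x) \<and> L x \<subseteq> X \<and> (\<forall>m\<ge>1. (\<psi> ^^ m) ` ball x (r x) \<subseteq> L x)"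
      by (elim exE)
    have "compact (\<Union>x\<in>F. L x)" using F(1) L by (intro compact_UN) auto
    moreover have "(\<Union>x\<in>F. L x) \<subseteq> X" using L by blast
    moreover have "(\<psi> ^^ m) ` K \<subseteq> (\<Union>x\<in>F. L x)" if m: "m \<ge> 1" for m
    proof
      fix y assume "y \<in> (\<psi> ^^ m) ` K"
      then obtain z where z: "z \<in> K" "y = (\<psi> ^^ m) z" by blast
      then obtain x where x: "x \<in> F" "z \<in> ball x (r x)" using F(3) by blast
      then show "y \<in> (\<Union>x\<in>F. L x)" using L m z(2) by blast
    qed
    ultimately show "\<exists>L. compact L \<and> L \<subseteq> X \<and> (\<forall>m\<ge>1. (\<psi> ^^ m) ` K \<subseteq> L)"
      by (intro exI[of _ "\<Union>x\<in>F. L x"]) simp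
  qed
  moreover have "weight_condition X w \<psi>"
    unfolding weight_condition_def SUP_Cn_norm_finite_iff
  proof (intro allI impI)
    fix K n assume "compact K \<and> K \<subseteq> X"
    then have K: "compact K" "K \<subseteq> X" by auto
    obtain F where F: "finite F" "F \<subseteq> K" "K \<subseteq> (\<Union>x\<in>F. ball x (r x))" using cover[OF K] by (elim exE conjE)
    have "\<exists>M. \<forall>m\<ge>1. \<forall>y. jet_bound n ((transposed ^^ m) (\<phi> x)) y M" if x: "x \<in> F" for x
    proof -
      have "x \<in> X" using x F(2) K(2) by blast
      from power_bounded_orbit_bounds[OF pb \<phi>(1)[OF this]] show ?thesis by (elim exE conjE) (erule spec)
    qed
    then have "\<exists>M. \<forall>x\<in>F. \<forall>m\<ge>1. \<forall>y. jet_bound n ((transposed ^^ m) (\<phi> x)) y (M x)" by (intro bchoice ballI)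
    then obtain M where M: "\<forall>x\<in>F. \<forall>m\<ge>1. \<forall>y. jet_bound n ((transposed ^^ m) (\<phi> x)) y (M x)" by (elim exE)
    define N where "N = (\<Sum>x\<in>F. \<bar>M x\<bar>)"
    have N: "0 \<le> N" by (simp add: N_def sum_nonneg)
    have "jet_bound n (weight_product w \<psi> m \<circ> inverse_iterate m) y N" if m: "m \<ge> 1" and y: "y \<in> (\<psi> ^^ m) ` K" for m y
    proof -
      obtain z where z: "z \<in> K" "y = (\<psi> ^^ m) z" using y by blast
      obtain x where x: "x \<in> F" "z \<in> ball x (r x)" using F(3) z(1) by blast
      have xX: "x \<in> X" using x(1) F(2) K(2) by blast
      have "M x \<le> N"
        unfolding N_def using member_le_sum[of x F "\<lambda>x. \<bar>M x\<bar>"] x(1) F(1) by force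
      then have "jet_bound n ((transposed ^^ m) (\<phi> x)) y N"
        using jet_bound_mono[OF M[rule_format, OF x(1) m]] by simp
      then show ?thesis
      proof (rule jet_bound_cong[rotated 3])
        show "open ((\<psi> ^^ m) ` ball x (r x))" by (rule open_iterate_image[OF open_ball r(2)[OF xX]])
        show "y \<in> (\<psi> ^^ m) ` ball x (r x)" using x(2) z(2) by blast
        fix y' assume "y' \<in> (\<psi> ^^ m) ` ball x (r x)"
        then obtain z' where z': "z' \<in> ball x (r x)" "y' = (\<psi> ^^ m) z'" by blast
        have "z' \<in> X" using z'(1) r(2)[OF xX] by blast
        then show "(transposed ^^ m) (\<phi> x) y' = (weight_product w \<psi> m \<circ> inverse_iterate m) y'"
          using \<phi>(2)[OF xX z'(1)] by (simp add: z'(2) iterated_transposed_image)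
      qed
    qed
    then show "\<exists>M\<ge>0. \<forall>m\<ge>1. \<forall>y\<in>(\<psi> ^^ m) ` K. jet_bound n (weight_product w \<psi> m \<circ> inverse_iterate m) y M"
      using N by (intro exI[of _ N]) simp
  qed
  ultimately show ?thesis by simp
qed

end

section \<open>Power bounded weighted composition operators\<close>

theorem theorem2p11:
  fixes X :: "(real^'n::finite) set"
    and w :: "real^'n \<Rightarrow> complex"
    and \<psi> :: "real^'n \<Rightarrow> real^'n"
    and C :: "((real^'n \<Rightarrow> complex) \<Rightarrow> complex) \<Rightarrow> ((real^'n \<Rightarrow> complex) \<Rightarrow> complex)"
  assumes "open X"
    and "smooth_on X w"
    and "X \<subseteq> closure {x \<in> X. w x \<noteq> 0}"
    and "\<psi> ` X \<subseteq> X"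
    and "smooth_on X \<psi>"
    and "inj_on \<psi> X"
    and "\<forall>x\<in>X. det (jacobian \<psi> (at x)) \<noteq> 0"
    and "weighted_composition_operator X w \<psi> C"
  shows "(stable_orbits X \<psi> \<and> weight_condition X w \<psi> \<and> inverse_condition X \<psi> \<longrightarrow>
            power_bounded (distributions X) (strong_dual_topology X) C) \<and>
         (power_bounded (distributions X) (strong_dual_topology X) C \<longrightarrow>
            stable_orbits X \<psi> \<and> weight_condition X w \<psi>)"
proof -
  interpret weighted_composition X w \<psi> C
    using assms by unfold_locales
  show ?thesis using power_bounded_if power_bounded_imp by blast
qed

end
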